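(* Let $\Gamma=N\rtimes_\sigma H$ with $N$ a discrete abelian group and $H$ a finite group of order $\kappa$. Let $\mathsf{f}\in\ell^2(\Gamma)$ and let $\mathbf{F}(\xi)$, $\xi\in\widehat{N}$, be its associated $\kappa\times\kappa$ transfer matrix. The following statements are equivalent: (a) The system $\{L_\gamma\mathsf{f}\}_{\gamma\in\Gamma}$ is a Riesz basis for $\ell^2(\Gamma)$. (b) The entries of $\mathbf{F}(\xi)$ belong to $L^\infty(\widehat{N})$, and $\operatorname*{ess\,inf}_{\xi\in\widehat{N}}|\det\mathbf{F}(\xi)|>0$. In this case the optimal Riesz bounds are $$A_{\mathsf{f}}:=\operatorname*{ess\,inf}_{\xi\in\widehat{N}}\lambda_{\min}[\mathbf{F}^*(\xi)\mathbf{F}(\xi)]\quad\text{and}\quad B_{\mathsf{f}}:=\operatorname*{ess\,sup}_{\xi\in\widehat{N}}\lambda_{\max}[\mathbf{F}^*(\xi)\mathbf{F}(\xi)].$$ Moreover, its dual Riesz basis is $\{L_\gamma\mathsf{g}\}_{\gamma\in\Gamma}$, where $\mathsf{g}$ is the unique element of $\ell^2(\Gamma)$ satisfying $$\mathbf{F}^*(\xi)\,\mathcal{T}_\Gamma\mathsf{g}(\xi)=\begin{bmatrix}1&0&\cdots&0\end{bmatrix}^\top\quad\text{for a.e. }\xi\in\widehat{N}.$$ Equivalently, $\mathbf{G}(\xi)=(\mathbf{F}^*(\xi))^{-1}$ for a.e. $\xi\in\widehat{N}$, where $\mathbf{G}(\xi)$ is the transfer matrix associated to $\mathsf{g}$.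
   Context: Setting: $(N,+)$ is a discrete abelian group, $(H,\cdot)$ is a finite group of order $\kappa$, $\sigma:H\to\mathrm{Aut}(N)$ is a homomorphism, and $\Gamma=N\rtimes_\sigma H$ is the set $N\times H$ with product $(n,h)(m,l)=(n+\sigma(h)(m),hl)$. The left regular representation of $\Gamma$ on the complex Hilbert space $\ell^2(\Gamma)$ is $L_\gamma\mathsf{f}(\eta)=\mathsf{f}(\gamma^{-1}\eta)$. $\widehat{N}$ is the (compact) dual group of $N$, with Haar measure normalized so that the Fourier transform $\widehat{\mathsf{a}}(\xi)=\sum_{n\in N}\mathsf{a}(n)\langle -n,\xi\rangle$, defined for $\mathsf{a}\in\ell^1(N)$, extends to a unitary operator $\ell^2(N)\to L^2(\widehat{N})$. Transfer matrix: for $\mathsf{f}\in\ell^2(\Gamma)$ and $h,l\in H$ put $\mathsf{f}_{h,l}(n):=\mathsf{f}[(0,l)^{-1}(n,h)]$, $n\in N$. The transfer matrix of $\mathsf{f}$ is $\mathbf{F}(\xi)=[\,\widehat{\mathsf{f}}_{h,l}(\xi)\,]_{h,l\in H}$ (row index $h$, column index $l$), and $\mathbf{F}^*(\xi)$ is its conjugate transpose. The elements of $H$ are ordered so that the first one is the identity $1_H$. The map $\mathcal{T}_\Gamma:\ell^2(\Gamma)\to L^2_\kappa(\widehat{N})=L^2(\widehat N)\times\cdots\times L^2(\widehat N)$ ($\kappa$ times) is $\mathcal{T}_\Gamma\mathsf{a}=[\,\widehat{\mathsf{a}}_h\,]_{h\in H}$ (a column vector), where $\mathsf{a}_h(n)=\mathsf{a}(n,h)$.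 $\lambda_{\min}$ and $\lambda_{\max}$ denote the smallest and largest eigenvalue. A Riesz basis of a Hilbert space is the image of an orthonormal basis under a bounded invertible operator; its optimal Riesz bounds are the largest $A$ and smallest $B$ with $A\|\mathsf{a}\|^2\le\|\sum_\gamma\mathsf{a}(\gamma)x_\gamma\|^2\le B\|\mathsf{a}\|^2$ for all $\mathsf{a}\in\ell^2(\Gamma)$; its dual Riesz basis is the unique biorthogonal Riesz basis. *)

theory Defs
  imports "HOL-Analysis.Analysis" "HOL-Probability.Essential_Supremum"
begin

section \<open>Square-summable functions on a set\<close>

definition ell2 :: "('a \<Rightarrow> complex) set" where
  "ell2 = {f. (\<lambda>x. (cmod (f x))\<^sup>2) summable_on UNIV}"

definition ell2_norm :: "('a \<Rightarrow> complex) \<Rightarrow> real" where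
  "ell2_norm f = sqrt (\<Sum>\<^sub>\<infinity>x. (cmod (f x))\<^sup>2)"

definition ell2_inner :: "('a \<Rightarrow> complex) \<Rightarrow> ('a \<Rightarrow> complex) \<Rightarrow> complex" where
  "ell2_inner f g = (\<Sum>\<^sub>\<infinity>x. f x * cnj (g x))"

definition ell1 :: "('a \<Rightarrow> complex) set" where
  "ell1 = {f. (\<lambda>x. cmod (f x)) summable_on UNIV}"

text \<open>Unconditional convergence of a series of functions in the norm of \<open>ell2\<close>.\<close>

definition ell2_has_sum :: "('i \<Rightarrow> 'a \<Rightarrow> complex) \<Rightarrow> ('a \<Rightarrow> complex) \<Rightarrow> bool" where
  "ell2_has_sum x s \<longleftrightarrow> s \<in> ell2 \<and>
     ((\<lambda>F. ell2_norm (\<lambda>a. (\<Sum>i\<in>F. x i a) - s a)) \<longlongrightarrow> 0) (finite_subsets_at_top UNIV)"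

section \<open>Riesz bases of \<open>ell2\<close>\<close>

definition ell2_orthonormal_basis :: "('i \<Rightarrow> 'a \<Rightarrow> complex) \<Rightarrow> bool" where
  "ell2_orthonormal_basis e \<longleftrightarrow>
     (\<forall>i. e i \<in> ell2) \<and>
     (\<forall>i j. ell2_inner (e i) (e j) = (if i = j then 1 else 0)) \<and>
     (\<forall>f\<in>ell2. (\<forall>i. ell2_inner f (e i) = 0) \<longrightarrow> f = (\<lambda>_. 0))"

text \<open>The last two conjuncts say that the operator and its inverse are bounded.\<close>

definition ell2_bounded_invertible ::
  "(('a \<Rightarrow> complex) \<Rightarrow> ('a \<Rightarrow> complex)) \<Rightarrow> bool" where
  "ell2_bounded_invertible T \<longleftrightarrow>
     bij_betw T ell2 ell2 \<and>
     (\<forall>f\<in>ell2. \<forall>g\<in>ell2. T (\<lambda>x. f x + g x) = (\<lambda>x. T f x + T g x)) \<and>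
     (\<forall>c. \<forall>f\<in>ell2. T (\<lambda>x. c * f x) = (\<lambda>x. c * T f x)) \<and>
     (\<exists>C. \<forall>f\<in>ell2. ell2_norm (T f) \<le> C * ell2_norm f) \<and>
     (\<exists>C. \<forall>f\<in>ell2. ell2_norm f \<le> C * ell2_norm (T f))"

definition riesz_basis :: "('i \<Rightarrow> 'a \<Rightarrow> complex) \<Rightarrow> bool" where
  "riesz_basis x \<longleftrightarrow>
     (\<exists>e T. ell2_orthonormal_basis e \<and> ell2_bounded_invertible T \<and> (\<forall>i. x i = T (e i)))"

definition riesz_bounds :: "('i \<Rightarrow> 'a \<Rightarrow> complex) \<Rightarrow> real \<Rightarrow> real \<Rightarrow> bool" where
  "riesz_bounds x A B \<longleftrightarrow>
     (\<forall>a\<in>ell2. \<exists>s. ell2_has_sum (\<lambda>i y. a i * x i y) s \<and>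
        A * (ell2_norm a)\<^sup>2 \<le> (ell2_norm s)\<^sup>2 \<and> (ell2_norm s)\<^sup>2 \<le> B * (ell2_norm a)\<^sup>2)"

definition optimal_riesz_bounds :: "('i \<Rightarrow> 'a \<Rightarrow> complex) \<Rightarrow> real \<Rightarrow> real \<Rightarrow> bool" where
  "optimal_riesz_bounds x A B \<longleftrightarrow>
     riesz_bounds x A B \<and> (\<forall>A' B'. riesz_bounds x A' B' \<longrightarrow> A' \<le> A \<and> B \<le> B')"

definition biorthogonal :: "('i \<Rightarrow> 'a \<Rightarrow> complex) \<Rightarrow> ('i \<Rightarrow> 'a \<Rightarrow> complex) \<Rightarrow> bool" where
  "biorthogonal x y \<longleftrightarrow> (\<forall>i j. ell2_inner (x i) (y j) = (if i = j then 1 else 0))"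

text \<open>\<open>y\<close> is the unique Riesz basis that is biorthogonal to \<open>x\<close>.\<close>

definition is_dual_riesz_basis ::
  "('i \<Rightarrow> 'a \<Rightarrow> complex) \<Rightarrow> ('i \<Rightarrow> 'a \<Rightarrow> complex) \<Rightarrow> bool" where
  "is_dual_riesz_basis x y \<longleftrightarrow>
     riesz_basis y \<and> biorthogonal x y \<and>
     (\<forall>y'. riesz_basis y' \<and> biorthogonal x y' \<longrightarrow> y' = y)"

section \<open>The semidirect product and its left regular representation\<close>

text \<open>
  The finite group \<open>H\<close> is a type of class \<open>group_add\<close>. This class does not assume
  commutativity, so the product of \<open>H\<close> is written \<open>+\<close>, its identity \<open>0\<close> and the inverse of
  \<open>h\<close> as \<open>- h\<close>.
\<close>

definition aut_action :: "('h::group_add \<Rightarrow> 'n::ab_group_add \<Rightarrow> 'n) \<Rightarrow> bool" where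
  "aut_action \<sigma> \<longleftrightarrow>
     (\<forall>h. bij (\<sigma> h) \<and> (\<forall>m n. \<sigma> h (m + n) = \<sigma> h m + \<sigma> h n)) \<and>
     (\<forall>h l. \<sigma> (h + l) = \<sigma> h \<circ> \<sigma> l)"

fun sd_mult :: "('h::group_add \<Rightarrow> 'n::ab_group_add \<Rightarrow> 'n) \<Rightarrow> 'n \<times> 'h \<Rightarrow> 'n \<times> 'h \<Rightarrow> 'n \<times> 'h" where
  "sd_mult \<sigma> (n, h) (m, l) = (n + \<sigma> h m, h + l)"

fun sd_inv :: "('h::group_add \<Rightarrow> 'n::ab_group_add \<Rightarrow> 'n) \<Rightarrow> 'n \<times> 'h \<Rightarrow> 'n \<times> 'h" where
  "sd_inv \<sigma> (n, h) = (\<sigma> (- h) (- n), - h)"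

lemma aut_action_zero:
  assumes "aut_action \<sigma>"
  shows "\<sigma> 0 n = n" and "\<sigma> h 0 = 0"
proof -
  have "\<sigma> 0 (\<sigma> 0 n) = \<sigma> 0 n" and "inj (\<sigma> 0)"
    using assms unfolding aut_action_def bij_def by (metis add_0 comp_apply)+
  then show "\<sigma> 0 n = n" by (simp add: inj_eq)
  have "\<sigma> h (0 + 0) = \<sigma> h 0 + \<sigma> h 0" using assms unfolding aut_action_def by blast
  then show "\<sigma> h 0 = 0" by simp
qed

lemma sd_mult_assoc:
  assumes "aut_action \<sigma>"
  shows "sd_mult \<sigma> (sd_mult \<sigma> x y) z = sd_mult \<sigma> x (sd_mult \<sigma> y z)"
  using assms by (cases x; cases y; cases z) (auto simp: aut_action_def add.assoc)

lemma sd_mult_one: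
  assumes "aut_action \<sigma>"
  shows "sd_mult \<sigma> (0, 0) x = x" and "sd_mult \<sigma> x (0, 0) = x"
  by (cases x; simp add: aut_action_zero[OF assms])+

lemma sd_mult_inv:
  assumes "aut_action \<sigma>"
  shows "sd_mult \<sigma> (sd_inv \<sigma> x) x = (0, 0)" and "sd_mult \<sigma> x (sd_inv \<sigma> x) = (0, 0)"
proof -
  obtain n h where x: "x = (n, h)" by (cases x)
  have add: "\<sigma> k (a + b) = \<sigma> k a + \<sigma> k b" and comp: "\<sigma> k (\<sigma> l a) = \<sigma> (k + l) a" for k l a b
    using assms unfolding aut_action_def by auto
  show "sd_mult \<sigma> (sd_inv \<sigma> x) x = (0, 0)"
    by (simp add: x add[symmetric] aut_action_zero[OF assms])
  show "sd_mult \<sigma> x (sd_inv \<sigma> x) = (0, 0)"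
    by (simp add: x comp aut_action_zero[OF assms])
qed

definition left_reg ::
  "('h::group_add \<Rightarrow> 'n::ab_group_add \<Rightarrow> 'n) \<Rightarrow> 'n \<times> 'h \<Rightarrow> ('n \<times> 'h \<Rightarrow> complex) \<Rightarrow> 'n \<times> 'h \<Rightarrow> complex"
  where "left_reg \<sigma> \<gamma> f = (\<lambda>\<eta>. f (sd_mult \<sigma> (sd_inv \<sigma> \<gamma>) \<eta>))"

section \<open>The dual group, its Haar measure and the Fourier transform\<close>

text \<open>
  Since \<open>N\<close> is discrete, every character is continuous, and the topology of the compact dual
  group is that of pointwise convergence, i.e. the subspace topology inherited from the
  product topology on \<open>'n \<Rightarrow> complex\<close>. The pairing of \<open>n\<close> with \<open>\<xi>\<close> is \<open>\<xi> n\<close>.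
\<close>

definition dual_group :: "('n::ab_group_add \<Rightarrow> complex) set" where
  "dual_group = {\<xi>. (\<forall>n. cmod (\<xi> n) = 1) \<and> (\<forall>m n. \<xi> (m + n) = \<xi> m * \<xi> n)}"

text \<open>
  The Haar measure as a translation-invariant regular Borel measure; \<open>N\<close> may be uncountable,
  so regularity is not automatic. Total mass \<open>1\<close> is the normalization for which the Fourier
  transform is unitary.
\<close>

definition dual_haar_measure :: "('n::ab_group_add \<Rightarrow> complex) measure \<Rightarrow> bool" where
  "dual_haar_measure M \<longleftrightarrow>
     sets M = sets (restrict_space borel dual_group) \<and>
     emeasure M dual_group = 1 \<and>
     (\<forall>\<xi>\<in>dual_group. \<forall>A\<in>sets M. emeasure M ((\<lambda>\<psi> n. \<xi> n * \<psi> n) ` A) = emeasure M A) \<and>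
     (\<forall>A\<in>sets M. emeasure M A =
        (INF U\<in>{U. openin (top_of_set dual_group) U \<and> A \<subseteq> U}. emeasure M U)) \<and>
     (\<forall>U. openin (top_of_set dual_group) U \<longrightarrow>
        emeasure M U = (SUP K\<in>{K. compact K \<and> K \<subseteq> U}. emeasure M K))"

definition fourier_ell1 :: "('n::ab_group_add \<Rightarrow> complex) \<Rightarrow> ('n \<Rightarrow> complex) \<Rightarrow> complex" where
  "fourier_ell1 a \<xi> = (\<Sum>\<^sub>\<infinity>n. a n * \<xi> (- n))"

text \<open>
  The extension by continuity from \<open>ell1\<close> to \<open>ell2\<close>: the transform of \<open>a\<close> is the limit, in the
  \<open>L\<^sup>2\<close> norm, of the transforms of every sequence in \<open>ell1\<close> that converges to \<open>a\<close> in \<open>ell2\<close>.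
\<close>

definition is_fourier ::
  "('n::ab_group_add \<Rightarrow> complex) measure \<Rightarrow> ('n \<Rightarrow> complex) \<Rightarrow> (('n \<Rightarrow> complex) \<Rightarrow> complex) \<Rightarrow> bool" where
  "is_fourier M a \<phi> \<longleftrightarrow>
     \<phi> \<in> borel_measurable M \<and> integrable M (\<lambda>\<xi>. (cmod (\<phi> \<xi>))\<^sup>2) \<and>
     (\<forall>b :: nat \<Rightarrow> 'n \<Rightarrow> complex.
        (\<forall>k. b k \<in> ell1) \<and> (\<lambda>k. ell2_norm (\<lambda>n. b k n - a n)) \<longlonglongrightarrow> 0 \<longrightarrow>
        (\<lambda>k. \<integral>\<^sup>+ \<xi>. ennreal ((cmod (fourier_ell1 (b k) \<xi> - \<phi> \<xi>))\<^sup>2) \<partial>M) \<longlonglongrightarrow> 0)"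

text \<open>
  A representative, determined up to null sets, of the class of the transform of \<open>a\<close>;
  meaningful only for \<open>a\<close> in \<open>ell2\<close>.
\<close>

definition fourier ::
  "('n::ab_group_add \<Rightarrow> complex) measure \<Rightarrow> ('n \<Rightarrow> complex) \<Rightarrow> ('n \<Rightarrow> complex) \<Rightarrow> complex" where
  "fourier M a = (SOME \<phi>. is_fourier M a \<phi>)"

section \<open>Transfer matrices\<close>

definition transfer_matrix ::
  "('n::ab_group_add \<Rightarrow> complex) measure \<Rightarrow> ('h::{finite,group_add} \<Rightarrow> 'n \<Rightarrow> 'n) \<Rightarrow>
   ('n \<times> 'h \<Rightarrow> complex) \<Rightarrow> ('n \<Rightarrow> complex) \<Rightarrow> complex^('h::{finite,group_add})^('h::{finite,group_add})" where
  "transfer_matrix M \<sigma> f \<xi> =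
     (\<chi> h l. fourier M (\<lambda>n. f (sd_mult \<sigma> (sd_inv \<sigma> (0, l)) (n, h))) \<xi>)"

definition transfer_vector ::
  "('n::ab_group_add \<Rightarrow> complex) measure \<Rightarrow> ('n \<times> 'h::finite \<Rightarrow> complex) \<Rightarrow>
   ('n \<Rightarrow> complex) \<Rightarrow> complex^'h" where
  "transfer_vector M a \<xi> = (\<chi> h. fourier M (\<lambda>n. a (n, h)) \<xi>)"

definition conj_transpose :: "complex^'m^'n \<Rightarrow> complex^'n^'m" where
  "conj_transpose A = (\<chi> i j. cnj (A $ j $ i))"

definition eigenvalue_of :: "complex^'h^'h \<Rightarrow> complex \<Rightarrow> bool" where
  "eigenvalue_of A c \<longleftrightarrow> (\<exists>v. v \<noteq> 0 \<and> A *v v = c *s v)"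

text \<open>Used for Hermitian matrices only, all of whose eigenvalues are real.\<close>

definition lambda_min :: "complex^'h^'h \<Rightarrow> real" where
  "lambda_min A = Min {t. eigenvalue_of A (complex_of_real t)}"

definition lambda_max :: "complex^'h^'h \<Rightarrow> real" where
  "lambda_max A = Max {t. eigenvalue_of A (complex_of_real t)}"

section \<open>Essential infimum and essential boundedness\<close>

definition essinf :: "'a measure \<Rightarrow> ('a \<Rightarrow> ereal) \<Rightarrow> ereal" where
  "essinf M f = - esssup M (\<lambda>x. - f x)"

definition ess_bounded :: "'a measure \<Rightarrow> ('a \<Rightarrow> complex) \<Rightarrow> bool" where
  "ess_bounded M f \<longleftrightarrow> f \<in> borel_measurable M \<and> esssup M (\<lambda>x. ereal (cmod (f x))) < \<infinity>"

end

theory Submission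
  imports Defs "HOL-Probability.Probability_Measure"
begin

text \<open>
  The map \<open>\<T>\<^sub>\<Gamma>\<close> is a unitary operator from \<open>\<ell>\<^sup>2(\<Gamma>)\<close> onto \<open>L\<^sup>2\<^sub>\<kappa>\<close> of the dual group. Writing
  \<open>(m, l) = (m, 0) (0, l)\<close>, translation by \<open>(m, l)\<close> turns \<open>\<T>\<^sub>\<Gamma> f\<close> into the \<open>l\<close>-th column of \<open>F\<close> times the
  character \<open>\<xi> (- m)\<close>, so the synthesis operator of the system of translates of \<open>f\<close> is, on the Fourier
  side, pointwise multiplication by \<open>F(\<xi>)\<close>. The translates form a Riesz basis iff this operator is
  bounded and invertible, i.e. iff \<open>A |v|\<^sup>2 \<le> |F(\<xi>) v|\<^sup>2 \<le> B |v|\<^sup>2\<close> for all \<open>v\<close> and almost all \<open>\<xi>\<close> with some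
  \<open>A > 0\<close>; the optimal constants are the essential bounds of the extreme eigenvalues of \<open>F\<^sup>* F\<close>, and by
  Cramer's rule such bounds exist iff the entries of \<open>F\<close> are essentially bounded and \<open>|det F|\<close> is
  essentially bounded away from zero. If \<open>F\<^sup>* \<T>\<^sub>\<Gamma> g\<close> is the first unit vector, then the translates of
  \<open>f\<close> and \<open>g\<close> are biorthogonal, which says that \<open>F\<^sup>* G\<close> and the identity matrix have the same
  Fourier coefficients.

  Unitarity of \<open>\<T>\<^sub>\<Gamma>\<close> rests on the orthonormality of the characters (which separate the points of \<open>N\<close>, by
  Zorn's lemma) and on their completeness, which follows from the Stone--Weierstrass theorem and the
  regularity of the Haar measure.
\<close>

section \<open>Square-integrable and square-summable functions\<close>

text \<open>\<open>N\<close> may be uncountable, and this shapes the analysis. Sums over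
  \<open>N\<close> are limits along the net of finite subsets, while Fatou's lemma and statements
  a.e. need sequences; so sequences of finite sets are extracted along which squared errors are at
  most \<open>(1/4) ^ k\<close>, a rate that turns convergence in norm into convergence a.e. The
  dual group need not be metrizable, so indicator functions are approximated by means of outer
  regularity and Urysohn's lemma. The Fourier transform is only a chosen representative and is
  handled through its Fourier coefficients, which determine it up to null sets. At the outset the
  entries of \<open>F\<close> are merely square-integrable, so multiplication by \<open>F\<close> is
  not yet known to be bounded; its identity with the synthesis operator is obtained on unit vectors
  and passed to the limit pointwise. For the optimal bounds it is not enough that some constants
  exist: norm inequalities and pointwise matrix inequalities have to be equivalent with the same,
  arbitrary real constants.\<close>

definition L2 :: "'x measure \<Rightarrow> ('x \<Rightarrow> 'b::euclidean_space) set" where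
  "L2 M = {\<phi>. \<phi> \<in> borel_measurable M \<and> integrable M (\<lambda>x. (norm (\<phi> x))\<^sup>2)}"

lemma L2_I: "\<phi> \<in> borel_measurable M \<Longrightarrow> integrable M (\<lambda>x. (norm (\<phi> x))\<^sup>2) \<Longrightarrow> \<phi> \<in> L2 M"
  and L2_measurable[measurable_dest]: "\<phi> \<in> L2 M \<Longrightarrow> \<phi> \<in> borel_measurable M"
  and L2_integrable: "\<phi> \<in> L2 M \<Longrightarrow> integrable M (\<lambda>x. (norm (\<phi> x))\<^sup>2)"
  by (auto simp: L2_def)

lemma norm_add_sq_le: "(norm (x + y))\<^sup>2 \<le> 2 * (norm x)\<^sup>2 + 2 * (norm (y::'b::real_normed_vector))\<^sup>2"
proof -
  have "(norm (x + y))\<^sup>2 \<le> (norm x + norm y)\<^sup>2"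
    by (simp add: norm_triangle_ineq power_mono)
  also have "\<dots> \<le> 2 * (norm x)\<^sup>2 + 2 * (norm y)\<^sup>2"
    using sum_squares_bound[of "norm x" "norm y"] by (simp add: power2_sum)
  finally show ?thesis .
qed

lemma norm_diff_sq_le: "(norm (x - y))\<^sup>2 \<le> 2 * (norm x)\<^sup>2 + 2 * (norm (y::'b::real_normed_vector))\<^sup>2"
  using norm_add_sq_le[of x "- y"] by simp

lemma L2_dominated:
  assumes "\<phi> \<in> borel_measurable M" "integrable M g" "AE x in M. (norm (\<phi> x))\<^sup>2 \<le> g x"
  shows "\<phi> \<in> L2 M"
  using assms(1) by (intro L2_I Bochner_Integration.integrable_bound[OF assms(2)])
    (use assms(3) in \<open>auto elim!: eventually_mono\<close>)

lemma L2_add: "\<phi> \<in> L2 M \<Longrightarrow> \<psi> \<in> L2 M \<Longrightarrow> (\<lambda>x. \<phi> x + \<psi> x) \<in> L2 M"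
  by (rule L2_dominated[where g = "\<lambda>x. 2 * (norm (\<phi> x))\<^sup>2 + 2 * (norm (\<psi> x))\<^sup>2"])
    (auto simp: norm_add_sq_le L2_integrable)

lemma L2_diff: "\<phi> \<in> L2 M \<Longrightarrow> \<psi> \<in> L2 M \<Longrightarrow> (\<lambda>x. \<phi> x - \<psi> x) \<in> L2 M"
  by (rule L2_dominated[where g = "\<lambda>x. 2 * (norm (\<phi> x))\<^sup>2 + 2 * (norm (\<psi> x))\<^sup>2"])
    (auto simp: norm_diff_sq_le L2_integrable)

lemma L2_zero: "(\<lambda>x. 0) \<in> L2 M"
  by (auto simp: L2_def)

lemma L2_sum: "(\<And>i. i \<in> I \<Longrightarrow> \<phi> i \<in> L2 M) \<Longrightarrow> (\<lambda>x. \<Sum>i\<in>I. \<phi> i x) \<in> L2 M"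
  by (induction I rule: infinite_finite_induct) (auto simp: L2_zero L2_add)

lemma L2_bounded_mult:
  fixes \<phi> u :: "'x \<Rightarrow> complex"
  assumes "\<phi> \<in> L2 M" and [measurable]: "u \<in> borel_measurable M" and "AE x in M. cmod (u x) \<le> K"
  shows "(\<lambda>x. u x * \<phi> x) \<in> L2 M"
proof (rule L2_dominated)
  show "integrable M (\<lambda>x. K\<^sup>2 * (norm (\<phi> x))\<^sup>2)"
    using assms(1) by (simp add: L2_integrable)
  show "AE x in M. (norm (u x * \<phi> x))\<^sup>2 \<le> K\<^sup>2 * (norm (\<phi> x))\<^sup>2"
    using assms(3) by eventually_elim (auto simp: norm_mult power_mult_distrib intro!: mult_right_mono power_mono)
qed (use assms(1) in measurable)

lemma L2_cmult:
  fixes \<phi> :: "'x \<Rightarrow> complex"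
  shows "\<phi> \<in> L2 M \<Longrightarrow> (\<lambda>x. c * \<phi> x) \<in> L2 M"
  by (rule L2_bounded_mult[where K = "cmod c"]) auto

lemma L2_mult_integrable:
  fixes \<phi> \<psi> :: "'x \<Rightarrow> complex"
  assumes "\<phi> \<in> L2 M" "\<psi> \<in> L2 M"
  shows "integrable M (\<lambda>x. \<phi> x * \<psi> x)"
proof (rule Bochner_Integration.integrable_bound)
  show "integrable M (\<lambda>x. (norm (\<phi> x))\<^sup>2 + (norm (\<psi> x))\<^sup>2)"
    using assms by (simp add: L2_integrable)
  have "cmod (\<phi> x * \<psi> x) \<le> (norm (\<phi> x))\<^sup>2 + (norm (\<psi> x))\<^sup>2" for x
    using sum_squares_bound[of "cmod (\<phi> x)" "cmod (\<psi> x)"]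
      mult_nonneg_nonneg[OF norm_ge_zero norm_ge_zero, of "\<phi> x" "\<psi> x"] unfolding norm_mult by linarith
  then show "AE x in M. norm (\<phi> x * \<psi> x) \<le> norm ((norm (\<phi> x))\<^sup>2 + (norm (\<psi> x))\<^sup>2)"
    by simp
qed (use assms in measurable)

lemma L2_cnj:
  fixes \<phi> :: "'x \<Rightarrow> complex"
  assumes "\<phi> \<in> L2 M" shows "(\<lambda>x. cnj (\<phi> x)) \<in> L2 M"
proof -
  have "(\<lambda>x. cnj (\<phi> x)) \<in> borel_measurable M"
    using assms by (intro borel_measurable_continuous_on[OF continuous_on_cnj[OF continuous_on_id]]) (simp add: L2_measurable)
  then show ?thesis using assms by (auto simp: L2_def)
qed

lemma L2_cauchy_schwarz:
  fixes \<phi> \<psi> :: "'x \<Rightarrow> complex"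
  assumes "\<phi> \<in> L2 M" "\<psi> \<in> L2 M"
  shows "cmod (\<integral>x. \<phi> x * \<psi> x \<partial>M) \<le> sqrt (\<integral>x. (cmod (\<phi> x))\<^sup>2 \<partial>M) * sqrt (\<integral>x. (cmod (\<psi> x))\<^sup>2 \<partial>M)"
proof -
  have [measurable]: "\<phi> \<in> borel_measurable M" "\<psi> \<in> borel_measurable M"
    using assms by (auto dest: L2_measurable)
  let ?I = "\<integral>x. cmod (\<phi> x) * cmod (\<psi> x) \<partial>M"
  have i: "integrable M (\<lambda>x. cmod (\<phi> x) * cmod (\<psi> x))"
    using integrable_norm[OF L2_mult_integrable[OF assms]] by (simp add: norm_mult)
  have "(\<integral>\<^sup>+x. ennreal (cmod (\<phi> x)) * ennreal (cmod (\<psi> x)) \<partial>M)\<^sup>2 \<le>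
     (\<integral>\<^sup>+x. ennreal (cmod (\<phi> x)) ^ 2 \<partial>M) * (\<integral>\<^sup>+x. ennreal (cmod (\<psi> x)) ^ 2 \<partial>M)"
    by (rule Cauchy_Schwarz_nn_integral) auto
  then have "(ennreal ?I)\<^sup>2 \<le> ennreal (\<integral>x. (cmod (\<phi> x))\<^sup>2 \<partial>M) * ennreal (\<integral>x. (cmod (\<psi> x))\<^sup>2 \<partial>M)"
    using i L2_integrable[OF assms(1)] L2_integrable[OF assms(2)]
    by (simp add: ennreal_power nn_integral_eq_integral flip: ennreal_mult)
  then have "?I\<^sup>2 \<le> (\<integral>x. (cmod (\<phi> x))\<^sup>2 \<partial>M) * (\<integral>x. (cmod (\<psi> x))\<^sup>2 \<partial>M)"
    by (simp add: ennreal_power flip: ennreal_mult)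
  then have "?I \<le> sqrt (\<integral>x. (cmod (\<phi> x))\<^sup>2 \<partial>M) * sqrt (\<integral>x. (cmod (\<psi> x))\<^sup>2 \<partial>M)"
    by (simp add: real_le_rsqrt flip: real_sqrt_mult)
  moreover have "cmod (\<integral>x. \<phi> x * \<psi> x \<partial>M) \<le> ?I"
    using integral_norm_bound[of M "\<lambda>x. \<phi> x * \<psi> x"] by (simp add: norm_mult)
  ultimately show ?thesis by linarith
qed

text \<open>The geometric rate makes the sum over \<open>k\<close> of the squared errors integrable,
  hence finite a.e., and the terms of a convergent series tend to 0.\<close>

lemma L2_AE_tendsto:
  fixes \<phi> :: "nat \<Rightarrow> 'x \<Rightarrow> 'b::euclidean_space"
  assumes "\<And>k. \<phi> k \<in> L2 M" "\<psi> \<in> L2 M"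
    and le: "\<And>k. (\<integral>x. (norm (\<phi> k x - \<psi> x))\<^sup>2 \<partial>M) \<le> C * (1/4) ^ k"
  shows "AE x in M. (\<lambda>k. \<phi> k x) \<longlonglongrightarrow> \<psi> x"
proof -
  have d: "(\<lambda>x. \<phi> k x - \<psi> x) \<in> L2 M" for k
    using assms by (intro L2_diff)
  then have [measurable]: "(\<lambda>x. \<phi> k x - \<psi> x) \<in> borel_measurable M" for k
    by (auto dest: L2_measurable)
  have "0 \<le> (\<integral>x. (norm (\<phi> 0 x - \<psi> x))\<^sup>2 \<partial>M)" by (rule Bochner_Integration.integral_nonneg) simp
  with le[of 0] have C: "0 \<le> C" by (simp del: Bochner_Integration.integral_nonneg)
  have "(\<integral>\<^sup>+x. (\<Sum>k. ennreal ((norm (\<phi> k x - \<psi> x))\<^sup>2)) \<partial>M) = (\<Sum>k. \<integral>\<^sup>+x. ennreal ((norm (\<phi> k x - \<psi> x))\<^sup>2) \<partial>M)"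
    by (rule nn_integral_suminf) measurable
  also have "\<dots> \<le> (\<Sum>k. ennreal (C * (1/4) ^ k))"
  proof (rule suminf_le)
    fix k show "(\<integral>\<^sup>+x. ennreal ((norm (\<phi> k x - \<psi> x))\<^sup>2) \<partial>M) \<le> ennreal (C * (1/4) ^ k)"
      using le[of k] L2_integrable[OF d, of k] by (simp add: nn_integral_eq_integral ennreal_leI)
  qed auto
  also have "\<dots> < \<infinity>"
    using C by (subst suminf_ennreal2) (auto intro!: summable_mult)
  finally have "AE x in M. (\<Sum>k. ennreal ((norm (\<phi> k x - \<psi> x))\<^sup>2)) \<noteq> \<infinity>"
    by (intro nn_integral_PInf_AE) auto
  then show ?thesis
  proof eventually_elim
    case (elim x)
    then have "summable (\<lambda>k. (norm (\<phi> k x - \<psi> x))\<^sup>2)"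
      by (intro summable_suminf_not_top) auto
    then have "(\<lambda>k. sqrt ((norm (\<phi> k x - \<psi> x))\<^sup>2)) \<longlonglongrightarrow> sqrt 0"
      by (intro tendsto_real_sqrt summable_LIMSEQ_zero)
    then show ?case
      by (simp add: LIM_zero_cancel tendsto_norm_zero_iff)
  qed
qed

text \<open>\<open>M\<close> may be an infinite measure, so the increments need not be integrable
  and are controlled through their squares: the rate leaves room for the weights
  \<open>2 ^ k\<close>, and the weighted sum of squares still forces absolute convergence of the
  telescoping series. Fatou's lemma, with \<open>k\<close> fixed and \<open>m\<close> tending to
  infinity, preserves the explicit rate.\<close>

lemma L2_complete:
  fixes \<phi> :: "nat \<Rightarrow> 'x \<Rightarrow> 'b::euclidean_space"
  assumes L2: "\<And>k. \<phi> k \<in> L2 M"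
    and le: "\<And>k m. k \<le> m \<Longrightarrow> (\<integral>x. (norm (\<phi> m x - \<phi> k x))\<^sup>2 \<partial>M) \<le> (1/4) ^ k"
  obtains \<psi> where "\<psi> \<in> L2 M" "\<And>k. (\<integral>x. (norm (\<psi> x - \<phi> k x))\<^sup>2 \<partial>M) \<le> (1/4) ^ k"
proof -
  have [measurable]: "\<phi> k \<in> borel_measurable M" for k
    using L2 by (auto dest: L2_measurable)
  define d where "d k x = norm (\<phi> (Suc k) x - \<phi> k x)" for k x
  have d_nonneg: "0 \<le> d k x" for k x
    by (simp add: d_def)
  have d: "(\<lambda>x. \<phi> m x - \<phi> k x) \<in> L2 M" for k m
    using L2 by (intro L2_diff)
  have [measurable]: "d k \<in> borel_measurable M" for k
    unfolding d_def by measurable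
  have nn: "(\<integral>\<^sup>+x. ennreal ((norm (\<phi> m x - \<phi> k x))\<^sup>2) \<partial>M) \<le> ennreal ((1/4) ^ k)" if "k \<le> m" for k m
    using le[OF that] L2_integrable[OF d, of m k] by (simp add: nn_integral_eq_integral ennreal_leI)
  have "(\<integral>\<^sup>+x. (\<Sum>k. ennreal (2 ^ k * (d k x)\<^sup>2)) \<partial>M) = (\<Sum>k. \<integral>\<^sup>+x. ennreal (2 ^ k * (d k x)\<^sup>2) \<partial>M)"
    by (rule nn_integral_suminf) measurable
  also have "\<dots> \<le> (\<Sum>k. ennreal ((1/2) ^ k))"
  proof (rule suminf_le)
    fix k
    have "(\<integral>\<^sup>+x. ennreal (2 ^ k * (d k x)\<^sup>2) \<partial>M) = ennreal (2 ^ k) * (\<integral>\<^sup>+x. ennreal ((d k x)\<^sup>2) \<partial>M)"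
      by (simp add: ennreal_mult nn_integral_cmult)
    also have "\<dots> \<le> ennreal (2 ^ k) * ennreal ((1/4) ^ k)"
      unfolding d_def by (intro mult_left_mono nn) auto
    also have "\<dots> = ennreal ((1/2) ^ k)"
      by (simp flip: ennreal_mult power_mult_distrib)
    finally show "(\<integral>\<^sup>+x. ennreal (2 ^ k * (d k x)\<^sup>2) \<partial>M) \<le> ennreal ((1/2) ^ k)" .
  qed auto
  also have "\<dots> < \<infinity>"
    by (subst suminf_ennreal2) auto
  finally have "AE x in M. (\<Sum>k. ennreal (2 ^ k * (d k x)\<^sup>2)) \<noteq> \<infinity>"
    by (intro nn_integral_PInf_AE) auto
  then have conv: "AE x in M. convergent (\<lambda>k. \<phi> k x)"
  proof eventually_elim
    case (elim x)
    then have s: "summable (\<lambda>k. 2 ^ k * (d k x)\<^sup>2)"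
      by (intro summable_suminf_not_top) auto
    have "summable (\<lambda>k. d k x)"
    proof (rule summable_comparison_test')
      show "summable (\<lambda>k. (1/2) ^ k + 2 ^ k * (d k x)\<^sup>2)"
        by (intro summable_add s summable_geometric) simp
      fix k
      \<comment> \<open>AM-GM: \<open>d \<le> (1/t + t d\<^sup>2) / 2\<close> with \<open>t = 2 ^ k\<close>\<close>
      have "2 * (1::real) * (2 ^ k * d k x) \<le> 1 + (2 ^ k * d k x)\<^sup>2"
        using sum_squares_bound[of 1 "2 ^ k * d k x"] by simp
      moreover have "0 \<le> 2 ^ k * d k x"
        by (simp add: d_nonneg)
      ultimately have "2 ^ k * d k x \<le> 1 + (2 ^ k * d k x)\<^sup>2"
        by linarith
      then have "(1/2) ^ k * (2 ^ k * d k x) \<le> (1/2) ^ k * (1 + (2 ^ k * d k x)\<^sup>2)"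
        by (intro mult_left_mono) auto
      then show "norm (d k x) \<le> (1/2) ^ k + 2 ^ k * (d k x)\<^sup>2"
        by (simp add: d_def field_simps power2_eq_square)
    qed
    then have "summable (\<lambda>k. \<phi> (Suc k) x - \<phi> k x)"
      unfolding d_def by (rule summable_norm_cancel)
    then have "convergent (\<lambda>n. \<Sum>k<n. \<phi> (Suc k) x - \<phi> k x)"
      by (simp add: summable_iff_convergent)
    then have "convergent (\<lambda>n. \<phi> n x - \<phi> 0 x)"
      using sum_lessThan_telescope[of "\<lambda>k. \<phi> k x"] by simp
    from convergent_add[OF this convergent_const[of "\<phi> 0 x"]] show ?case by simp
  qed
  define \<psi> where "\<psi> x = lim (\<lambda>k. \<phi> k x)" for x
  have [measurable]: "\<psi> \<in> borel_measurable M"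
    unfolding \<psi>_def by measurable
  have bound: "(\<integral>\<^sup>+x. ennreal ((norm (\<psi> x - \<phi> k x))\<^sup>2) \<partial>M) \<le> ennreal ((1/4) ^ k)" for k
  proof -
    have "(\<integral>\<^sup>+x. ennreal ((norm (\<psi> x - \<phi> k x))\<^sup>2) \<partial>M) =
        (\<integral>\<^sup>+x. liminf (\<lambda>m. ennreal ((norm (\<phi> m x - \<phi> k x))\<^sup>2)) \<partial>M)"
    proof (rule nn_integral_cong_AE)
      show "AE x in M. ennreal ((norm (\<psi> x - \<phi> k x))\<^sup>2) = liminf (\<lambda>m. ennreal ((norm (\<phi> m x - \<phi> k x))\<^sup>2))"
        using conv
      proof eventually_elim
        case (elim x)
        then have "(\<lambda>m. \<phi> m x) \<longlonglongrightarrow> \<psi> x"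
          by (simp add: \<psi>_def convergent_LIMSEQ_iff)
        then have "(\<lambda>m. ennreal ((norm (\<phi> m x - \<phi> k x))\<^sup>2)) \<longlonglongrightarrow> ennreal ((norm (\<psi> x - \<phi> k x))\<^sup>2)"
          by (intro tendsto_intros tendsto_ennrealI)
        then show ?case
          by (intro lim_imp_Liminf[symmetric]) simp_all
      qed
    qed
    also have "\<dots> \<le> liminf (\<lambda>m. \<integral>\<^sup>+x. ennreal ((norm (\<phi> m x - \<phi> k x))\<^sup>2) \<partial>M)"
      by (rule nn_integral_liminf) measurable
    also have "\<dots> \<le> liminf (\<lambda>m. ennreal ((1/4) ^ k))"
      by (intro Liminf_mono eventually_sequentiallyI[of k] nn)
    also have "\<dots> = ennreal ((1/4) ^ k)"
      by (simp add: Liminf_const)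
    finally show ?thesis .
  qed
  have diff: "(\<lambda>x. \<psi> x - \<phi> k x) \<in> L2 M" for k
    using le_less_trans[OF bound[of k] ennreal_less_top] by (intro L2_I integrableI_bounded) auto
  show ?thesis
  proof (rule that)
    show "\<psi> \<in> L2 M"
      using L2_add[OF diff[of 0] L2[of 0]] by simp
    fix k
    show "(\<integral>x. (norm (\<psi> x - \<phi> k x))\<^sup>2 \<partial>M) \<le> (1/4) ^ k"
      using bound[of k] L2_integrable[OF diff[of k]] by (simp add: nn_integral_eq_integral)
  qed
qed

lemma L2_AE_eq:
  assumes "\<phi> \<in> L2 M" "\<psi> \<in> L2 M" "(\<integral>x. (norm (\<phi> x - \<psi> x))\<^sup>2 \<partial>M) \<le> 0"
  shows "AE x in M. \<phi> x = \<psi> x"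
proof -
  have "(\<integral>x. (norm (\<phi> x - \<psi> x))\<^sup>2 \<partial>M) = 0"
    using assms(3) by (intro antisym Bochner_Integration.integral_nonneg) auto
  then have "AE x in M. (norm (\<phi> x - \<psi> x))\<^sup>2 = 0"
    using L2_integrable[OF L2_diff[OF assms(1,2)]]
    by (subst (asm) integral_nonneg_eq_0_iff_AE) auto
  then show ?thesis by eventually_elim simp
qed

lemma integral_cmod_sq: "complex_of_real (\<integral>x. (cmod (\<phi> x))\<^sup>2 \<partial>M) = (\<integral>x. \<phi> x * cnj (\<phi> x) \<partial>M)"
  by (subst integral_complex_of_real[symmetric]) (simp only: complex_norm_square)

lemma integral_cnj_swap: "cnj (\<integral>x. \<phi> x * cnj (\<psi> x) \<partial>M) = (\<integral>x. \<psi> x * cnj (\<phi> x) \<partial>M)"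
  using Bochner_Integration.integral_cnj[of M "\<lambda>x. \<phi> x * cnj (\<psi> x)"] by (simp add: mult.commute)

text \<open>Square-summability is square-integrability for the counting measure. Facts on
  \<open>L2\<close> thereby apply to \<open>ell2\<close>, and one theory of orthonormal expansions
  serves both characters and sequences.\<close>

lemma ell2_iff_L2: "f \<in> ell2 \<longleftrightarrow> f \<in> L2 (count_space UNIV)"
  using abs_summable_equivalent[of "\<lambda>x. (cmod (f x))\<^sup>2" UNIV]
  by (simp add: ell2_def L2_def abs_summable_on_def)

lemma infsum_eq_integral:
  fixes f :: "'a \<Rightarrow> 'b::{banach, second_countable_topology}"
  assumes "integrable (count_space UNIV) f"
  shows "(\<Sum>\<^sub>\<infinity>x. f x) = (\<integral>x. f x \<partial>count_space UNIV)"
  using infsetsum_infsum[of f UNIV] assms by (simp add: abs_summable_on_def infsetsum_def)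

lemma ell2_norm_sq: "f \<in> ell2 \<Longrightarrow> (ell2_norm f)\<^sup>2 = (\<integral>x. (cmod (f x))\<^sup>2 \<partial>count_space UNIV)"
  unfolding ell2_norm_def
  by (subst infsum_eq_integral) (auto simp: ell2_iff_L2 L2_integrable Bochner_Integration.integral_nonneg)

lemma ell2_norm_nonneg: "0 \<le> ell2_norm f"
  by (simp add: ell2_norm_def infsum_nonneg)

lemma ell2_inner_eq:
  "f \<in> ell2 \<Longrightarrow> g \<in> ell2 \<Longrightarrow> ell2_inner f g = (\<integral>x. f x * cnj (g x) \<partial>count_space UNIV)"
  unfolding ell2_inner_def
  by (intro infsum_eq_integral L2_mult_integrable L2_cnj) (auto simp: ell2_iff_L2)

lemma ell2_add: "f \<in> ell2 \<Longrightarrow> g \<in> ell2 \<Longrightarrow> (\<lambda>x. f x + g x) \<in> ell2"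
  and ell2_diff: "f \<in> ell2 \<Longrightarrow> g \<in> ell2 \<Longrightarrow> (\<lambda>x. f x - g x) \<in> ell2"
  and ell2_cmult: "f \<in> ell2 \<Longrightarrow> (\<lambda>x. c * f x) \<in> ell2"
  and ell2_zero: "(\<lambda>x. 0) \<in> ell2"
  by (auto simp: ell2_iff_L2 L2_add L2_diff L2_cmult L2_zero)

lemma ell2_sum: "(\<And>i. i \<in> I \<Longrightarrow> f i \<in> ell2) \<Longrightarrow> (\<lambda>x. \<Sum>i\<in>I. f i x) \<in> ell2"
  by (simp add: ell2_iff_L2 L2_sum)

lemma ell2_finite_support: "finite {x. f x \<noteq> 0} \<Longrightarrow> f \<in> ell2"
  unfolding ell2_def by (auto intro!: finite_nonzero_values_imp_summable_on)

lemma ell2_norm_eq_0: "f \<in> ell2 \<Longrightarrow> ell2_norm f = 0 \<Longrightarrow> f = (\<lambda>x. 0)"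
proof -
  assume f: "f \<in> ell2" "ell2_norm f = 0"
  then have "AE x in count_space UNIV. f x = (\<lambda>x. 0) x"
    using ell2_norm_sq[OF f(1)] by (intro L2_AE_eq) (auto simp: ell2_iff_L2 L2_zero)
  then show ?thesis by (auto simp: AE_count_space)
qed

lemma ell2_norm_diff_eq_0: "f \<in> ell2 \<Longrightarrow> g \<in> ell2 \<Longrightarrow> ell2_norm (\<lambda>x. f x - g x) = 0 \<Longrightarrow> f = g"
  using ell2_norm_eq_0[of "\<lambda>x. f x - g x"] by (auto simp: ell2_diff fun_eq_iff)

lemma ell2_norm_diff_sq_le:
  assumes "f \<in> ell2" "g \<in> ell2"
  shows "(ell2_norm (\<lambda>x. f x - g x))\<^sup>2 \<le> 2 * (ell2_norm f)\<^sup>2 + 2 * (ell2_norm g)\<^sup>2"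
proof -
  have "(\<integral>x. (cmod (f x - g x))\<^sup>2 \<partial>count_space UNIV) \<le>
      (\<integral>x. 2 * (cmod (f x))\<^sup>2 + 2 * (cmod (g x))\<^sup>2 \<partial>count_space UNIV)"
    using assms L2_diff[of f "count_space UNIV" g]
    by (intro integral_mono norm_diff_sq_le) (auto simp: ell2_iff_L2 L2_integrable)
  then show ?thesis
    using assms by (simp add: ell2_norm_sq ell2_diff) (simp add: ell2_iff_L2 L2_integrable)
qed

lemma ell2_inner_self: "f \<in> ell2 \<Longrightarrow> ell2_inner f f = complex_of_real ((ell2_norm f)\<^sup>2)"
  by (simp only: ell2_inner_eq ell2_norm_sq integral_cmod_sq)

lemma ell2_inner_diff_right:
  assumes "f \<in> ell2" "g \<in> ell2" "h \<in> ell2"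
  shows "ell2_inner f (\<lambda>x. g x - h x) = ell2_inner f g - ell2_inner f h"
proof -
  have "integrable (count_space UNIV) (\<lambda>x. f x * cnj (g x))" "integrable (count_space UNIV) (\<lambda>x. f x * cnj (h x))"
    using assms by (auto intro!: L2_mult_integrable L2_cnj simp: ell2_iff_L2)
  then show ?thesis
    using assms by (simp add: ell2_inner_eq ell2_diff right_diff_distrib)
qed

lemma ell2_inner_cnj: "ell2_inner f g = cnj (ell2_inner g f)"
  unfolding ell2_inner_def by (subst infsum_cnj[symmetric]) (simp add: mult.commute)

lemma ell2_cauchy_schwarz:
  assumes "f \<in> ell2" "g \<in> ell2"
  shows "cmod (ell2_inner f g) \<le> ell2_norm f * ell2_norm g"
proof -
  have "cmod (ell2_inner f g) \<le> sqrt ((ell2_norm f)\<^sup>2) * sqrt ((ell2_norm g)\<^sup>2)"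
    using L2_cauchy_schwarz[of f "count_space UNIV" "\<lambda>x. cnj (g x)"] assms
    by (simp add: ell2_norm_sq ell2_inner_eq) (simp add: ell2_iff_L2 L2_cnj)
  then show ?thesis
    by (simp add: ell2_norm_nonneg)
qed

text \<open>Replaces the net of finite subsets by one increasing sequence. The index set may be
  uncountable, so the sets need not exhaust it; they capture all but \<open>(1/4) ^ k\<close> of the
  squared norm.\<close>

lemma ell2_fast_exhaustion:
  assumes a: "a \<in> ell2"
  obtains F :: "nat \<Rightarrow> 'i set" where "\<And>k. finite (F k)" "\<And>k m. k \<le> m \<Longrightarrow> F k \<subseteq> F m"
    "\<And>k G. finite G \<Longrightarrow> G \<inter> F k = {} \<Longrightarrow> (\<Sum>i\<in>G. (cmod (a i))\<^sup>2) \<le> (1/4) ^ k"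
proof -
  let ?s = "\<lambda>F. \<Sum>i\<in>F. (cmod (a i))\<^sup>2"
  have sm: "(\<lambda>i. (cmod (a i))\<^sup>2) summable_on UNIV"
    using a by (simp add: ell2_def)
  define S where "S = (\<Sum>\<^sub>\<infinity>i. (cmod (a i))\<^sup>2)"
  have "\<exists>F. finite F \<and> S - (1/4) ^ k < ?s F" for k
  proof -
    have "(?s \<longlongrightarrow> S) (finite_subsets_at_top UNIV)"
      using sm unfolding S_def by (simp add: has_sum_def[symmetric])
    then have "eventually (\<lambda>F. S - (1/4) ^ k < ?s F) (finite_subsets_at_top UNIV)"
      by (rule order_tendstoD) simp
    then show ?thesis
      unfolding eventually_finite_subsets_at_top by blast
  qed
  then obtain F where F: "\<And>k. finite (F k)" "\<And>k. S - (1/4) ^ k < ?s (F k)"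
    by metis
  show ?thesis
  \<comment> \<open>Unions make the sets increase; the tail estimate survives because a set disjoint
    from the union is disjoint from \<open>F k\<close>.\<close>
  proof (rule that[of "\<lambda>k. \<Union>j\<le>k. F j"])
    fix k G assume G: "finite G" "G \<inter> (\<Union>j\<le>k. F j) = {}"
    have "?s (G \<union> F k) \<le> S"
      unfolding S_def by (rule finite_sum_le_infsum) (use sm G F in auto)
    moreover have "G \<inter> F k = {}"
      using G(2) by blast
    then have "?s (G \<union> F k) = ?s G + ?s (F k)"
      using G F by (intro sum.union_disjoint) auto
    ultimately show "?s G \<le> (1/4) ^ k"
      using F(2)[of k] by simp
  qed (use F in \<open>auto intro: order_trans\<close>)
qed

lemma ell2_cutoff_norm_le:
  assumes a: "a \<in> ell2" and F: "finite F" "\<And>G. finite G \<Longrightarrow> G \<inter> F = {} \<Longrightarrow> (\<Sum>i\<in>G. (cmod (a i))\<^sup>2) \<le> e"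
  shows "(ell2_norm (\<lambda>i. (if i \<in> F then a i else 0) - a i))\<^sup>2 \<le> e"
proof -
  let ?b = "\<lambda>i. if i \<in> F then a i else 0"
  have "?b \<in> ell2"
    using F(1) by (intro ell2_finite_support) (auto elim: rev_finite_subset)
  then have "(\<lambda>i. (cmod (?b i - a i))\<^sup>2) summable_on UNIV"
    using ell2_diff[OF _ a] by (simp add: ell2_def)
  then have "(\<Sum>\<^sub>\<infinity>i. (cmod (?b i - a i))\<^sup>2) \<le> e"
  proof (rule infsum_le_finite_sums)
    fix G :: "'a set" assume "finite G"
    have "(\<Sum>i\<in>G. (cmod (?b i - a i))\<^sup>2) = (\<Sum>i\<in>G - F. (cmod (a i))\<^sup>2)"
      using \<open>finite G\<close> by (intro sum.mono_neutral_cong_right) auto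
    also have "\<dots> \<le> e"
      using \<open>finite G\<close> by (intro F(2)) auto
    finally show "(\<Sum>i\<in>G. (cmod (?b i - a i))\<^sup>2) \<le> e" .
  qed
  then show ?thesis
    by (simp add: ell2_norm_def infsum_nonneg)
qed

section \<open>Orthonormal expansions\<close>

lemma L2_inner_sum:
  fixes \<phi> :: "'x \<Rightarrow> complex"
  assumes "\<phi> \<in> L2 M" "\<And>i. e i \<in> L2 M"
  shows "(\<integral>x. (\<Sum>i\<in>F. a i * e i x) * cnj (\<phi> x) \<partial>M) = (\<Sum>i\<in>F. a i * (\<integral>x. e i x * cnj (\<phi> x) \<partial>M))"
proof -
  have "integrable M (\<lambda>x. e i x * cnj (\<phi> x))" for i
    using assms by (intro L2_mult_integrable L2_cnj)
  then show ?thesis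
    by (simp add: sum_distrib_right mult.assoc Bochner_Integration.integral_sum)
qed

context
  fixes M :: "'x measure" and e :: "'i \<Rightarrow> 'x \<Rightarrow> complex"
  assumes e: "\<And>i. e i \<in> L2 M"
    and on: "\<And>i j. (\<integral>x. e i x * cnj (e j x) \<partial>M) = (if i = j then 1 else 0)"
begin

lemma orthonormal_partial_sum_L2: "(\<lambda>x. \<Sum>i\<in>F. a i * e i x) \<in> L2 M"
  by (intro L2_sum L2_cmult e)

lemma orthonormal_sum_norm:
  assumes "finite F"
  shows "(\<integral>x. (cmod (\<Sum>i\<in>F. a i * e i x))\<^sup>2 \<partial>M) = (\<Sum>i\<in>F. (cmod (a i))\<^sup>2)"
proof -
  let ?s = "\<lambda>x. \<Sum>i\<in>F. a i * e i x"
  have *: "(\<integral>x. e i x * cnj (?s x) \<partial>M) = (if i \<in> F then cnj (a i) else 0)" for i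
  proof -
    have "(\<integral>x. e i x * cnj (?s x) \<partial>M) = cnj (\<integral>x. ?s x * cnj (e i x) \<partial>M)"
      by (rule integral_cnj_swap[symmetric])
    also have "\<dots> = cnj (\<Sum>j\<in>F. a j * (if j = i then 1 else 0))"
      by (simp add: L2_inner_sum e on)
    also have "\<dots> = (if i \<in> F then cnj (a i) else 0)"
      using assms by (simp add: if_distrib cong: if_cong)
    finally show ?thesis .
  qed
  have "complex_of_real (\<integral>x. (cmod (?s x))\<^sup>2 \<partial>M) = (\<integral>x. ?s x * cnj (?s x) \<partial>M)"
    by (rule integral_cmod_sq)
  also have "\<dots> = (\<Sum>i\<in>F. a i * cnj (a i))"
    unfolding L2_inner_sum[OF orthonormal_partial_sum_L2 e] * by (rule sum.cong) auto
  also have "\<dots> = complex_of_real (\<Sum>i\<in>F. (cmod (a i))\<^sup>2)"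
    by (simp only: complex_norm_square of_real_sum)
  finally show ?thesis
    using of_real_eq_iff by blast
qed

text \<open>Pythagoras for the orthogonal projection: the square of the sum and both cross terms
  have the same value, so one copy remains with a minus sign. Nonnegativity of the left side is
  Bessel's inequality.\<close>

lemma orthonormal_projection_norm:
  assumes "finite F" and \<phi>: "\<phi> \<in> L2 M" and c: "\<And>i. (\<integral>x. \<phi> x * cnj (e i x) \<partial>M) = c i"
  shows "(\<integral>x. (cmod ((\<Sum>i\<in>F. c i * e i x) - \<phi> x))\<^sup>2 \<partial>M) = (\<integral>x. (cmod (\<phi> x))\<^sup>2 \<partial>M) - (\<Sum>i\<in>F. (cmod (c i))\<^sup>2)"
proof -
  let ?s = "\<lambda>x. \<Sum>i\<in>F. c i * e i x"
  have s: "?s \<in> L2 M"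
    by (rule orthonormal_partial_sum_L2)
  have int: "integrable M (\<lambda>x. \<psi> x * cnj (\<theta> x))" if "\<psi> \<in> L2 M" "\<theta> \<in> L2 M" for \<psi> \<theta> :: "'x \<Rightarrow> complex"
    using that by (intro L2_mult_integrable L2_cnj)
  have c': "(\<integral>x. e i x * cnj (\<phi> x) \<partial>M) = cnj (c i)" for i
    unfolding c[symmetric] by (rule integral_cnj_swap[symmetric])
  have s1: "(\<integral>x. ?s x * cnj (\<phi> x) \<partial>M) = complex_of_real (\<Sum>i\<in>F. (cmod (c i))\<^sup>2)"
    by (simp add: L2_inner_sum \<phi> e c' complex_norm_square[symmetric])
  have s2: "(\<integral>x. \<phi> x * cnj (?s x) \<partial>M) = cnj (\<integral>x. ?s x * cnj (\<phi> x) \<partial>M)"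
    by (rule integral_cnj_swap[symmetric])
  have s3: "(\<integral>x. ?s x * cnj (?s x) \<partial>M) = complex_of_real (\<Sum>i\<in>F. (cmod (c i))\<^sup>2)"
    unfolding orthonormal_sum_norm[OF assms(1), symmetric] integral_cmod_sq ..
  have "complex_of_real (\<integral>x. (cmod (?s x - \<phi> x))\<^sup>2 \<partial>M) = (\<integral>x. (?s x - \<phi> x) * cnj (?s x - \<phi> x) \<partial>M)"
    by (rule integral_cmod_sq)
  also have "\<dots> = (\<integral>x. (?s x * cnj (?s x) - ?s x * cnj (\<phi> x)) - (\<phi> x * cnj (?s x) - \<phi> x * cnj (\<phi> x)) \<partial>M)"
    by (rule arg_cong[where f = "integral\<^sup>L M"]) (simp only: fun_eq_iff complex_cnj_diff ring_distribs, simp)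
  also have "\<dots> = ((\<integral>x. ?s x * cnj (?s x) \<partial>M) - (\<integral>x. ?s x * cnj (\<phi> x) \<partial>M)) -
      ((\<integral>x. \<phi> x * cnj (?s x) \<partial>M) - (\<integral>x. \<phi> x * cnj (\<phi> x) \<partial>M))"
    by (simp only: Bochner_Integration.integral_diff Bochner_Integration.integrable_diff int s \<phi>)
  also have "(\<integral>x. \<phi> x * cnj (\<phi> x) \<partial>M) = complex_of_real (\<integral>x. (cmod (\<phi> x))\<^sup>2 \<partial>M)"
    by (rule integral_cmod_sq[symmetric])
  finally have "complex_of_real (\<integral>x. (cmod (?s x - \<phi> x))\<^sup>2 \<partial>M) =
      complex_of_real ((\<integral>x. (cmod (\<phi> x))\<^sup>2 \<partial>M) - (\<Sum>i\<in>F. (cmod (c i))\<^sup>2))"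
    unfolding s1 s2 s3 by simp
  then show ?thesis
    using of_real_eq_iff by blast
qed

lemma orthonormal_bessel:
  assumes \<phi>: "\<phi> \<in> L2 M"
  shows "(\<lambda>i. \<integral>x. \<phi> x * cnj (e i x) \<partial>M) \<in> ell2"
  unfolding ell2_def mem_Collect_eq
proof (rule nonneg_bdd_above_summable_on)
  let ?c = "\<lambda>i. \<integral>x. \<phi> x * cnj (e i x) \<partial>M"
  show "bdd_above (sum (\<lambda>i. (cmod (?c i))\<^sup>2) ` {F. F \<subseteq> UNIV \<and> finite F})"
  proof (rule bdd_aboveI2)
    fix F :: "'i set" assume "F \<in> {F. F \<subseteq> UNIV \<and> finite F}"
    then have "0 \<le> (\<integral>x. (cmod (\<phi> x))\<^sup>2 \<partial>M) - (\<Sum>i\<in>F. (cmod (?c i))\<^sup>2)"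
      by (subst orthonormal_projection_norm[OF _ \<phi> refl, symmetric]) auto
    then show "(\<Sum>i\<in>F. (cmod (?c i))\<^sup>2) \<le> (\<integral>x. (cmod (\<phi> x))\<^sup>2 \<partial>M)" by simp
  qed
qed simp

text \<open>The Riesz--Fischer theorem. The function is built along the fast sequence of finite
  sets, and each \<open>F k\<close> then serves as a reference point for the whole net.\<close>

lemma orthonormal_expansion:
  assumes a: "a \<in> ell2"
  obtains \<phi> where "\<phi> \<in> L2 M" "\<And>i. (\<integral>x. \<phi> x * cnj (e i x) \<partial>M) = a i"
    "((\<lambda>F. \<integral>x. (cmod ((\<Sum>i\<in>F. a i * e i x) - \<phi> x))\<^sup>2 \<partial>M) \<longlongrightarrow> 0) (finite_subsets_at_top UNIV)"
    "(\<integral>x. (cmod (\<phi> x))\<^sup>2 \<partial>M) = (ell2_norm a)\<^sup>2"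
proof -
  obtain F where F: "\<And>k. finite (F k)" "\<And>k m. k \<le> m \<Longrightarrow> F k \<subseteq> F m"
    "\<And>k G. finite G \<Longrightarrow> G \<inter> F k = {} \<Longrightarrow> (\<Sum>i\<in>G. (cmod (a i))\<^sup>2) \<le> (1/4) ^ k"
    using ell2_fast_exhaustion[OF a] by metis
  define s where "s G x = (\<Sum>i\<in>G. a i * e i x)" for G x
  have s_L2: "s G \<in> L2 M" for G
    unfolding s_def by (rule orthonormal_partial_sum_L2)
  have s_diff: "(\<integral>x. (cmod (s G x - s (F k) x))\<^sup>2 \<partial>M) \<le> (1/4) ^ k" if "finite G" "F k \<subseteq> G" for G k
  proof -
    have "s G x - s (F k) x = (\<Sum>i\<in>G - F k. a i * e i x)" for x
      unfolding s_def using that by (simp add: sum_diff)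
    then have "(\<integral>x. (cmod (s G x - s (F k) x))\<^sup>2 \<partial>M) = (\<Sum>i\<in>G - F k. (cmod (a i))\<^sup>2)"
      using that by (simp add: orthonormal_sum_norm)
    also have "\<dots> \<le> (1/4) ^ k"
      by (rule F) (use that in auto)
    finally show ?thesis .
  qed
  obtain \<phi> where \<phi>: "\<phi> \<in> L2 M" "\<And>k. (\<integral>x. (cmod (\<phi> x - s (F k) x))\<^sup>2 \<partial>M) \<le> (1/4) ^ k"
    by (rule L2_complete[of "\<lambda>k. s (F k)" M]) (use s_L2 s_diff F(1,2) in auto)
  \<comment> \<open>The detour through \<open>s (F k)\<close> costs \<open>2 * (1/4) ^ k\<close>
    twice, once for each difference.\<close>
  have bound: "(\<integral>x. (cmod (s G x - \<phi> x))\<^sup>2 \<partial>M) \<le> 4 * (1/4) ^ k" if "finite G" "F k \<subseteq> G" for G k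
  proof -
    have i: "integrable M (\<lambda>x. (cmod (s A x - s B x))\<^sup>2)" "integrable M (\<lambda>x. (cmod (\<phi> x - s A x))\<^sup>2)"
        "integrable M (\<lambda>x. (cmod (s A x - \<phi> x))\<^sup>2)" for A B
      using s_L2 \<phi> by (auto intro!: L2_integrable L2_diff)
    have "(\<integral>x. (cmod (s G x - \<phi> x))\<^sup>2 \<partial>M) \<le>
        (\<integral>x. 2 * (cmod (s G x - s (F k) x))\<^sup>2 + 2 * (cmod (\<phi> x - s (F k) x))\<^sup>2 \<partial>M)"
    proof (rule integral_mono)
      show "(cmod (s G x - \<phi> x))\<^sup>2 \<le> 2 * (cmod (s G x - s (F k) x))\<^sup>2 + 2 * (cmod (\<phi> x - s (F k) x))\<^sup>2" for x
        using norm_diff_sq_le[of "s G x - s (F k) x" "\<phi> x - s (F k) x"] by simp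
    qed (use i in auto)
    also have "\<dots> \<le> 4 * (1/4) ^ k"
      using s_diff[OF that] \<phi>(2)[of k] i by simp
    finally show ?thesis .
  qed
  have lim: "((\<lambda>G. \<integral>x. (cmod (s G x - \<phi> x))\<^sup>2 \<partial>M) \<longlongrightarrow> 0) (finite_subsets_at_top UNIV)"
  proof (rule order_tendstoI)
    fix r :: real assume "0 < r"
    obtain k where "(1/4) ^ k < r / 4"
      using real_arch_pow_inv[of "r/4" "1/4"] \<open>0 < r\<close> by auto
    then show "eventually (\<lambda>G. (\<integral>x. (cmod (s G x - \<phi> x))\<^sup>2 \<partial>M) < r) (finite_subsets_at_top UNIV)"
      unfolding eventually_finite_subsets_at_top
      by (intro exI[of _ "F k"]) (auto simp: F intro: le_less_trans[OF bound])
  next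
    fix r :: real assume "r < 0"
    then show "eventually (\<lambda>G. r < (\<integral>x. (cmod (s G x - \<phi> x))\<^sup>2 \<partial>M)) (finite_subsets_at_top UNIV)"
      by (auto intro!: always_eventually less_le_trans[OF _ Bochner_Integration.integral_nonneg])
  qed
  \<comment> \<open>Taking the coefficient at \<open>i\<close> is continuous by Cauchy--Schwarz,
    while along the net it is constantly \<open>a i\<close> as soon as \<open>i\<close> lies in
    \<open>G\<close>.\<close>
  have coeff: "(\<integral>x. \<phi> x * cnj (e i x) \<partial>M) = a i" for i
  proof (rule tendsto_unique)
    show "((\<lambda>G. \<integral>x. s G x * cnj (e i x) \<partial>M) \<longlongrightarrow> (\<integral>x. \<phi> x * cnj (e i x) \<partial>M)) (finite_subsets_at_top UNIV)"
    proof (rule Lim_null_comparison[THEN LIM_zero_cancel])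
      show "((\<lambda>G. sqrt (\<integral>x. (cmod (s G x - \<phi> x))\<^sup>2 \<partial>M)) \<longlongrightarrow> 0) (finite_subsets_at_top UNIV)"
        using tendsto_real_sqrt[OF lim] by simp
      have "norm ((\<integral>x. s G x * cnj (e i x) \<partial>M) - (\<integral>x. \<phi> x * cnj (e i x) \<partial>M)) \<le>
          sqrt (\<integral>x. (cmod (s G x - \<phi> x))\<^sup>2 \<partial>M)" for G
      proof -
        have "(\<integral>x. (cmod (e i x))\<^sup>2 \<partial>M) = 1"
          using orthonormal_sum_norm[of "{i}" "\<lambda>_. 1"] by simp
        moreover have "(\<integral>x. s G x * cnj (e i x) \<partial>M) - (\<integral>x. \<phi> x * cnj (e i x) \<partial>M) =
            (\<integral>x. (s G x - \<phi> x) * cnj (e i x) \<partial>M)"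
          by (simp add: left_diff_distrib Bochner_Integration.integral_diff L2_mult_integrable L2_cnj s_L2 \<phi> e)
        ultimately show ?thesis
          using L2_cauchy_schwarz[of "\<lambda>x. s G x - \<phi> x" M "\<lambda>x. cnj (e i x)"]
          by (simp add: L2_diff L2_cnj s_L2 \<phi> e)
      qed
      then show "eventually (\<lambda>G. norm ((\<integral>x. s G x * cnj (e i x) \<partial>M) - (\<integral>x. \<phi> x * cnj (e i x) \<partial>M)) \<le>
          sqrt (\<integral>x. (cmod (s G x - \<phi> x))\<^sup>2 \<partial>M)) (finite_subsets_at_top UNIV)"
        by simp
    qed
    have "eventually (\<lambda>G. finite G \<and> i \<in> G) (finite_subsets_at_top UNIV)"
      unfolding eventually_finite_subsets_at_top by (intro exI[of _ "{i}"]) auto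
    then have "eventually (\<lambda>G. (\<integral>x. s G x * cnj (e i x) \<partial>M) = a i) (finite_subsets_at_top UNIV)"
      by eventually_elim (simp add: s_def L2_inner_sum e on if_distrib cong: if_cong)
    then show "((\<lambda>G. \<integral>x. s G x * cnj (e i x) \<partial>M) \<longlongrightarrow> a i) (finite_subsets_at_top UNIV)"
      by (rule tendsto_eventually)
  qed simp
  \<comment> \<open>Once the coefficients are known, the projection identity shows that the finite
    sums differ from the squared norm of \<open>\<phi>\<close> by an error tending to 0.\<close>
  have "(ell2_norm a)\<^sup>2 = (\<integral>x. (cmod (\<phi> x))\<^sup>2 \<partial>M)"
  proof (rule tendsto_unique)
    show "((\<lambda>G. \<Sum>i\<in>G. (cmod (a i))\<^sup>2) \<longlongrightarrow> (ell2_norm a)\<^sup>2) (finite_subsets_at_top UNIV)"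
      using a by (simp add: ell2_norm_def infsum_nonneg ell2_def flip: has_sum_def)
    have "((\<lambda>G. (\<integral>x. (cmod (\<phi> x))\<^sup>2 \<partial>M) - (\<integral>x. (cmod (s G x - \<phi> x))\<^sup>2 \<partial>M)) \<longlongrightarrow>
        (\<integral>x. (cmod (\<phi> x))\<^sup>2 \<partial>M) - 0) (finite_subsets_at_top UNIV)"
      by (intro tendsto_intros lim)
    moreover have "eventually (\<lambda>G. (\<integral>x. (cmod (\<phi> x))\<^sup>2 \<partial>M) - (\<integral>x. (cmod (s G x - \<phi> x))\<^sup>2 \<partial>M) =
        (\<Sum>i\<in>G. (cmod (a i))\<^sup>2)) (finite_subsets_at_top UNIV)"
      using eventually_finite_subsets_at_top_weakI[of UNIV finite]
      unfolding s_def by (auto elim!: eventually_mono simp: orthonormal_projection_norm[OF _ \<phi>(1) coeff])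
    ultimately show "((\<lambda>G. \<Sum>i\<in>G. (cmod (a i))\<^sup>2) \<longlongrightarrow> (\<integral>x. (cmod (\<phi> x))\<^sup>2 \<partial>M)) (finite_subsets_at_top UNIV)"
      using tendsto_cong by fastforce
  qed simp
  with \<phi>(1) coeff lim show ?thesis
    unfolding s_def by (intro that) auto
qed

end

section \<open>Riesz bases as images of the standard basis\<close>

definition ell2_unit :: "'i \<Rightarrow> 'i \<Rightarrow> complex" where
  "ell2_unit i j = (if j = i then 1 else 0)"

lemma ell2_unit: "ell2_unit i \<in> ell2"
  by (rule ell2_finite_support) (simp add: ell2_unit_def)

lemma ell2_inner_unit: "ell2_inner f (ell2_unit i) = f i"
proof -
  have "ell2_inner f (ell2_unit i) = (\<Sum>\<^sub>\<infinity>x\<in>{i}. f x * cnj (ell2_unit i x))"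
    unfolding ell2_inner_def by (rule infsum_cong_neutral) (auto simp: ell2_unit_def)
  then show ?thesis
    by (simp add: ell2_unit_def)
qed

lemma ell2_orthonormal_basis_unit: "ell2_orthonormal_basis ell2_unit"
  unfolding ell2_orthonormal_basis_def
  by (auto simp: ell2_unit ell2_inner_unit) (auto simp: ell2_unit_def)

lemma ell2_orthonormal_expansion:
  assumes e: "ell2_orthonormal_basis e" and a: "a \<in> ell2"
  obtains f where "f \<in> ell2" "\<And>i. ell2_inner f (e i) = a i" "ell2_norm f = ell2_norm a"
    "((\<lambda>F. ell2_norm (\<lambda>x. (\<Sum>i\<in>F. a i * e i x) - f x)) \<longlongrightarrow> 0) (finite_subsets_at_top UNIV)"
proof -
  let ?C = "count_space UNIV"
  have e_ell2: "e i \<in> ell2" and "e i \<in> L2 ?C"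
    "(\<integral>x. e i x * cnj (e j x) \<partial>?C) = (if i = j then 1 else 0)" for i j
    using e unfolding ell2_orthonormal_basis_def by (auto simp: ell2_iff_L2 ell2_inner_eq[symmetric])
  from orthonormal_expansion[OF this(2,3) a] obtain f where f: "f \<in> L2 ?C"
    "\<And>i. (\<integral>x. f x * cnj (e i x) \<partial>?C) = a i" 
    "((\<lambda>F. \<integral>x. (cmod ((\<Sum>i\<in>F. a i * e i x) - f x))\<^sup>2 \<partial>?C) \<longlongrightarrow> 0) (finite_subsets_at_top UNIV)"
    "(\<integral>x. (cmod (f x))\<^sup>2 \<partial>?C) = (ell2_norm a)\<^sup>2"
    by blast
  have f': "f \<in> ell2"
    using f by (simp add: ell2_iff_L2)
  show ?thesis
  proof (rule that)
    show "ell2_norm f = ell2_norm a"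
      using f(4) ell2_norm_sq[OF f'] ell2_norm_nonneg[of f] ell2_norm_nonneg[of a] by (metis power2_eq_imp_eq)
    have "(\<integral>x. (cmod ((\<Sum>i\<in>F. a i * e i x) - f x))\<^sup>2 \<partial>?C) = (ell2_norm (\<lambda>x. (\<Sum>i\<in>F. a i * e i x) - f x))\<^sup>2" for F
      by (simp add: ell2_norm_sq ell2_diff ell2_sum ell2_cmult e_ell2 f')
    then show "((\<lambda>F. ell2_norm (\<lambda>x. (\<Sum>i\<in>F. a i * e i x) - f x)) \<longlongrightarrow> 0) (finite_subsets_at_top UNIV)"
      using tendsto_real_sqrt[OF f(3)] by (simp add: ell2_norm_nonneg)
  qed (use f f' e_ell2 in \<open>auto simp: ell2_inner_eq\<close>)
qed

lemma ell2_orthonormal_eqI: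
  assumes "ell2_orthonormal_basis e" "f \<in> ell2" "g \<in> ell2" "\<And>i. ell2_inner f (e i) = ell2_inner g (e i)"
  shows "f = g"
proof -
  have "e i \<in> ell2" for i
    using assms(1) by (simp add: ell2_orthonormal_basis_def)
  then have "ell2_inner (\<lambda>x. f x - g x) (e i) = 0" for i
    using ell2_inner_diff_right[of "e i" f g] assms(2-4) ell2_inner_cnj[of _ "e i"]
    by (metis complex_cnj_zero eq_iff_diff_eq_0 complex_cnj_cancel_iff)
  then have "(\<lambda>x. f x - g x) = (\<lambda>_. 0)"
    using assms(1-3) ell2_diff[of f g] unfolding ell2_orthonormal_basis_def by blast
  then show ?thesis
    by (auto simp: fun_eq_iff)
qed

lemma ell2_unit_sum_tendsto:
  assumes a: "a \<in> ell2"
  shows "((\<lambda>F. ell2_norm (\<lambda>x. (\<Sum>i\<in>F. a i * ell2_unit i x) - a x)) \<longlongrightarrow> 0) (finite_subsets_at_top UNIV)"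
proof -
  obtain f where "\<And>i. ell2_inner f (ell2_unit i) = a i"
    "((\<lambda>F. ell2_norm (\<lambda>x. (\<Sum>i\<in>F. a i * ell2_unit i x) - f x)) \<longlongrightarrow> 0) (finite_subsets_at_top UNIV)"
    by (rule ell2_orthonormal_expansion[OF ell2_orthonormal_basis_unit a]) blast
  moreover from this(1) have "f = a"
    by (auto simp: ell2_inner_unit)
  ultimately show ?thesis by simp
qed

lemma ell2_has_sum_unique:
  assumes "ell2_has_sum x s" "ell2_has_sum x t" "\<And>i. x i \<in> ell2"
  shows "s = t"
proof -
  have st: "s \<in> ell2" "t \<in> ell2"
    and lim: "((\<lambda>F. ell2_norm (\<lambda>a. (\<Sum>i\<in>F. x i a) - s a)) \<longlongrightarrow> 0) (finite_subsets_at_top UNIV)"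
      "((\<lambda>F. ell2_norm (\<lambda>a. (\<Sum>i\<in>F. x i a) - t a)) \<longlongrightarrow> 0) (finite_subsets_at_top UNIV)"
    using assms by (auto simp: ell2_has_sum_def)
  let ?b = "\<lambda>F. 2 * (ell2_norm (\<lambda>a. (\<Sum>i\<in>F. x i a) - t a))\<^sup>2 + 2 * (ell2_norm (\<lambda>a. (\<Sum>i\<in>F. x i a) - s a))\<^sup>2"
  have "(?b \<longlongrightarrow> 2 * 0\<^sup>2 + 2 * 0\<^sup>2) (finite_subsets_at_top UNIV)"
    by (intro tendsto_intros lim)
  moreover have "(ell2_norm (\<lambda>a. s a - t a))\<^sup>2 \<le> ?b F" for F
  proof -
    have "(\<lambda>a. (\<Sum>i\<in>F. x i a)) \<in> ell2"
      using assms(3) by (rule ell2_sum)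
    with st show ?thesis
      using ell2_norm_diff_sq_le[of "\<lambda>a. (\<Sum>i\<in>F. x i a) - t a" "\<lambda>a. (\<Sum>i\<in>F. x i a) - s a"]
      by (simp add: ell2_diff)
  qed
  ultimately have "(ell2_norm (\<lambda>a. s a - t a))\<^sup>2 \<le> 2 * 0\<^sup>2 + 2 * 0\<^sup>2"
    by (intro tendsto_lowerbound[OF _ always_eventually]) auto
  then have "ell2_norm (\<lambda>a. s a - t a) = 0" by simp
  then show ?thesis using st ell2_norm_diff_eq_0 by blast
qed

section \<open>Bounded invertible operators as synthesis operators\<close>

context
  fixes T :: "('a \<Rightarrow> complex) \<Rightarrow> ('a \<Rightarrow> complex)"
  assumes T: "ell2_bounded_invertible T"
begin

lemma ell2_bi_mem: "f \<in> ell2 \<Longrightarrow> T f \<in> ell2"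
  and ell2_bi_add: "f \<in> ell2 \<Longrightarrow> g \<in> ell2 \<Longrightarrow> T (\<lambda>x. f x + g x) = (\<lambda>x. T f x + T g x)"
  and ell2_bi_cmult: "f \<in> ell2 \<Longrightarrow> T (\<lambda>x. c * f x) = (\<lambda>x. c * T f x)"
  using T unfolding ell2_bounded_invertible_def bij_betw_def by auto

lemma ell2_bi_surj: "g \<in> ell2 \<Longrightarrow> \<exists>f\<in>ell2. T f = g"
  using T unfolding ell2_bounded_invertible_def bij_betw_def by (metis imageE)

lemma ell2_bi_diff: "f \<in> ell2 \<Longrightarrow> g \<in> ell2 \<Longrightarrow> T (\<lambda>x. f x - g x) = (\<lambda>x. T f x - T g x)"
  using ell2_bi_add[of f "\<lambda>x. (-1) * g x"] ell2_bi_cmult[of g "-1"] ell2_cmult[of g "-1"] by simp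

lemma ell2_bi_sum: "finite F \<Longrightarrow> (\<And>i. f i \<in> ell2) \<Longrightarrow> T (\<lambda>x. \<Sum>i\<in>F. a i * f i x) = (\<lambda>x. \<Sum>i\<in>F. a i * T (f i) x)"
proof (induction F rule: finite_induct)
  case empty
  show ?case using ell2_bi_cmult[OF ell2_zero, of 0] by simp
next
  case (insert j F)
  then show ?case
    by (simp add: ell2_bi_add ell2_bi_cmult ell2_cmult ell2_sum)
qed

lemma ell2_bi_bounded: obtains C where "0 \<le> C" "\<And>f. f \<in> ell2 \<Longrightarrow> (ell2_norm (T f))\<^sup>2 \<le> C * (ell2_norm f)\<^sup>2"
proof -
  obtain C where "\<And>f. f \<in> ell2 \<Longrightarrow> ell2_norm (T f) \<le> C * ell2_norm f"
    using T unfolding ell2_bounded_invertible_def by blast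
  then have "(ell2_norm (T f))\<^sup>2 \<le> C\<^sup>2 * (ell2_norm f)\<^sup>2" if "f \<in> ell2" for f
    using that power_mono[OF _ ell2_norm_nonneg, of "T f" "C * ell2_norm f" 2] by (simp add: power_mult_distrib)
  then show ?thesis using that[of "C\<^sup>2"] by simp
qed

lemma ell2_bi_bounded_below: obtains c where "0 < c" "\<And>f. f \<in> ell2 \<Longrightarrow> c * (ell2_norm f)\<^sup>2 \<le> (ell2_norm (T f))\<^sup>2"
proof -
  obtain C where C: "\<And>f. f \<in> ell2 \<Longrightarrow> ell2_norm f \<le> C * ell2_norm (T f)"
    using T unfolding ell2_bounded_invertible_def by blast
  \<comment> \<open>Adding 1 makes the denominator positive without an argument about the sign of
    \<open>C\<close>.\<close>
  have "1 / (C\<^sup>2 + 1) * (ell2_norm f)\<^sup>2 \<le> (ell2_norm (T f))\<^sup>2" if "f \<in> ell2" for f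
  proof -
    have "(ell2_norm f)\<^sup>2 \<le> C\<^sup>2 * (ell2_norm (T f))\<^sup>2"
      using C[OF that] power_mono[OF _ ell2_norm_nonneg, of f "C * ell2_norm (T f)" 2] by (simp add: power_mult_distrib)
    also have "\<dots> \<le> (C\<^sup>2 + 1) * (ell2_norm (T f))\<^sup>2"
      by (intro mult_right_mono) auto
    finally show ?thesis
      using add_nonneg_pos[OF zero_le_power2[of C] zero_less_one] by (simp add: field_simps)
  qed
  moreover have "0 < 1 / (C\<^sup>2 + 1)"
    using add_nonneg_pos[OF zero_le_power2[of C] zero_less_one] by simp
  ultimately show ?thesis using that by blast
qed

text \<open>Boundedness carries the expansion of \<open>a\<close> in unit vectors to an expansion of
  \<open>T a\<close>: thus \<open>T\<close> is the synthesis operator of the system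
  \<open>T (ell2_unit i)\<close>.\<close>

lemma ell2_bi_has_sum:
  assumes a: "a \<in> ell2"
  shows "ell2_has_sum (\<lambda>i y. a i * T (ell2_unit i) y) (T a)"
  unfolding ell2_has_sum_def
proof
  obtain C where C: "0 \<le> C" "\<And>f. f \<in> ell2 \<Longrightarrow> (ell2_norm (T f))\<^sup>2 \<le> C * (ell2_norm f)\<^sup>2"
    using ell2_bi_bounded by blast
  let ?d = "\<lambda>F x. (\<Sum>i\<in>F. a i * ell2_unit i x) - a x"
  have "((\<lambda>F. sqrt (C * (ell2_norm (?d F))\<^sup>2)) \<longlongrightarrow> sqrt (C * 0\<^sup>2)) (finite_subsets_at_top UNIV)"
    by (intro tendsto_intros ell2_unit_sum_tendsto a)
  then have lim: "((\<lambda>F. sqrt (C * (ell2_norm (?d F))\<^sup>2)) \<longlongrightarrow> 0) (finite_subsets_at_top UNIV)"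
    by simp
  show "((\<lambda>F. ell2_norm (\<lambda>y. (\<Sum>i\<in>F. a i * T (ell2_unit i) y) - T a y)) \<longlongrightarrow> 0) (finite_subsets_at_top UNIV)"
  proof (rule Lim_null_comparison[OF _ lim])
    have "norm (ell2_norm (\<lambda>y. (\<Sum>i\<in>F. a i * T (ell2_unit i) y) - T a y)) \<le> sqrt (C * (ell2_norm (?d F))\<^sup>2)"
      if "finite F" for F
    proof -
      have "(\<lambda>y. (\<Sum>i\<in>F. a i * T (ell2_unit i) y) - T a y) = T (?d F)"
        using that a by (simp add: ell2_bi_diff ell2_bi_sum ell2_sum ell2_cmult ell2_unit)
      then show ?thesis
        using C(2)[of "?d F"] a
        by (simp add: ell2_norm_nonneg real_le_rsqrt ell2_diff ell2_sum ell2_cmult ell2_unit)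
    qed
    then show "\<forall>\<^sub>F F in finite_subsets_at_top UNIV. norm (ell2_norm (\<lambda>y. (\<Sum>i\<in>F. a i * T (ell2_unit i) y) - T a y))
        \<le> sqrt (C * (ell2_norm (?d F))\<^sup>2)"
      by (auto intro: eventually_finite_subsets_at_top_weakI)
  qed
qed (simp add: ell2_bi_mem a)

text \<open>\<open>riesz_bounds\<close> only asks for some sum of the series; sums are unique, so it
  must be \<open>T a\<close>, and the bounds become norm inequalities for \<open>T\<close>.\<close>

lemma riesz_bounds_iff:
  "riesz_bounds (\<lambda>i. T (ell2_unit i)) A B \<longleftrightarrow>
    (\<forall>a\<in>ell2. A * (ell2_norm a)\<^sup>2 \<le> (ell2_norm (T a))\<^sup>2 \<and> (ell2_norm (T a))\<^sup>2 \<le> B * (ell2_norm a)\<^sup>2)"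
proof -
  have "s = T a" if "ell2_has_sum (\<lambda>i y. a i * T (ell2_unit i) y) s" "a \<in> ell2" for a s
    using that(1) ell2_bi_has_sum[OF that(2)]
    by (rule ell2_has_sum_unique) (simp add: ell2_cmult ell2_unit ell2_bi_mem)
  then show ?thesis
    unfolding riesz_bounds_def using ell2_bi_has_sum by (intro ball_cong refl) blast
qed

text \<open>\<open>y\<close> is the sum of a series in the vectors \<open>T (ell2_unit i)\<close>,
  and all partial sums are orthogonal to \<open>y\<close>; hence \<open>y\<close> is orthogonal to
  itself. Uniqueness of the dual basis rests on this.\<close>

lemma ell2_bi_total:
  assumes y: "y \<in> ell2" and ortho: "\<And>i. ell2_inner (T (ell2_unit i)) y = 0"
  shows "y = (\<lambda>_. 0)"
proof -
  obtain b where b: "b \<in> ell2" "T b = y"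
    using ell2_bi_surj[OF y] by blast
  let ?s = "\<lambda>F x. \<Sum>i\<in>F. b i * T (ell2_unit i) x"
  have s: "?s F \<in> ell2" for F
    by (intro ell2_sum ell2_cmult ell2_bi_mem ell2_unit)
  have "(ell2_norm y)\<^sup>2 \<le> ell2_norm y * ell2_norm (\<lambda>x. ?s F x - y x)" for F
  proof -
    have "ell2_inner (?s F) y = (\<Sum>i\<in>F. b i * ell2_inner (T (ell2_unit i)) y)"
      using s[of F] y L2_inner_sum[of y "count_space UNIV" "\<lambda>i. T (ell2_unit i)" b F]
      by (simp add: ell2_inner_eq ell2_bi_mem ell2_unit ell2_iff_L2[symmetric])
    then have "ell2_inner (?s F) y = 0"
      by (simp add: ortho)
    then have "ell2_inner y (?s F) = 0"
      by (subst ell2_inner_cnj) simp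
    then have "ell2_inner y (\<lambda>x. ?s F x - y x) = - complex_of_real ((ell2_norm y)\<^sup>2)"
      using y s by (simp add: ell2_inner_diff_right ell2_inner_self)
    then show ?thesis
      using ell2_cauchy_schwarz[OF y ell2_diff[OF s y], of F] by (simp add: norm_power ell2_norm_nonneg)
  qed
  moreover have "((\<lambda>F. ell2_norm y * ell2_norm (\<lambda>x. ?s F x - y x)) \<longlongrightarrow> ell2_norm y * 0) (finite_subsets_at_top UNIV)"
    using ell2_bi_has_sum[OF b(1)] b(2) unfolding ell2_has_sum_def by (intro tendsto_intros) simp
  ultimately have "(ell2_norm y)\<^sup>2 \<le> ell2_norm y * 0"
    by (intro tendsto_lowerbound[OF _ always_eventually]) auto
  then have "ell2_norm y = 0" by simp
  then show ?thesis using ell2_norm_eq_0[OF y] by simp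
qed

end

text \<open>The unitary operator \<open>U\<close> that takes the standard basis to \<open>e\<close>
  is absorbed into \<open>T\<close>. Here the index set and the underlying set coincide, as they do
  for translates by group elements, so \<open>T \<circ> U\<close> acts on a single space.\<close>

theorem riesz_basis_iff:
  fixes x :: "'i \<Rightarrow> 'i \<Rightarrow> complex"
  shows "riesz_basis x \<longleftrightarrow> (\<exists>S. ell2_bounded_invertible S \<and> (\<forall>i. x i = S (ell2_unit i)))"
proof
  assume "\<exists>S. ell2_bounded_invertible S \<and> (\<forall>i. x i = S (ell2_unit i))"
  then show "riesz_basis x"
    unfolding riesz_basis_def using ell2_orthonormal_basis_unit by blast
next
  assume "riesz_basis x"
  then obtain e :: "'i \<Rightarrow> 'i \<Rightarrow> complex" and T where e: "ell2_orthonormal_basis e" and T: "ell2_bounded_invertible T" and x: "\<And>i. x i = T (e i)"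
    unfolding riesz_basis_def by blast
  have e_ell2: "e i \<in> ell2" and e_on: "ell2_inner (e i) (e j) = (if i = j then 1 else 0)" for i j
    using e by (auto simp: ell2_orthonormal_basis_def)
  have "\<forall>a\<in>ell2. \<exists>f\<in>ell2. (\<forall>i. ell2_inner f (e i) = a i) \<and> ell2_norm f = ell2_norm a"
  proof
    fix a :: "'i \<Rightarrow> complex" assume "a \<in> ell2"
    then obtain f where "f \<in> ell2" "\<And>i. ell2_inner f (e i) = a i" "ell2_norm f = ell2_norm a"
      by (rule ell2_orthonormal_expansion[OF e]) blast
    then show "\<exists>f\<in>ell2. (\<forall>i. ell2_inner f (e i) = a i) \<and> ell2_norm f = ell2_norm a"
      by blast
  qed
  then obtain U where U: "\<And>a. a \<in> ell2 \<Longrightarrow> U a \<in> ell2" "\<And>a i. a \<in> ell2 \<Longrightarrow> ell2_inner (U a) (e i) = a i"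
      "\<And>a. a \<in> ell2 \<Longrightarrow> ell2_norm (U a) = ell2_norm a"
    by metis
  \<comment> \<open>\<open>U\<close> comes from a choice; its linearity and its values on unit
    vectors follow because a vector is determined by its coefficients with respect to
    \<open>e\<close>.\<close>
  have U_eqI: "U a = f" if "a \<in> ell2" "f \<in> ell2" "\<And>i. ell2_inner f (e i) = a i" for a f
    using that U by (intro ell2_orthonormal_eqI[OF e]) auto
  have inner: "ell2_inner f (e i) = (\<integral>x. f x * cnj (e i x) \<partial>count_space UNIV)"
      "integrable (count_space UNIV) (\<lambda>x. f x * cnj (e i x))" if "f \<in> ell2" for f i
    using that e_ell2 by (auto simp: ell2_inner_eq ell2_iff_L2[symmetric] intro!: L2_mult_integrable L2_cnj)
  have U_add: "U (\<lambda>i. a i + b i) = (\<lambda>x. U a x + U b x)" if "a \<in> ell2" "b \<in> ell2" for a b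
  proof (rule U_eqI)
    fix i
    have "ell2_inner (\<lambda>x. U a x + U b x) (e i) = ell2_inner (U a) (e i) + ell2_inner (U b) (e i)"
      using that U(1) by (simp add: inner ell2_add distrib_right)
    then show "ell2_inner (\<lambda>x. U a x + U b x) (e i) = a i + b i"
      using that by (simp add: U(2))
  qed (use that U in \<open>auto simp: ell2_add\<close>)
  have U_cmult: "U (\<lambda>i. c * a i) = (\<lambda>x. c * U a x)" if "a \<in> ell2" for a c
  proof (rule U_eqI)
    fix i
    have "ell2_inner (\<lambda>x. c * U a x) (e i) = c * ell2_inner (U a) (e i)"
      using that U(1) by (simp add: inner ell2_cmult mult.assoc)
    then show "ell2_inner (\<lambda>x. c * U a x) (e i) = c * a i"
      using that by (simp add: U(2))
  qed (use that U in \<open>auto simp: ell2_cmult\<close>)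
  have U_unit: "U (ell2_unit i) = e i" for i
    by (rule U_eqI) (auto simp: ell2_unit e_ell2 e_on ell2_unit_def)
  have U_bij: "bij_betw U ell2 ell2"
    unfolding bij_betw_def
  proof
    show "inj_on U ell2"
      by (rule inj_onI) (metis U(2) ext)
    have "f \<in> U ` ell2" if f: "f \<in> ell2" for f
    proof -
      \<comment> \<open>Bessel's inequality makes the coefficients of \<open>f\<close>
        square-summable, hence an admissible argument of \<open>U\<close>.\<close>
      let ?a = "\<lambda>i. ell2_inner f (e i)"
      have "?a \<in> ell2"
        unfolding inner(1)[OF f]
        using e_ell2 e_on f by (intro orthonormal_bessel) (auto simp: ell2_iff_L2 ell2_inner_eq[symmetric])
      moreover from this have "U ?a = f"
        using f by (intro U_eqI) auto
      ultimately show ?thesis by force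
    qed
    then show "U ` ell2 = ell2"
      using U(1) by auto
  qed
  have "ell2_bounded_invertible (T \<circ> U)"
    unfolding ell2_bounded_invertible_def
  proof (intro conjI allI ballI)
    have "bij_betw T ell2 ell2"
      using T by (simp add: ell2_bounded_invertible_def)
    then show "bij_betw (T \<circ> U) ell2 ell2"
      using U_bij by (rule bij_betw_trans[rotated])
    obtain C D where "\<And>f. f \<in> ell2 \<Longrightarrow> ell2_norm (T f) \<le> C * ell2_norm f"
        "\<And>f. f \<in> ell2 \<Longrightarrow> ell2_norm f \<le> D * ell2_norm (T f)"
      using T unfolding ell2_bounded_invertible_def by blast
    from this[OF U(1)]
    show "\<exists>C. \<forall>f\<in>ell2. ell2_norm ((T \<circ> U) f) \<le> C * ell2_norm f" "\<exists>C. \<forall>f\<in>ell2. ell2_norm f \<le> C * ell2_norm ((T \<circ> U) f)"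
      by (auto simp: U(3))
  qed (simp_all add: U U_add U_cmult ell2_bi_add[OF T] ell2_bi_cmult[OF T])
  then show "\<exists>S. ell2_bounded_invertible S \<and> (\<forall>i. x i = S (ell2_unit i))"
    using U_unit x by (intro exI[of _ "T \<circ> U"]) simp
qed

text \<open>
  The library knows that function spaces are Hausdorff only for countable index types, by
  metrizability; the Stone--Weierstrass theorem needs it for all of them. The weaker separation
  classes have to be declared first, for coherence with the metric instance.
\<close>

instance "fun" :: (type, t0_space) t0_space
proof
  fix f g :: "'a \<Rightarrow> 'b" assume "f \<noteq> g"
  then obtain i where "f i \<noteq> g i" by auto
  then obtain U where "open U" "(f i \<in> U) \<noteq> (g i \<in> U)" using t0_space_class.t0_space by metis
  moreover have "open ((\<lambda>h. h i) -` U)"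
    using \<open>open U\<close> by (auto intro!: open_vimage continuous_on_product_coordinates)
  ultimately show "\<exists>U. open U \<and> \<not> (f \<in> U \<longleftrightarrow> g \<in> U)"
    by (intro exI[of _ "(\<lambda>h. h i) -` U"]) auto
qed

instance "fun" :: (type, t1_space) t1_space
proof
  fix f g :: "'a \<Rightarrow> 'b" assume "f \<noteq> g"
  then obtain i where "f i \<noteq> g i" by auto
  then obtain U where "open U" "f i \<in> U" "g i \<notin> U" using t1_space_class.t1_space by metis
  moreover have "open ((\<lambda>h. h i) -` U)"
    using \<open>open U\<close> by (auto intro!: open_vimage continuous_on_product_coordinates)
  ultimately show "\<exists>U. open U \<and> f \<in> U \<and> g \<notin> U"
    by (intro exI[of _ "(\<lambda>h. h i) -` U"]) auto
qed

instance "fun" :: (type, t2_space) t2_space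
proof
  fix f g :: "'a \<Rightarrow> 'b" assume "f \<noteq> g"
  then obtain i where "f i \<noteq> g i" by auto
  then obtain U V where "open U" "open V" "f i \<in> U" "g i \<in> V" "U \<inter> V = {}" using hausdorff by metis
  moreover have "open ((\<lambda>h. h i) -` U)" "open ((\<lambda>h. h i) -` V)"
    using \<open>open U\<close> \<open>open V\<close> by (auto intro!: open_vimage continuous_on_product_coordinates)
  ultimately show "\<exists>U V. open U \<and> open V \<and> f \<in> U \<and> g \<in> V \<and> U \<inter> V = {}"
    by (intro exI[of _ "(\<lambda>h. h i) -` U"] exI[of _ "(\<lambda>h. h i) -` V"]) auto
qed

section \<open>The dual group\<close>

text \<open>A closed subset of a product of circles, which is compact by Tychonoff's
  theorem.\<close>

lemma compact_dual_group: "compact (dual_group :: ('n::ab_group_add \<Rightarrow> complex) set)"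
proof -
  have "compactin (product_topology (\<lambda>_. euclidean) UNIV) (PiE (UNIV::'n set) (\<lambda>_. sphere (0::complex) 1))"
    by (subst compactin_PiE) auto
  then have "compact (PiE (UNIV::'n set) (\<lambda>_. sphere (0::complex) 1))"
    by (simp add: euclidean_product_topology)
  moreover have "closed {\<xi> :: 'n \<Rightarrow> complex. \<forall>m n. \<xi> (m + n) = \<xi> m * \<xi> n}"
    by (intro closed_Collect_all closed_Collect_eq continuous_intros continuous_on_product_coordinates)
  moreover have "(dual_group :: ('n \<Rightarrow> complex) set) = PiE (UNIV::'n set) (\<lambda>_. sphere (0::complex) 1) \<inter> {\<xi>. \<forall>m n. \<xi> (m + n) = \<xi> m * \<xi> n}"
    by (auto simp: dual_group_def)
  ultimately show ?thesis
    using compact_Int_closed[of "PiE (UNIV::'n set) (\<lambda>_. sphere (0::complex) 1)" "{\<xi> :: 'n \<Rightarrow> complex. \<forall>m n. \<xi> (m + n) = \<xi> m * \<xi> n}"] by metis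
qed

lemma dual_group_simps:
  assumes "\<xi> \<in> dual_group"
  shows "cmod (\<xi> n) = 1" "\<xi> (m + n) = \<xi> m * \<xi> n" "\<xi> 0 = 1" "\<xi> (- n) = cnj (\<xi> n)"
    "\<xi> (m - n) = \<xi> m * cnj (\<xi> n)" "\<xi> n * cnj (\<xi> n) = 1" "cnj (\<xi> n) * \<xi> n = 1"
proof -
  show norm: "cmod (\<xi> n) = 1" and add: "\<xi> (m + n) = \<xi> m * \<xi> n" for m n
    using assms by (auto simp: dual_group_def)
  have unit: "\<xi> n * cnj (\<xi> n) = 1" for n
    using norm[of n] by (simp add: complex_norm_square[symmetric])
  then show "\<xi> n * cnj (\<xi> n) = 1" "cnj (\<xi> n) * \<xi> n = 1"
    by (simp_all add: mult.commute)
  have "\<xi> 0 * \<xi> 0 = \<xi> 0 * 1" "\<xi> 0 \<noteq> 0"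
    using add[of 0 0] norm[of 0] by auto
  then show zero: "\<xi> 0 = 1"
    by simp
  show neg: "\<xi> (- n) = cnj (\<xi> n)" for n
  proof -
    have "\<xi> n * \<xi> (- n) = \<xi> n * cnj (\<xi> n)" "\<xi> n \<noteq> 0"
      using add[of n "- n"] norm[of n] unit[of n] zero by auto
    then show ?thesis by simp
  qed
  show "\<xi> (m - n) = \<xi> m * cnj (\<xi> n)"
    using add[of m "- n"] neg by simp
qed

subsection \<open>Characters separate the points of a discrete abelian group\<close>

text \<open>Multiples by natural numbers; in the extension below an integer multiple is written as a
  difference \<open>nmul i x - nmul j x\<close>.\<close>

primrec nmul :: "nat \<Rightarrow> 'a::monoid_add \<Rightarrow> 'a" where
  "nmul 0 x = 0"
| "nmul (Suc k) x = x + nmul k x"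

lemma nmul_add: "nmul (i + j) x = nmul i x + nmul j x"
  by (induction i) (auto simp: add.assoc)

lemma nmul_mult: "nmul (i * j) x = nmul i (nmul j x)"
  by (induction i) (auto simp: nmul_add)

text \<open>
  Characters of subgroups are represented by their graphs, so that Zorn's lemma applies to
  inclusion and unions of sets.
\<close>

definition character_graph :: "('n::ab_group_add \<times> complex) set \<Rightarrow> bool" where
  "character_graph G \<longleftrightarrow> (0, 1) \<in> G \<and>
     (\<forall>x z y w. (x, z) \<in> G \<longrightarrow> (y, w) \<in> G \<longrightarrow> (x + y, z * w) \<in> G) \<and>
     (\<forall>x z. (x, z) \<in> G \<longrightarrow> (- x, cnj z) \<in> G \<and> cmod z = 1) \<and>
     (\<forall>z. (0, z) \<in> G \<longrightarrow> z = 1)"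

lemma character_graphD:
  assumes "character_graph G"
  shows "(0, 1) \<in> G" "(x, z) \<in> G \<Longrightarrow> (y, w) \<in> G \<Longrightarrow> (x + y, z * w) \<in> G"
    "(x, z) \<in> G \<Longrightarrow> (- x, cnj z) \<in> G" "(x, z) \<in> G \<Longrightarrow> cmod z = 1" "(x, z) \<in> G \<Longrightarrow> z * cnj z = 1"
    "(0, z) \<in> G \<Longrightarrow> z = 1"
  using assms complex_norm_square[of z, symmetric] unfolding character_graph_def by auto

lemma character_graph_unique:
  assumes G: "character_graph G" and "(x, z) \<in> G" "(x, w) \<in> G"
  shows "z = w"
proof -
  have "(x + (- x), z * cnj w) \<in> G"
    using assms by (intro character_graphD(2,3)[OF G])
  then have "z * cnj w = 1"
    using character_graphD(6)[OF G] by simp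
  then have "z * (w * cnj w) = w"
    by (simp add: mult.left_commute)
  then show ?thesis
    using character_graphD(5)[OF G assms(3)] by simp
qed

lemma character_graph_nmul: "character_graph G \<Longrightarrow> (x, z) \<in> G \<Longrightarrow> (nmul k x, z ^ k) \<in> G"
  by (induction k) (auto simp: character_graphD)

text \<open>Supplies the value at a new element \<open>x\<close>: it must agree with the multiples
  of \<open>x\<close> that already have a value, and differ from 1 so that \<open>x\<close> is
  separated from 0. If no positive multiple has a value, -1 works. Otherwise let \<open>k\<close> be
  the least such multiple, which is at least 2, and choose among the \<open>k\<close> distinct
  \<open>k\<close>-th roots of its value.\<close>

lemma character_value_exists:
  assumes G: "character_graph G" and x: "x \<notin> Domain G"
  obtains w where "cmod w = 1" "w \<noteq> 1" "\<And>k z. (nmul k x, z) \<in> G \<Longrightarrow> w ^ k = z"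
proof (cases "\<exists>k>0. nmul k x \<in> Domain G")
  case False
  then have "k = 0 \<and> z = 1" if "(nmul k x, z) \<in> G" for k z
    using that character_graphD(6)[OF G] by (cases k) fastforce+
  then show ?thesis
    using that[of "-1"] by force
next
  case True
  define k where "k = (LEAST k. 0 < k \<and> nmul k x \<in> Domain G)"
  have k: "0 < k" "nmul k x \<in> Domain G" and least: "\<And>j. 0 < j \<Longrightarrow> nmul j x \<in> Domain G \<Longrightarrow> k \<le> j"
    unfolding k_def using LeastI_ex[OF True] by (auto intro: Least_le)
  obtain z where z: "(nmul k x, z) \<in> G"
    using k(2) by blast
  have "k \<noteq> 1"
    using k(2) x by auto
  with k have "2 \<le> k" by simp
  have "z \<noteq> 0"
    using character_graphD(4)[OF G z] by auto
  then have "card {w. w ^ k = z} = k"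
    using card_nth_roots k(1) by blast
  then have "\<not> {w. w ^ k = z} \<subseteq> {1}"
    using \<open>2 \<le> k\<close> card_mono[of "{1}" "{w. w ^ k = z}"] by auto
  then obtain w where w: "w ^ k = z" "w \<noteq> 1"
    by auto
  show ?thesis
  proof (rule that[OF _ w(2)])
    have "cmod w ^ k = 1"
      using w(1) character_graphD(4)[OF G z] by (simp flip: norm_power)
    then show "cmod w = 1"
      using k(1) power_eq_imp_eq_base[of "cmod w" k 1] by simp
    fix j y assume y: "(nmul j x, y) \<in> G"
    \<comment> \<open>Division with remainder: subtracting the multiple of \<open>k\<close> leaves
      \<open>nmul r x\<close> in the domain, so minimality of \<open>k\<close> forces
      \<open>r = 0\<close>.\<close>
    define q r where "q = j div k" "r = j mod k"
    have j: "j = r + q * k"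
      by (simp add: q_r_def)
    have zq: "(nmul (q * k) x, z ^ q) \<in> G"
      using character_graph_nmul[OF G z] by (simp add: nmul_mult)
    have "(nmul j x + (- nmul (q * k) x), y * cnj (z ^ q)) \<in> G"
      by (intro character_graphD(2,3)[OF G] y zq)
    then have "(nmul r x, y * cnj (z ^ q)) \<in> G"
      by (simp add: j nmul_add)
    moreover have "r < k"
      using k(1) by (simp add: q_r_def)
    ultimately have "r = 0"
      using least[of r] by (cases "r = 0") (auto simp: Domain.simps)
    then have "y = z ^ q"
      using y zq by (intro character_graph_unique[OF G]) (auto simp: j)
    then show "w ^ j = y"
      using \<open>r = 0\<close> w(1) by (simp add: j mult.commute power_mult)
  qed
qed

text \<open>The graph generated by \<open>G\<close> and \<open>(x, w)\<close>. Two natural exponents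
  stand for one integer exponent, as \<open>cnj w\<close> is the inverse of \<open>w\<close>.
  Well-definedness is the last clause of \<open>character_graph\<close>; there the compatibility of
  \<open>w\<close> with \<open>G\<close> enters, according to the sign of
  \<open>j - i\<close>.\<close>

lemma character_graph_extend:
  assumes G: "character_graph G" and x: "x \<notin> Domain G"
  obtains G' w where "character_graph G'" "G \<subseteq> G'" "(x, w) \<in> G'" "w \<noteq> 1"
proof -
  obtain w where w: "cmod w = 1" "w \<noteq> 1" "\<And>k z. (nmul k x, z) \<in> G \<Longrightarrow> w ^ k = z"
    using character_value_exists[OF G x] by blast
  define G' where "G' = {(y + nmul i x - nmul j x, z * w ^ i * cnj w ^ j) | y z i j. (y, z) \<in> G}"
  have memI: "(a, b) \<in> G'" if "(y, z) \<in> G" "a = y + nmul i x - nmul j x" "b = z * w ^ i * cnj w ^ j" for a b y z i j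
    unfolding G'_def using that by blast
  have ww: "w * cnj w = 1"
    using w(1) complex_norm_square[of w] by simp
  have wwp: "w ^ i * cnj w ^ i = 1" for i
    using ww by (simp flip: power_mult_distrib)
  have "character_graph G'"
    unfolding character_graph_def
  proof (intro conjI allI impI)
    show "(0, 1) \<in> G'"
      by (rule memI[of 0 1 _ 0 0]) (auto simp: character_graphD[OF G])
    show "(a + a', b * b') \<in> G'" if ab: "(a, b) \<in> G'" "(a', b') \<in> G'" for a b a' b'
    proof -
      obtain y z i j where 1: "(y, z) \<in> G" "a = y + nmul i x - nmul j x" "b = z * w ^ i * cnj w ^ j"
        using ab(1) unfolding G'_def by blast
      obtain y' z' i' j' where 2: "(y', z') \<in> G" "a' = y' + nmul i' x - nmul j' x" "b' = z' * w ^ i' * cnj w ^ j'"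
        using ab(2) unfolding G'_def by blast
      show ?thesis
        by (rule memI[OF character_graphD(2)[OF G 1(1) 2(1)], of _ "i + i'" "j + j'"])
          (simp_all add: 1 2 nmul_add power_add)
    qed
    fix a b assume "(a, b) \<in> G'"
    then obtain y z i j where 1: "(y, z) \<in> G" "a = y + nmul i x - nmul j x" "b = z * w ^ i * cnj w ^ j"
      unfolding G'_def by blast
    show "(- a, cnj b) \<in> G'"
      by (rule memI[OF character_graphD(3)[OF G 1(1)], of _ j i]) (simp_all add: 1)
    show "cmod b = 1"
      using w(1) character_graphD(4)[OF G 1(1)] by (simp add: 1 norm_mult norm_power)
  next
    fix b assume "(0, b) \<in> G'"
    then obtain y z i j where 1: "(y, z) \<in> G" "0 = y + nmul i x - nmul j x" "b = z * w ^ i * cnj w ^ j"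
      unfolding G'_def by blast
    show "b = 1"
    proof (cases "i \<le> j")
      case True
      then obtain d where j: "j = i + d"
        using le_Suc_ex by blast
      have "nmul d x = y"
        using 1(2) by (simp add: j nmul_add)
      then have "w ^ d = z"
        using w(3) 1(1) by simp
      then have "b = (w ^ d * cnj w ^ d) * (w ^ i * cnj w ^ i)"
        by (simp add: 1 j power_add)
      then show ?thesis
        by (simp only: wwp mult_1_left)
    next
      case False
      then obtain d where i: "i = j + d"
        using le_Suc_ex nat_le_linear by blast
      have "nmul d x = - y"
        using 1(2) by (simp add: i nmul_add eq_neg_iff_add_eq_0 add.commute)
      then have "w ^ d = cnj z"
        using w(3) character_graphD(3)[OF G 1(1)] by simp
      then have "b = (z * cnj z) * (w ^ j * cnj w ^ j)"
        by (simp add: 1 i power_add)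
      then show ?thesis
        by (simp only: wwp character_graphD(5)[OF G 1(1)] mult_1_left)
    qed
  qed
  moreover have "G \<subseteq> G'"
    by (auto intro!: memI[of _ _ _ 0 0])
  moreover have "(x, w) \<in> G'"
    by (rule memI[OF character_graphD(1)[OF G], of _ 1 0]) auto
  ultimately show ?thesis
    using that w(2) by blast
qed

text \<open>The value at \<open>n\<close> is fixed before the maximal extension is taken: Zorn's
  lemma runs over the graphs above \<open>G1\<close>, where \<open>n\<close> already has a value
  other than 1. A maximal graph has full domain, since a missing element could be adjoined.\<close>

theorem characters_separate:
  fixes n :: "'n::ab_group_add"
  assumes "n \<noteq> 0"
  obtains \<xi> where "\<xi> \<in> dual_group" "\<xi> n \<noteq> 1"
proof -
  have G0: "character_graph {(0::'n, 1)}"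
    by (auto simp: character_graph_def)
  obtain G1 w where G1: "character_graph G1" "(n, w) \<in> G1" "w \<noteq> 1"
  proof (rule character_graph_extend[OF G0, of n])
    show "n \<notin> Domain {(0, 1)}"
      using assms by auto
  qed blast
  have "\<exists>G\<in>{G. character_graph G \<and> G1 \<subseteq> G}. \<forall>X\<in>{G. character_graph G \<and> G1 \<subseteq> G}. G \<subseteq> X \<longrightarrow> X = G"
  proof (rule subset_Zorn_nonempty)
    show "{G. character_graph G \<and> G1 \<subseteq> G} \<noteq> {}"
      using G1 by blast
    fix \<C> assume "\<C> \<noteq> {}" and chain: "subset.chain {G. character_graph G \<and> G1 \<subseteq> G} \<C>"
    then have \<C>: "\<And>G. G \<in> \<C> \<Longrightarrow> character_graph G" "\<And>G. G \<in> \<C> \<Longrightarrow> G1 \<subseteq> G"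
      and lin: "\<And>G H. G \<in> \<C> \<Longrightarrow> H \<in> \<C> \<Longrightarrow> G \<subseteq> H \<or> H \<subseteq> G"
      unfolding subset.chain_def by blast+
    have "character_graph (\<Union>\<C>)"
      unfolding character_graph_def
    proof (intro conjI allI impI)
      show "(0, 1) \<in> \<Union>\<C>"
        using \<open>\<C> \<noteq> {}\<close> \<C>(1) character_graphD(1) by blast
      fix x z y v assume "(x, z) \<in> \<Union>\<C>" "(y, v) \<in> \<Union>\<C>"
      then obtain G H where "G \<in> \<C>" "H \<in> \<C>" "(x, z) \<in> G" "(y, v) \<in> H"
        by blast
      then obtain K where "K \<in> \<C>" "(x, z) \<in> K" "(y, v) \<in> K"
        using lin by blast
      then show "(x + y, z * v) \<in> \<Union>\<C>"
        using character_graphD(2)[OF \<C>(1)] by blast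
    next
      fix x z assume "(x, z) \<in> \<Union>\<C>"
      then obtain G where "G \<in> \<C>" "(x, z) \<in> G"
        by blast
      then show "(- x, cnj z) \<in> \<Union>\<C>" "cmod z = 1"
        using character_graphD(3,4)[OF \<C>(1)] by blast+
    next
      fix z assume "(0, z) \<in> \<Union>\<C>"
      then show "z = 1"
        using character_graphD(6)[OF \<C>(1)] by blast
    qed
    then show "\<Union>\<C> \<in> {G. character_graph G \<and> G1 \<subseteq> G}"
      using \<open>\<C> \<noteq> {}\<close> \<C>(2) by blast
  qed
  then obtain G where G: "character_graph G" "G1 \<subseteq> G"
    and "\<forall>X\<in>{G. character_graph G \<and> G1 \<subseteq> G}. G \<subseteq> X \<longrightarrow> X = G"
    by auto
  then have max: "X = G" if "character_graph X" "G \<subseteq> X" for X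
    using that order_trans[OF G(2) that(2)] by auto
  have "x \<in> Domain G" for x
  proof (rule ccontr)
    assume x: "x \<notin> Domain G"
    obtain G' v where "character_graph G'" "G \<subseteq> G'" "(x, v) \<in> G'"
      using character_graph_extend[OF G(1) x] by blast
    then show False
      using max[of G'] x by auto
  qed
  then have "\<exists>z. (x, z) \<in> G" for x
    by (simp add: Domain.simps)
  then obtain \<xi> where \<xi>: "\<And>x. (x, \<xi> x) \<in> G"
    by metis
  have "\<xi> (a + b) = \<xi> a * \<xi> b" for a b
    using \<xi> by (intro character_graph_unique[OF G(1)]) (auto intro: character_graphD(2)[OF G(1)])
  then have "\<xi> \<in> dual_group"
    using character_graphD(4)[OF G(1) \<xi>] by (auto simp: dual_group_def)
  moreover have "\<xi> n = w"
    using \<xi> G G1 by (intro character_graph_unique[OF G(1)]) auto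
  ultimately show ?thesis
    using that G1(3) by blast
qed

section \<open>Haar measure and completeness of the characters\<close>

text \<open>The rule \<open>cong\<close> compares functions on \<open>dual_group\<close> only,
  because identities such as \<open>\<xi> (m + n) = \<xi> m * \<xi> n\<close> are available only
  there.\<close>

inductive trig_poly :: "(('n::ab_group_add \<Rightarrow> complex) \<Rightarrow> complex) \<Rightarrow> bool" where
  monomial: "trig_poly (\<lambda>\<xi>. c * \<xi> n)"
| add: "trig_poly p \<Longrightarrow> trig_poly q \<Longrightarrow> trig_poly (\<lambda>\<xi>. p \<xi> + q \<xi>)"
| cong: "trig_poly p \<Longrightarrow> (\<And>\<xi>. \<xi> \<in> dual_group \<Longrightarrow> q \<xi> = p \<xi>) \<Longrightarrow> trig_poly q"

lemma trig_poly_const: "trig_poly (\<lambda>\<xi>. c)"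
  by (rule trig_poly.cong[OF trig_poly.monomial[of c 0]]) (simp add: dual_group_simps)

lemma trig_poly_mult_monomial: "trig_poly p \<Longrightarrow> trig_poly (\<lambda>\<xi>. p \<xi> * (c * \<xi> n))"
proof (induction rule: trig_poly.induct)
  case (monomial d m)
  show ?case
    by (rule trig_poly.cong[OF trig_poly.monomial[of "d * c" "m + n"]]) (simp add: dual_group_simps mult_ac)
next
  case (add p q)
  show ?case
    by (rule trig_poly.cong[OF trig_poly.add[OF add.IH]]) (simp add: distrib_right)
next
  case (cong p q)
  show ?case
    by (rule trig_poly.cong[OF cong.IH]) (simp add: cong.hyps)
qed

lemma trig_poly_mult: "trig_poly q \<Longrightarrow> trig_poly p \<Longrightarrow> trig_poly (\<lambda>\<xi>. p \<xi> * q \<xi>)"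
proof (induction rule: trig_poly.induct)
  case (monomial c n)
  then show ?case by (rule trig_poly_mult_monomial)
next
  case (add q r)
  show ?case
    by (rule trig_poly.cong[OF trig_poly.add[OF add.IH(1)[OF add.prems] add.IH(2)[OF add.prems]]]) (simp add: distrib_left)
next
  case (cong q r)
  show ?case
    by (rule trig_poly.cong[OF cong.IH[OF cong.prems]]) (simp add: cong.hyps)
qed

lemma trig_poly_continuous: "trig_poly p \<Longrightarrow> continuous_on dual_group p"
proof (induction rule: trig_poly.induct)
  case (monomial c n)
  show ?case
    by (intro continuous_intros continuous_on_subset[OF continuous_on_product_coordinates]) auto
next
  case (cong p q)
  then show ?case by (metis continuous_on_cong)
qed (intro continuous_intros)

text \<open>Puts the real-valued trigonometric polynomials into the form required by the real
  Stone--Weierstrass theorem. Characters that differ at \<open>n\<close> differ there in real or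
  imaginary part, and both parts are trigonometric polynomials because \<open>\<xi> (- n)\<close> is
  the conjugate of \<open>\<xi> n\<close>.\<close>

lemma function_ring_on_trig_poly:
  "function_ring_on {p. trig_poly (\<lambda>\<xi>. complex_of_real (p \<xi>))} (dual_group :: ('n::ab_group_add \<Rightarrow> complex) set)"
proof
  show "compact (dual_group :: ('n \<Rightarrow> complex) set)"
    by (rule compact_dual_group)
next
  fix p :: "('n \<Rightarrow> complex) \<Rightarrow> real" assume "p \<in> {p. trig_poly (\<lambda>\<xi>. complex_of_real (p \<xi>))}"
  then have "continuous_on dual_group (\<lambda>\<xi>. Re (complex_of_real (p \<xi>)))"
    by (intro continuous_intros trig_poly_continuous) simp
  then show "continuous_on dual_group p" by simp
next
  fix x y :: "'n \<Rightarrow> complex" assume xy: "x \<in> dual_group" "y \<in> dual_group" "x \<noteq> y"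
  then obtain n where n: "x n \<noteq> y n" by auto
  have Re: "trig_poly (\<lambda>\<xi>. complex_of_real (Re (\<xi> n)))"
    by (rule trig_poly.cong[OF trig_poly.add[OF trig_poly.monomial[of "1/2" n] trig_poly.monomial[of "1/2" "- n"]]])
      (simp add: dual_group_simps complex_eq_iff)
  have Im: "trig_poly (\<lambda>\<xi>. complex_of_real (Im (\<xi> n)))"
    by (rule trig_poly.cong[OF trig_poly.add[OF trig_poly.monomial[of "- \<i>/2" n] trig_poly.monomial[of "\<i>/2" "- n"]]])
      (simp add: dual_group_simps complex_eq_iff)
  show "\<exists>p\<in>{p. trig_poly (\<lambda>\<xi>. complex_of_real (p \<xi>))}. p x \<noteq> p y"
    using n Re Im by (auto simp: complex_eq_iff)
qed (auto simp: trig_poly_const intro: trig_poly.add trig_poly_mult)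

section \<open>Invariance and regularity of the Haar measure\<close>

context
  fixes M :: "('n::ab_group_add \<Rightarrow> complex) measure"
  assumes haar: "dual_haar_measure M"
begin

lemma haar_sets: "sets M = sets (restrict_space borel dual_group)"
  using haar by (simp add: dual_haar_measure_def)

lemma haar_space: "space M = dual_group"
  using sets_eq_imp_space_eq[OF haar_sets] by (simp add: space_restrict_space)

lemma haar_prob: "prob_space M"
  by standard (use haar in \<open>simp add: dual_haar_measure_def haar_space\<close>)

interpretation prob_space M
  by (rule haar_prob)

lemma haar_measurable_continuous: "continuous_on dual_group g \<Longrightarrow> g \<in> borel_measurable M"
  using borel_measurable_continuous_on_restrict measurable_cong_sets[OF haar_sets refl] by blast

lemma haar_measurable_character[measurable]: "(\<lambda>\<xi>. \<xi> n) \<in> borel_measurable M"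
  by (intro haar_measurable_continuous continuous_on_subset[OF continuous_on_product_coordinates]) auto

lemma haar_translation:
  assumes \<xi>: "\<xi> \<in> dual_group" and g: "g \<in> borel_measurable M"
  shows "(\<integral>\<psi>. g (\<lambda>n. \<xi> n * \<psi> n) \<partial>M) = (\<integral>\<psi>. g \<psi> \<partial>M :: complex)"
proof -
  define \<tau> where "\<tau> = (\<lambda>(\<psi> :: 'n \<Rightarrow> complex) n. \<xi> n * \<psi> n)"
  have "\<tau> \<in> borel \<rightarrow>\<^sub>M borel"
    unfolding \<tau>_def
    by (intro borel_measurable_continuous_onI continuous_intros continuous_on_product_coordinates)
  moreover have "\<tau> \<in> dual_group \<rightarrow> dual_group"
    using \<xi> by (auto simp: \<tau>_def dual_group_def norm_mult)
  ultimately have "\<tau> \<in> restrict_space borel dual_group \<rightarrow>\<^sub>M restrict_space borel dual_group"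
    by (rule measurable_restrict_space3)
  then have \<tau>[measurable]: "\<tau> \<in> M \<rightarrow>\<^sub>M M"
    using measurable_cong_sets[OF haar_sets haar_sets] by simp
  have "distr M M \<tau> = M"
  proof (rule measure_eqI)
    fix A assume "A \<in> sets (distr M M \<tau>)"
    then have A: "A \<in> sets M" by simp
    then have "A \<subseteq> dual_group"
      using sets.sets_into_space haar_space by blast
    \<comment> \<open>Invariance is given for images under translations, while \<open>distr\<close>
      is computed with preimages; the inverse translation is the one by the conjugate character
      \<open>\<eta>\<close>.\<close>
    define \<eta> where "\<eta> n = cnj (\<xi> n)" for n
    have \<eta>: "\<eta> \<in> dual_group"
      using \<xi> by (auto simp: \<eta>_def dual_group_def)
    have inv: "\<eta> n * (\<xi> n * z) = z" "\<xi> n * (\<eta> n * z) = z" for n z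
      using dual_group_simps(6,7)[OF \<xi>, of n] by (simp_all add: \<eta>_def flip: mult.assoc)
    have "\<tau> -` A \<inter> space M = (\<lambda>\<psi> n. \<eta> n * \<psi> n) ` A"
    proof safe
      fix \<psi> assume "\<tau> \<psi> \<in> A"
      moreover have "\<psi> = (\<lambda>n. \<eta> n * \<tau> \<psi> n)"
        by (simp add: \<tau>_def inv)
      ultimately show "\<psi> \<in> (\<lambda>\<psi> n. \<eta> n * \<psi> n) ` A" by blast
    next
      fix \<psi> assume "\<psi> \<in> A"
      then show "(\<lambda>n. \<eta> n * \<psi> n) \<in> \<tau> -` A"
        by (simp add: \<tau>_def inv)
      show "(\<lambda>n. \<eta> n * \<psi> n) \<in> space M"
        using \<open>\<psi> \<in> A\<close> \<open>A \<subseteq> dual_group\<close> \<eta> by (auto simp: haar_space dual_group_def norm_mult)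
    qed
    moreover have "emeasure M ((\<lambda>\<psi> n. \<eta> n * \<psi> n) ` A) = emeasure M A"
      using haar \<eta> A unfolding dual_haar_measure_def by blast
    ultimately show "emeasure (distr M M \<tau>) A = emeasure M A"
      using A by (simp add: emeasure_distr)
  qed simp
  then have "(\<integral>\<psi>. g \<psi> \<partial>M) = (\<integral>\<psi>. g \<psi> \<partial>(distr M M \<tau>))"
    by simp
  also have "\<dots> = (\<integral>\<psi>. g (\<tau> \<psi>) \<partial>M)"
    using g by (intro integral_distr \<tau>)
  finally show ?thesis
    by (simp add: \<tau>_def)
qed

text \<open>Translation by \<open>\<eta>\<close> multiplies the integral by \<open>\<eta> n\<close>;
  for \<open>n \<noteq> 0\<close> this factor can be chosen different from 1, so the integral
  vanishes.\<close>

lemma haar_integral_character: "(\<integral>\<xi>. \<xi> n \<partial>M) = (if n = 0 then 1 else 0)"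
proof (cases "n = 0")
  case True
  have "(\<integral>\<xi>. \<xi> n \<partial>M) = (\<integral>\<xi>. 1 \<partial>M)"
    by (rule Bochner_Integration.integral_cong) (auto simp: haar_space dual_group_simps True)
  then show ?thesis
    by (simp add: prob_space True)
next
  case False
  then obtain \<eta> where \<eta>: "\<eta> \<in> dual_group" "\<eta> n \<noteq> 1"
    using characters_separate by blast
  have "(\<integral>\<xi>. \<xi> n \<partial>M) = \<eta> n * (\<integral>\<xi>. \<xi> n \<partial>M)"
    using haar_translation[OF \<eta>(1) haar_measurable_character, of n] by simp
  then show ?thesis
    using False \<eta>(2) by simp
qed

lemma haar_characters_orthonormal: "(\<integral>\<xi>. \<xi> (- m) * cnj (\<xi> (- n)) \<partial>M) = (if m = n then 1 else 0)"
proof -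
  have "(\<integral>\<xi>. \<xi> (- m) * cnj (\<xi> (- n)) \<partial>M) = (\<integral>\<xi>. \<xi> (n - m) \<partial>M)"
    by (rule Bochner_Integration.integral_cong) (auto simp: haar_space dual_group_simps mult.commute)
  then show ?thesis
    by (auto simp: haar_integral_character)
qed

lemma haar_character_L2: "(\<lambda>\<xi>. \<xi> n) \<in> L2 M"
proof (rule L2_dominated)
  show "integrable M (\<lambda>_. 1::real)" by simp
qed (auto simp: haar_space dual_group_simps intro!: AE_I2)

lemma haar_bounded_mult_integrable:
  fixes \<phi> g :: "_ \<Rightarrow> complex"
  assumes "integrable M \<phi>" "g \<in> borel_measurable M" "\<And>\<xi>. \<xi> \<in> dual_group \<Longrightarrow> cmod (g \<xi>) \<le> B"
  shows "integrable M (\<lambda>\<xi>. \<phi> \<xi> * g \<xi>)"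
proof (rule Bochner_Integration.integrable_bound)
  show "integrable M (\<lambda>\<xi>. B * norm (\<phi> \<xi>))"
    using assms(1) by simp
  show "AE \<xi> in M. norm (\<phi> \<xi> * g \<xi>) \<le> norm (B * norm (\<phi> \<xi>))"
  proof (rule AE_I2)
    fix \<xi> assume "\<xi> \<in> space M"
    then have "cmod (g \<xi>) \<le> B" by (simp add: haar_space assms)
    then have "norm (\<phi> \<xi>) * norm (g \<xi>) \<le> norm (\<phi> \<xi>) * \<bar>B\<bar>"
      by (intro mult_left_mono) auto
    then show "norm (\<phi> \<xi> * g \<xi>) \<le> norm (B * norm (\<phi> \<xi>))"
      by (simp add: norm_mult abs_mult mult.commute)
  qed
qed (use assms in measurable)

lemma haar_trig_poly_orthogonal:
  assumes \<phi>: "integrable M \<phi>" and zero: "\<And>n. (\<integral>\<xi>. \<phi> \<xi> * \<xi> n \<partial>M) = 0" and "trig_poly p"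
  shows "integrable M (\<lambda>\<xi>. \<phi> \<xi> * p \<xi>) \<and> (\<integral>\<xi>. \<phi> \<xi> * p \<xi> \<partial>M) = 0"
  using assms(3)
proof (induction rule: trig_poly.induct)
  case (monomial c n)
  have "integrable M (\<lambda>\<xi>. c * (\<phi> \<xi> * \<xi> n))"
    by (intro integrable_mult_right haar_bounded_mult_integrable[where B = 1] \<phi>) (auto simp: dual_group_simps)
  moreover have "(\<integral>\<xi>. c * (\<phi> \<xi> * \<xi> n) \<partial>M) = 0"
    by (simp add: zero)
  ultimately show ?case
    by (simp add: mult.left_commute)
next
  case (add p q)
  then show ?case by (simp add: distrib_left)
next
  case (cong p q)
  have "integrable M (\<lambda>\<xi>. \<phi> \<xi> * q \<xi>) = integrable M (\<lambda>\<xi>. \<phi> \<xi> * p \<xi>)"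
    by (rule Bochner_Integration.integrable_cong) (auto simp: haar_space cong.hyps)
  moreover have "(\<integral>\<xi>. \<phi> \<xi> * q \<xi> \<partial>M) = (\<integral>\<xi>. \<phi> \<xi> * p \<xi> \<partial>M)"
    by (rule Bochner_Integration.integral_cong) (auto simp: haar_space cong.hyps)
  ultimately show ?case
    using cong.IH by simp
qed

text \<open>Uniform approximation fits an integrable \<open>\<phi>\<close>: replacing
  \<open>g\<close> by a trigonometric polynomial within \<open>e\<close> changes the integral by at
  most \<open>e\<close> times the integral of \<open>norm (\<phi> \<xi>)\<close>.\<close>

lemma haar_continuous_orthogonal:
  assumes \<phi>: "integrable M \<phi>" and zero: "\<And>n. (\<integral>\<xi>. \<phi> \<xi> * \<xi> n \<partial>M) = 0"
    and g: "continuous_on dual_group (g :: _ \<Rightarrow> real)"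
  shows "(\<integral>\<xi>. \<phi> \<xi> * complex_of_real (g \<xi>) \<partial>M) = 0"
proof -
  let ?N = "\<integral>\<xi>. norm (\<phi> \<xi>) \<partial>M"
  have gM: "(\<lambda>\<xi>. complex_of_real (g \<xi>)) \<in> borel_measurable M"
    by (intro haar_measurable_continuous continuous_intros g)
  have "bounded (g ` dual_group)"
    by (intro compact_imp_bounded compact_continuous_image g compact_dual_group)
  then obtain B where "\<And>\<xi>. \<xi> \<in> dual_group \<Longrightarrow> norm (g \<xi>) \<le> B"
    by (auto simp: bounded_iff)
  then have int_g: "integrable M (\<lambda>\<xi>. \<phi> \<xi> * complex_of_real (g \<xi>))"
    by (intro haar_bounded_mult_integrable[where B = B] \<phi> gM) auto
  have "norm (\<integral>\<xi>. \<phi> \<xi> * complex_of_real (g \<xi>) \<partial>M) \<le> e * ?N" if "0 < e" for e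
  proof -
    obtain p where p: "trig_poly (\<lambda>\<xi>. complex_of_real (p \<xi>))" "\<And>\<xi>. \<xi> \<in> dual_group \<Longrightarrow> \<bar>g \<xi> - p \<xi>\<bar> < e"
      using function_ring_on.Stone_Weierstrass_basic[OF function_ring_on_trig_poly g \<open>0 < e\<close>] by blast
    note int_p = haar_trig_poly_orthogonal[OF \<phi> zero p(1)]
    have "(\<integral>\<xi>. \<phi> \<xi> * complex_of_real (g \<xi>) \<partial>M) = (\<integral>\<xi>. \<phi> \<xi> * complex_of_real (g \<xi>) - \<phi> \<xi> * complex_of_real (p \<xi>) \<partial>M)"
      using int_p int_g by simp
    also have "norm \<dots> \<le> (\<integral>\<xi>. norm (\<phi> \<xi> * complex_of_real (g \<xi>) - \<phi> \<xi> * complex_of_real (p \<xi>)) \<partial>M)"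
      by (rule integral_norm_bound)
    also have "\<dots> \<le> (\<integral>\<xi>. e * norm (\<phi> \<xi>) \<partial>M)"
    proof (rule integral_mono)
      fix \<xi> assume "\<xi> \<in> space M"
      then have "\<bar>g \<xi> - p \<xi>\<bar> \<le> e"
        using p(2)[of \<xi>] by (simp add: haar_space)
      then have "norm (\<phi> \<xi>) * \<bar>g \<xi> - p \<xi>\<bar> \<le> norm (\<phi> \<xi>) * e"
        by (intro mult_left_mono) auto
      then show "norm (\<phi> \<xi> * complex_of_real (g \<xi>) - \<phi> \<xi> * complex_of_real (p \<xi>)) \<le> e * norm (\<phi> \<xi>)"
        by (simp add: norm_mult mult.commute flip: right_diff_distrib of_real_diff)
    qed (use int_p int_g \<phi> in auto)
    finally show ?thesis by simp
  qed
  then have "norm (\<integral>\<xi>. \<phi> \<xi> * complex_of_real (g \<xi>) \<partial>M) \<le> 0 * ?N"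
    by (intro tendsto_lowerbound[where F = "at_right 0" and f = "\<lambda>e. e * ?N"] tendsto_intros)
      (auto simp: eventually_at_right_less eventually_at_filter)
  then show ?thesis by simp
qed

lemma haar_regular_open:
  assumes A: "A \<in> sets M" and "0 < e"
  obtains U where "openin (top_of_set dual_group) U" "A \<subseteq> U" "U \<in> sets M" "measure M U \<le> measure M A + e"
proof -
  have "emeasure M A < emeasure M A + ennreal e"
    using \<open>0 < e\<close> by (simp add: emeasure_eq_measure ennreal_less_iff flip: ennreal_plus)
  moreover have "emeasure M A = (INF U\<in>{U. openin (top_of_set dual_group) U \<and> A \<subseteq> U}. emeasure M U)"
    using haar A unfolding dual_haar_measure_def by blast
  ultimately obtain U where U: "openin (top_of_set dual_group) U" "A \<subseteq> U" "emeasure M U < emeasure M A + ennreal e"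
    by (auto simp: INF_less_iff)
  have "U \<in> sets M"
    using U(1) unfolding haar_sets by (auto simp: openin_open sets_restrict_space)
  moreover have "measure M U \<le> measure M A + e"
    using U(3) \<open>0 < e\<close> by (simp add: emeasure_eq_measure ennreal_less_iff flip: ennreal_plus)
  ultimately show ?thesis
    using that U by blast
qed

text \<open>Outer regularity of both \<open>A\<close> and its complement gives open sets
  \<open>U k\<close> and \<open>V k\<close> that cover the group and overlap in small measure. A
  Urysohn function that is 0 off \<open>U k\<close> and 1 off \<open>V k\<close> agrees with the
  indicator of \<open>A\<close> off the overlap. The measures of the overlaps are summable, so by
  Borel--Cantelli these functions converge a.e. to the indicator, and dominated convergence
  applies.\<close>

lemma haar_set_orthogonal:
  assumes \<phi>: "integrable M \<phi>" and zero: "\<And>n. (\<integral>\<xi>. \<phi> \<xi> * \<xi> n \<partial>M) = 0"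
    and A: "A \<in> sets M"
  shows "(\<integral>\<xi>. \<phi> \<xi> * complex_of_real (indicator A \<xi>) \<partial>M) = 0"
proof -
  have A_space: "A \<subseteq> dual_group"
    using sets.sets_into_space[OF A] haar_space by simp
  have "\<exists>U. openin (top_of_set dual_group) U \<and> B \<subseteq> U \<and> U \<in> sets M \<and> measure M U \<le> measure M B + (1/2) ^ k"
    if "B \<in> sets M" for B k
    by (rule haar_regular_open[OF that, of "(1/2)^k"]) auto
  then obtain W where W: "\<And>B k. B \<in> sets M \<Longrightarrow> openin (top_of_set dual_group) (W B k)" "\<And>B k. B \<in> sets M \<Longrightarrow> B \<subseteq> W B k"
      "\<And>B k. B \<in> sets M \<Longrightarrow> W B k \<in> sets M" "\<And>B k. B \<in> sets M \<Longrightarrow> measure M (W B k) \<le> measure M B + (1/2) ^ k"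
    by metis
  define U where "U = W A"
  define V where "V = W (dual_group - A)"
  have A': "dual_group - A \<in> sets M"
    using A sets.compl_sets haar_space by metis
  have U: "openin (top_of_set dual_group) (U k)" "A \<subseteq> U k" "U k \<in> sets M" "measure M (U k) \<le> measure M A + (1/2) ^ k" for k
    using W[OF A] by (auto simp: U_def)
  have V: "openin (top_of_set dual_group) (V k)" "dual_group - A \<subseteq> V k" "V k \<in> sets M"
      "measure M (V k) \<le> measure M (dual_group - A) + (1/2) ^ k" for k
    using W[OF A'] by (auto simp: V_def)
  have UV: "U k \<subseteq> dual_group" "V k \<subseteq> dual_group" for k
    using openin_imp_subset[OF U(1)[of k]] openin_imp_subset[OF V(1)[of k]] by auto
  have small: "measure M (U k \<inter> V k) \<le> 2 * (1/2) ^ k" for k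
  proof -
    have "U k \<union> V k = space M"
      using U(2)[of k] V(2)[of k] UV[of k] by (auto simp: haar_space)
    \<comment> \<open>Inclusion--exclusion in a probability space: the two excesses
      \<open>(1/2) ^ k\<close> add up to a bound for the overlap.\<close>
    then have "measure M (U k) + measure M (V k) = 1 + measure M (U k \<inter> V k)"
      using measure_Un3[of "U k" M "V k"] U(3) V(3) by (simp add: fmeasurable_eq_sets prob_space)
    moreover have "measure M (dual_group - A) = 1 - measure M A"
      using prob_compl[OF A] by (simp add: haar_space)
    ultimately show ?thesis
      using U(4)[of k] V(4)[of k] by simp
  qed
  have "normal_space (top_of_set (dual_group :: ('n \<Rightarrow> complex) set))"
  proof (rule compact_Hausdorff_or_regular_imp_normal_space)
    show "compact_space (top_of_set (dual_group :: ('n \<Rightarrow> complex) set))"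
      by (simp add: compact_space_subtopology compact_dual_group)
    have "Hausdorff_space (euclidean :: ('n \<Rightarrow> complex) topology)"
      unfolding euclidean_product_topology[symmetric] by (simp add: Hausdorff_space_product_topology)
    then show "Hausdorff_space (top_of_set (dual_group :: ('n \<Rightarrow> complex) set)) \<or> regular_space (top_of_set (dual_group :: ('n \<Rightarrow> complex) set))"
      by (simp add: Hausdorff_space_subtopology)
  qed
  then have "\<exists>g. continuous_map (top_of_set dual_group) (top_of_set {0..1::real}) g \<and>
      g ` (dual_group - U k) \<subseteq> {0} \<and> g ` (dual_group - V k) \<subseteq> {1}" for k
  proof (rule Urysohn_lemma[of _ "dual_group - U k" "dual_group - V k" 0 1])
    show "closedin (top_of_set dual_group) (dual_group - U k)" "closedin (top_of_set dual_group) (dual_group - V k)"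
      using U(1) V(1) by (auto intro: closedin_diff)
    show "disjnt (dual_group - U k) (dual_group - V k)"
      using U(2)[of k] V(2)[of k] by (auto simp: disjnt_def)
  qed auto
  then obtain g where g: "\<And>k. continuous_map (top_of_set dual_group) (top_of_set {0..1::real}) (g k)"
      "\<And>k. g k ` (dual_group - U k) \<subseteq> {0}" "\<And>k. g k ` (dual_group - V k) \<subseteq> {1}"
    by metis
  have g_cont: "continuous_on dual_group (g k)" and g01: "\<xi> \<in> dual_group \<Longrightarrow> g k \<xi> \<in> {0..1}" for k \<xi>
    using g(1)[of k] by (auto simp: continuous_map_in_subtopology)
  have gM: "g k \<in> borel_measurable M" for k
    by (intro haar_measurable_continuous g_cont)
  have "AE \<xi> in M. eventually (\<lambda>k. \<xi> \<in> space M - U k \<inter> V k) sequentially"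
  proof (rule borel_cantelli_AE1)
    show "summable (\<lambda>k. measure M (U k \<inter> V k))"
      by (rule summable_comparison_test'[where g = "\<lambda>k. 2 * (1/2) ^ k"])
        (auto intro!: summable_mult summable_geometric simp: small)
  qed (use U V in \<open>auto simp: emeasure_eq_measure\<close>)
  then have lim: "AE \<xi> in M. (\<lambda>k. \<phi> \<xi> * complex_of_real (g k \<xi>)) \<longlonglongrightarrow> \<phi> \<xi> * complex_of_real (indicator A \<xi>)"
    using AE_space
  proof eventually_elim
    case (elim \<xi>)
    have "eventually (\<lambda>k. \<phi> \<xi> * complex_of_real (g k \<xi>) = \<phi> \<xi> * complex_of_real (indicator A \<xi>)) sequentially"
      using elim(1)
    proof eventually_elim
      case (elim k)
      then show ?case
        using g(2,3)[of k] U(2)[of k] V(2)[of k] by (cases "\<xi> \<in> A") (auto simp: haar_space image_subset_iff)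
    qed
    then show ?case
      by (rule tendsto_eventually)
  qed
  have "(\<lambda>k. \<integral>\<xi>. \<phi> \<xi> * complex_of_real (g k \<xi>) \<partial>M) \<longlonglongrightarrow> (\<integral>\<xi>. \<phi> \<xi> * complex_of_real (indicator A \<xi>) \<partial>M)"
  proof (rule integral_dominated_convergence[OF _ _ integrable_norm[OF \<phi>] lim])
    show "AE \<xi> in M. norm (\<phi> \<xi> * complex_of_real (g k \<xi>)) \<le> norm (\<phi> \<xi>)" for k
    proof (rule AE_I2)
      fix \<xi> assume "\<xi> \<in> space M"
      then show "norm (\<phi> \<xi> * complex_of_real (g k \<xi>)) \<le> norm (\<phi> \<xi>)"
        using g01[of \<xi> k] by (auto simp: haar_space norm_mult intro: mult_left_le)
    qed
  qed (use \<phi> A gM in measurable)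
  moreover have "(\<integral>\<xi>. \<phi> \<xi> * complex_of_real (g k \<xi>) \<partial>M) = 0" for k
    by (rule haar_continuous_orthogonal[OF \<phi> zero g_cont])
  ultimately show ?thesis
    by (simp add: LIMSEQ_const_iff)
qed

text \<open>The sets where \<open>u\<close> is positive or negative are themselves test sets, and on
  each of them the integrand has constant sign.\<close>

lemma haar_real_zero:
  assumes u: "integrable M (u :: _ \<Rightarrow> real)" and zero: "\<And>A. A \<in> sets M \<Longrightarrow> (\<integral>\<xi>. u \<xi> * indicator A \<xi> \<partial>M) = 0"
  shows "AE \<xi> in M. u \<xi> = 0"
proof -
  have [measurable]: "u \<in> borel_measurable M"
    using u by simp
  have int: "integrable M (\<lambda>\<xi>. u \<xi> * indicator A \<xi>)" if "A \<in> sets M" for A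
    using integrable_mult_indicator[OF that u] by (simp add: mult.commute)
  have "AE \<xi> in M. u \<xi> * indicator {\<xi>\<in>space M. 0 < u \<xi>} \<xi> = 0"
  proof (subst integral_nonneg_eq_0_iff_AE[symmetric])
    show "(\<integral>\<xi>. u \<xi> * indicator {\<xi>\<in>space M. 0 < u \<xi>} \<xi> \<partial>M) = 0"
      by (rule zero) measurable
  qed (auto intro!: int split: split_indicator)
  moreover have "AE \<xi> in M. - u \<xi> * indicator {\<xi>\<in>space M. u \<xi> < 0} \<xi> = 0"
  proof (subst integral_nonneg_eq_0_iff_AE[symmetric])
    have "(\<integral>\<xi>. u \<xi> * indicator {\<xi>\<in>space M. u \<xi> < 0} \<xi> \<partial>M) = 0"
      by (rule zero) measurable
    then show "(\<integral>\<xi>. - u \<xi> * indicator {\<xi>\<in>space M. u \<xi> < 0} \<xi> \<partial>M) = 0"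
      by simp
  qed (auto intro!: int split: split_indicator)
  ultimately show ?thesis
    using AE_space by eventually_elim (auto simp: indicator_def split: if_splits)
qed

text \<open>Stated for integrable rather than square-integrable \<open>\<phi>\<close>: it is also
  applied to entries of a product of two transfer matrices, which are sums of products of
  square-integrable functions.\<close>

theorem haar_characters_complete:
  assumes \<phi>: "integrable M \<phi>" and zero: "\<And>n. (\<integral>\<xi>. \<phi> \<xi> * \<xi> n \<partial>M) = (0::complex)"
  shows "AE \<xi> in M. \<phi> \<xi> = 0"
proof -
  have int: "integrable M (\<lambda>\<xi>. \<phi> \<xi> * complex_of_real (indicator A \<xi>))" if "A \<in> sets M" for A
    using that by (intro haar_bounded_mult_integrable[where B = 1] \<phi>) (auto simp: indicator_def)
  have "AE \<xi> in M. Re (\<phi> \<xi>) = 0"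
  proof (rule haar_real_zero)
    fix A assume "A \<in> sets M"
    then have "(\<integral>\<xi>. Re (\<phi> \<xi> * complex_of_real (indicator A \<xi>)) \<partial>M) = 0"
      using haar_set_orthogonal[OF \<phi> zero] int by (subst integral_Re) auto
    then show "(\<integral>\<xi>. Re (\<phi> \<xi>) * indicator A \<xi> \<partial>M) = 0"
      by simp
  qed (simp add: \<phi>)
  moreover have "AE \<xi> in M. Im (\<phi> \<xi>) = 0"
  proof (rule haar_real_zero)
    fix A assume "A \<in> sets M"
    then have "(\<integral>\<xi>. Im (\<phi> \<xi> * complex_of_real (indicator A \<xi>)) \<partial>M) = 0"
      using haar_set_orthogonal[OF \<phi> zero] int by (subst integral_Im) auto
    then show "(\<integral>\<xi>. Im (\<phi> \<xi>) * indicator A \<xi> \<partial>M) = 0"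
      by simp
  qed (simp add: \<phi>)
  ultimately show ?thesis
    by eventually_elim (simp add: complex_eq_iff)
qed

end

section \<open>The Fourier transform on \<open>ell2\<close>\<close>

text \<open>Recovers inner products from norms, so that Parseval's identity passes from norms to
  inner products. The factors 1 and -1 are written out to give all four terms the form
  \<open>\<phi> x + c * \<psi> x\<close>, which \<open>fourier_inner\<close> rewrites.\<close>

lemma L2_polarization:
  fixes \<phi> \<psi> :: "'x \<Rightarrow> complex"
  assumes "\<phi> \<in> L2 M" "\<psi> \<in> L2 M"
  shows "4 * (\<integral>x. \<phi> x * cnj (\<psi> x) \<partial>M) =
    complex_of_real (\<integral>x. (cmod (\<phi> x + 1 * \<psi> x))\<^sup>2 \<partial>M) - complex_of_real (\<integral>x. (cmod (\<phi> x + (-1) * \<psi> x))\<^sup>2 \<partial>M)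
    + (\<i> * complex_of_real (\<integral>x. (cmod (\<phi> x + \<i> * \<psi> x))\<^sup>2 \<partial>M) - \<i> * complex_of_real (\<integral>x. (cmod (\<phi> x + (- \<i>) * \<psi> x))\<^sup>2 \<partial>M))"
    (is "_ = ?r")
proof -
  define q where "q c x = complex_of_real ((cmod (\<phi> x + c * \<psi> x))\<^sup>2)" for c x
  have "integrable M (\<lambda>x. (cmod (\<phi> x + c * \<psi> x))\<^sup>2)" for c
    using assms by (intro L2_integrable L2_add L2_cmult)
  then have i: "integrable M (q c)" for c
    unfolding q_def by (subst complex_of_real_integrable_eq)
  have pol: "4 * (\<phi> x * cnj (\<psi> x)) = q 1 x - q (-1) x + (\<i> * q \<i> x - \<i> * q (- \<i>) x)" for x
    unfolding q_def complex_norm_square by (simp add: algebra_simps)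
  have "4 * (\<integral>x. \<phi> x * cnj (\<psi> x) \<partial>M) = (\<integral>x. 4 * (\<phi> x * cnj (\<psi> x)) \<partial>M)"
    by simp
  also have "\<dots> = (\<integral>x. q 1 x \<partial>M) - (\<integral>x. q (-1) x \<partial>M) + (\<i> * (\<integral>x. q \<i> x \<partial>M) - \<i> * (\<integral>x. q (- \<i>) x \<partial>M))"
    unfolding pol using i by simp
  also have "\<dots> = ?r"
    unfolding q_def integral_complex_of_real ..
  finally show ?thesis .
qed

lemma ell1_subset_ell2: "b \<in> ell1 \<Longrightarrow> b \<in> ell2"
proof -
  assume b: "b \<in> ell1"
  then have sm: "(\<lambda>x. cmod (b x)) summable_on UNIV"
    by (simp add: ell1_def)
  let ?S = "\<Sum>\<^sub>\<infinity>x. cmod (b x)"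
  have le: "cmod (b x) \<le> ?S" for x
    using finite_sum_le_infsum[OF sm, of "{x}"] by simp
  have "(\<lambda>x. (cmod (b x))\<^sup>2) summable_on UNIV"
  proof (rule summable_on_comparison_test)
    show "(\<lambda>x. ?S * cmod (b x)) summable_on UNIV"
      by (intro summable_on_cmult_right sm)
    show "(cmod (b x))\<^sup>2 \<le> ?S * cmod (b x)" for x
      using le[of x] by (simp add: power2_eq_square mult_right_mono)
  qed simp
  then show "b \<in> ell2"
    by (simp add: ell2_def)
qed

context
  fixes M :: "('n::ab_group_add \<Rightarrow> complex) measure"
  assumes haar: "dual_haar_measure M"
begin

interpretation prob_space M
  by (rule haar_prob[OF haar])

lemma haar_L2_integrable: "\<phi> \<in> L2 M \<Longrightarrow> integrable M (\<phi> :: _ \<Rightarrow> complex)"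
proof -
  assume "\<phi> \<in> L2 M"
  moreover have "(\<lambda>_. 1) \<in> L2 M"
    by (simp add: L2_def)
  ultimately show ?thesis
    using L2_mult_integrable[of \<phi> M "\<lambda>_. 1"] by simp
qed

lemma haar_AE_dual_group: "AE \<xi> in M. \<xi> \<in> dual_group"
  using haar_space[OF haar] AE_space[of M] by simp

lemma haar_character_mult_L2: "\<phi> \<in> L2 M \<Longrightarrow> (\<lambda>\<xi>. \<xi> n * \<phi> \<xi>) \<in> L2 M"
  using haar_AE_dual_group
  by (intro L2_bounded_mult[where K = 1] haar_measurable_character[OF haar])
    (auto simp: dual_group_simps elim: eventually_mono)

text \<open>The inverse transform. On the dual group the kernel \<open>\<xi> n\<close> is the
  conjugate of the kernel \<open>\<xi> (- n)\<close> of \<open>fourier_ell1\<close>, so these are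
  the coefficients with respect to the orthonormal family of the functions
  \<open>\<xi> (- n)\<close>.\<close>

definition fourier_coeff :: "(('n \<Rightarrow> complex) \<Rightarrow> complex) \<Rightarrow> 'n \<Rightarrow> complex" where
  "fourier_coeff \<phi> n = (\<integral>\<xi>. \<phi> \<xi> * \<xi> n \<partial>M)"

lemma fourier_coeff_inner: "fourier_coeff \<phi> n = (\<integral>\<xi>. \<phi> \<xi> * cnj (\<xi> (- n)) \<partial>M)"
  unfolding fourier_coeff_def
  by (rule Bochner_Integration.integral_cong) (auto simp: haar_space[OF haar] dual_group_simps)

lemma fourier_coeff_integrable: "\<phi> \<in> L2 M \<Longrightarrow> integrable M (\<lambda>\<xi>. \<phi> \<xi> * \<xi> n)"
  by (intro L2_mult_integrable haar_character_L2[OF haar])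

lemma fourier_coeff_add:
  "\<phi> \<in> L2 M \<Longrightarrow> \<psi> \<in> L2 M \<Longrightarrow> fourier_coeff (\<lambda>\<xi>. \<phi> \<xi> + \<psi> \<xi>) n = fourier_coeff \<phi> n + fourier_coeff \<psi> n"
  and fourier_coeff_diff:
  "\<phi> \<in> L2 M \<Longrightarrow> \<psi> \<in> L2 M \<Longrightarrow> fourier_coeff (\<lambda>\<xi>. \<phi> \<xi> - \<psi> \<xi>) n = fourier_coeff \<phi> n - fourier_coeff \<psi> n"
  and fourier_coeff_cmult: "fourier_coeff (\<lambda>\<xi>. c * \<phi> \<xi>) n = c * fourier_coeff \<phi> n"
  unfolding fourier_coeff_def
  by (simp_all add: distrib_right left_diff_distrib fourier_coeff_integrable mult.assoc)

lemma fourier_coeff_cong_AE: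
  assumes "AE \<xi> in M. \<phi> \<xi> = \<psi> \<xi>" "\<phi> \<in> borel_measurable M" "\<psi> \<in> borel_measurable M"
  shows "fourier_coeff \<phi> n = fourier_coeff \<psi> n"
  unfolding fourier_coeff_def
  by (rule integral_cong_AE) (use assms in \<open>auto elim: eventually_mono intro!: borel_measurable_times haar_measurable_character[OF haar]\<close>)

lemma fourier_coeff_ell2: "\<phi> \<in> L2 M \<Longrightarrow> fourier_coeff \<phi> \<in> ell2"
  using orthonormal_bessel[of "\<lambda>n \<xi>. \<xi> (- n)" M, OF haar_character_L2[OF haar] haar_characters_orthonormal[OF haar], of \<phi>]
  by (simp add: fourier_coeff_inner[abs_def])

lemma fourier_coeff_inject:
  assumes "\<phi> \<in> L2 M" "\<psi> \<in> L2 M" "fourier_coeff \<phi> = fourier_coeff \<psi>"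
  shows "AE \<xi> in M. \<phi> \<xi> = \<psi> \<xi>"
proof -
  have "AE \<xi> in M. \<phi> \<xi> - \<psi> \<xi> = 0"
  proof (rule haar_characters_complete[OF haar])
    show "integrable M (\<lambda>\<xi>. \<phi> \<xi> - \<psi> \<xi>)"
      using assms by (intro haar_L2_integrable L2_diff)
    show "(\<integral>\<xi>. (\<phi> \<xi> - \<psi> \<xi>) * \<xi> n \<partial>M) = 0" for n
      using assms fourier_coeff_diff[of \<phi> \<psi> n] by (simp add: fourier_coeff_def)
  qed
  then show ?thesis by simp
qed

lemma fourier_coeff_expansion:
  assumes a: "a \<in> ell2"
  obtains \<phi> where "\<phi> \<in> L2 M" "fourier_coeff \<phi> = a" "(\<integral>\<xi>. (cmod (\<phi> \<xi>))\<^sup>2 \<partial>M) = (ell2_norm a)\<^sup>2"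
    "((\<lambda>F. \<integral>\<xi>. (cmod ((\<Sum>n\<in>F. a n * \<xi> (- n)) - \<phi> \<xi>))\<^sup>2 \<partial>M) \<longlongrightarrow> 0) (finite_subsets_at_top UNIV)"
  by (rule orthonormal_expansion[of "\<lambda>n \<xi>. \<xi> (- n)" M, OF haar_character_L2[OF haar] haar_characters_orthonormal[OF haar] a])
    (auto simp: fourier_coeff_inner[abs_def] fun_eq_iff)

text \<open>Riesz--Fischer provides a function with the same coefficients and the right norm;
  completeness of the characters identifies it with \<open>\<phi>\<close> a.e.\<close>

lemma fourier_coeff_parseval:
  assumes \<phi>: "\<phi> \<in> L2 M"
  shows "(\<integral>\<xi>. (cmod (\<phi> \<xi>))\<^sup>2 \<partial>M) = (ell2_norm (fourier_coeff \<phi>))\<^sup>2"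
proof -
  obtain \<psi> where \<psi>: "\<psi> \<in> L2 M" "fourier_coeff \<psi> = fourier_coeff \<phi>"
      "(\<integral>\<xi>. (cmod (\<psi> \<xi>))\<^sup>2 \<partial>M) = (ell2_norm (fourier_coeff \<phi>))\<^sup>2"
    by (rule fourier_coeff_expansion[OF fourier_coeff_ell2[OF \<phi>]])
  have "AE \<xi> in M. \<phi> \<xi> = \<psi> \<xi>"
    using fourier_coeff_inject[OF \<phi> \<psi>(1)] \<psi>(2) by simp
  then have "(\<integral>\<xi>. (cmod (\<phi> \<xi>))\<^sup>2 \<partial>M) = (\<integral>\<xi>. (cmod (\<psi> \<xi>))\<^sup>2 \<partial>M)"
    using \<phi> \<psi>(1) by (intro integral_cong_AE) (auto elim: eventually_mono intro!: borel_measurable_integrable L2_integrable)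
  then show ?thesis
    using \<psi>(3) by simp
qed

lemma fourier_ell1_partial_sum_bound:
  assumes b: "b \<in> ell1" and \<xi>: "\<xi> \<in> dual_group" and "finite F"
  shows "cmod ((\<Sum>n\<in>F. b n * \<xi> (- n)) - fourier_ell1 b \<xi>) \<le> (\<Sum>\<^sub>\<infinity>n. cmod (b n)) - (\<Sum>n\<in>F. cmod (b n))"
proof -
  have sm: "(\<lambda>n. cmod (b n)) summable_on UNIV"
    using b by (simp add: ell1_def)
  have norm_eq: "cmod (b n * \<xi> (- n)) = cmod (b n)" for n
    using \<xi> by (simp add: norm_mult dual_group_simps)
  then have abs: "(\<lambda>n. cmod (b n * \<xi> (- n))) summable_on UNIV"
    using sm by simp
  have "infsum (\<lambda>n. b n * \<xi> (- n)) (UNIV - F) = fourier_ell1 b \<xi> - (\<Sum>n\<in>F. b n * \<xi> (- n))"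
    using infsum_Diff[OF abs_summable_summable[OF abs] _ subset_UNIV, of F] \<open>finite F\<close>
    by (simp add: fourier_ell1_def)
  then have "cmod ((\<Sum>n\<in>F. b n * \<xi> (- n)) - fourier_ell1 b \<xi>) = cmod (infsum (\<lambda>n. b n * \<xi> (- n)) (UNIV - F))"
    by (simp add: norm_minus_commute)
  also have "\<dots> \<le> infsum (\<lambda>n. cmod (b n * \<xi> (- n))) (UNIV - F)"
    by (intro norm_infsum_bound summable_on_subset_banach[OF abs]) auto
  also have "\<dots> = (\<Sum>\<^sub>\<infinity>n. cmod (b n)) - (\<Sum>n\<in>F. cmod (b n))"
    unfolding norm_eq using infsum_Diff[OF sm _ subset_UNIV, of F] \<open>finite F\<close> by simp
  finally show ?thesis .
qed

text \<open>One sequence of finite sets serves two modes of convergence: the partial sums tend to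
  \<open>\<phi>\<close> a.e. by the L2 rate, and to \<open>fourier_ell1 b\<close> at every character
  by the decay of the absolute tails. Uniqueness of limits identifies the two.\<close>

lemma fourier_ell1_L2:
  assumes b: "b \<in> ell1"
  obtains \<phi> where "\<phi> \<in> L2 M" "fourier_coeff \<phi> = b" "AE \<xi> in M. fourier_ell1 b \<xi> = \<phi> \<xi>"
proof -
  obtain \<phi> where \<phi>: "\<phi> \<in> L2 M" "fourier_coeff \<phi> = b"
    and lim: "((\<lambda>F. \<integral>\<xi>. (cmod ((\<Sum>n\<in>F. b n * \<xi> (- n)) - \<phi> \<xi>))\<^sup>2 \<partial>M) \<longlongrightarrow> 0) (finite_subsets_at_top UNIV)"
    by (rule fourier_coeff_expansion[OF ell1_subset_ell2[OF b]])
  let ?S = "\<Sum>\<^sub>\<infinity>n. cmod (b n)"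
  have sum_lim: "((\<lambda>F. \<Sum>n\<in>F. cmod (b n)) \<longlongrightarrow> ?S) (finite_subsets_at_top UNIV)"
    using b by (simp add: ell1_def flip: has_sum_def)
  \<comment> \<open>The factor 1 matches the constant \<open>C\<close> of
    \<open>L2_AE_tendsto\<close>.\<close>
  define Q where "Q k F \<longleftrightarrow> finite F \<and> (\<integral>\<xi>. (cmod ((\<Sum>n\<in>F. b n * \<xi> (- n)) - \<phi> \<xi>))\<^sup>2 \<partial>M) \<le> 1 * (1/4) ^ k \<and>
      ?S - (\<Sum>n\<in>F. cmod (b n)) \<le> (1/4) ^ k" for k F
  have "\<exists>F. Q k F" for k
  proof -
    have "eventually (\<lambda>F. (\<integral>\<xi>. (cmod ((\<Sum>n\<in>F. b n * \<xi> (- n)) - \<phi> \<xi>))\<^sup>2 \<partial>M) < (1/4) ^ k) (finite_subsets_at_top UNIV)"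
      using lim by (rule order_tendstoD) simp
    moreover have "eventually (\<lambda>F. ?S - (1/4) ^ k < (\<Sum>n\<in>F. cmod (b n))) (finite_subsets_at_top UNIV)"
      using sum_lim by (rule order_tendstoD) simp
    moreover have "eventually finite (finite_subsets_at_top (UNIV :: 'n set))"
      by (rule eventually_finite_subsets_at_top_weakI) simp
    ultimately have "eventually (Q k) (finite_subsets_at_top UNIV)"
      by eventually_elim (auto simp: Q_def)
    then show ?thesis
      by (rule eventually_happens'[OF finite_subsets_at_top_neq_bot])
  qed
  then obtain F where "\<And>k. Q k (F k)"
    by metis
  then have F: "\<And>k. finite (F k)"
      "\<And>k. (\<integral>\<xi>. (cmod ((\<Sum>n\<in>F k. b n * \<xi> (- n)) - \<phi> \<xi>))\<^sup>2 \<partial>M) \<le> 1 * (1/4) ^ k"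
      "\<And>k. ?S - (\<Sum>n\<in>F k. cmod (b n)) \<le> (1/4) ^ k"
    by (auto simp: Q_def)
  have "AE \<xi> in M. (\<lambda>k. \<Sum>n\<in>F k. b n * \<xi> (- n)) \<longlonglongrightarrow> \<phi> \<xi>"
    by (rule L2_AE_tendsto[OF _ \<phi>(1) F(2)]) (intro L2_sum L2_cmult haar_character_L2[OF haar])
  then have "AE \<xi> in M. fourier_ell1 b \<xi> = \<phi> \<xi>"
    using haar_AE_dual_group
  proof eventually_elim
    case (elim \<xi>)
    have "(\<lambda>k. \<Sum>n\<in>F k. b n * \<xi> (- n)) \<longlonglongrightarrow> fourier_ell1 b \<xi>"
    proof (rule LIM_zero_cancel, rule Lim_null_comparison[OF _ LIMSEQ_power_zero])
      show "eventually (\<lambda>k. norm ((\<Sum>n\<in>F k. b n * \<xi> (- n)) - fourier_ell1 b \<xi>) \<le> (1/4::real) ^ k) sequentially"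
        by (intro always_eventually allI order_trans[OF fourier_ell1_partial_sum_bound[OF b elim(2) F(1)] F(3)])
    qed simp
    then show ?case
      using elim(1) by (rule LIMSEQ_unique)
  qed
  with \<phi> that show ?thesis by blast
qed

text \<open>By Parseval, the integral in \<open>is_fourier\<close> is the squared distance from
  \<open>b k\<close> to the coefficients of \<open>\<phi>\<close>. The condition therefore says that
  every sequence in \<open>ell1\<close> tending to \<open>a\<close> also tends to these
  coefficients. To conclude from it, one such sequence has to be exhibited: cut-offs of
  \<open>a\<close> to finite sets.\<close>

lemma is_fourier_iff:
  assumes a: "a \<in> ell2"
  shows "is_fourier M a \<phi> \<longleftrightarrow> \<phi> \<in> L2 M \<and> fourier_coeff \<phi> = a"
proof -
  have key: "(\<integral>\<^sup>+ \<xi>. ennreal ((cmod (fourier_ell1 b \<xi> - \<psi> \<xi>))\<^sup>2) \<partial>M) = ennreal ((ell2_norm (\<lambda>n. b n - fourier_coeff \<psi> n))\<^sup>2)"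
    if b: "b \<in> ell1" and \<psi>: "\<psi> \<in> L2 M" for b \<psi>
  proof -
    obtain \<theta> where \<theta>: "\<theta> \<in> L2 M" "fourier_coeff \<theta> = b" "AE \<xi> in M. fourier_ell1 b \<xi> = \<theta> \<xi>"
      using fourier_ell1_L2[OF b] by blast
    have "(\<integral>\<^sup>+ \<xi>. ennreal ((cmod (fourier_ell1 b \<xi> - \<psi> \<xi>))\<^sup>2) \<partial>M) = (\<integral>\<^sup>+ \<xi>. ennreal ((cmod (\<theta> \<xi> - \<psi> \<xi>))\<^sup>2) \<partial>M)"
      using \<theta>(3) by (intro nn_integral_cong_AE) (auto elim: eventually_mono)
    also have "\<dots> = ennreal (\<integral>\<xi>. (cmod (\<theta> \<xi> - \<psi> \<xi>))\<^sup>2 \<partial>M)"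
      using L2_integrable[OF L2_diff[OF \<theta>(1) \<psi>]] by (simp add: nn_integral_eq_integral)
    also have "\<dots> = ennreal ((ell2_norm (\<lambda>n. b n - fourier_coeff \<psi> n))\<^sup>2)"
      using fourier_coeff_parseval[OF L2_diff[OF \<theta>(1) \<psi>]]
      by (simp add: fourier_coeff_diff[OF \<theta>(1) \<psi>, abs_def] \<theta>(2))
    finally show ?thesis .
  qed
  show ?thesis
  proof
    assume L: "\<phi> \<in> L2 M \<and> fourier_coeff \<phi> = a"
    have "(\<lambda>k. \<integral>\<^sup>+ \<xi>. ennreal ((cmod (fourier_ell1 (b k) \<xi> - \<phi> \<xi>))\<^sup>2) \<partial>M) \<longlonglongrightarrow> 0"
      if "\<And>k. b k \<in> ell1" "(\<lambda>k. ell2_norm (\<lambda>n. b k n - a n)) \<longlonglongrightarrow> 0" for b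
    proof -
      have "(\<lambda>k. ennreal ((ell2_norm (\<lambda>n. b k n - a n))\<^sup>2)) \<longlonglongrightarrow> ennreal (0\<^sup>2)"
        by (intro tendsto_ennrealI tendsto_power that(2))
      then show ?thesis
        using L by (simp add: key[OF that(1)])
    qed
    then show "is_fourier M a \<phi>"
      using L by (auto simp: is_fourier_def L2_def)
  next
    assume fou: "is_fourier M a \<phi>"
    then have \<phi>: "\<phi> \<in> L2 M"
      by (simp add: is_fourier_def L2_def)
    let ?c = "fourier_coeff \<phi>"
    obtain F where F: "\<And>k. finite (F k)" "\<And>k m. k \<le> m \<Longrightarrow> F k \<subseteq> F m"
      "\<And>k G. finite G \<Longrightarrow> G \<inter> F k = {} \<Longrightarrow> (\<Sum>i\<in>G. (cmod (a i))\<^sup>2) \<le> (1/4) ^ k"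
      using ell2_fast_exhaustion[OF a] by metis
    define b where "b k n = (if n \<in> F k then a n else 0)" for k n
    have b1: "b k \<in> ell1" for k
      unfolding ell1_def b_def using F(1)[of k]
      by (auto intro!: finite_nonzero_values_imp_summable_on elim: rev_finite_subset)
    have diff_ell2: "(\<lambda>n. b k n - c n) \<in> ell2" if "c \<in> ell2" for c k
      by (intro ell2_diff ell1_subset_ell2 b1 that)
    have "(ell2_norm (\<lambda>n. b k n - a n))\<^sup>2 \<le> (1/4) ^ k" for k
      unfolding b_def by (rule ell2_cutoff_norm_le[OF a F(1) F(3)])
    then have "(\<lambda>k. (ell2_norm (\<lambda>n. b k n - a n))\<^sup>2) \<longlonglongrightarrow> 0"
      by (intro Lim_null_comparison[OF _ LIMSEQ_power_zero[of "1/4::real"]] always_eventually) auto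
    from tendsto_real_sqrt[OF this] have lim_a: "(\<lambda>k. ell2_norm (\<lambda>n. b k n - a n)) \<longlonglongrightarrow> 0"
      by (simp add: ell2_norm_nonneg)
    then have "(\<lambda>k. \<integral>\<^sup>+ \<xi>. ennreal ((cmod (fourier_ell1 (b k) \<xi> - \<phi> \<xi>))\<^sup>2) \<partial>M) \<longlonglongrightarrow> 0"
      using fou b1 unfolding is_fourier_def by blast
    then have lim_c: "(\<lambda>k. (ell2_norm (\<lambda>n. b k n - ?c n))\<^sup>2) \<longlonglongrightarrow> 0"
      by (simp add: key[OF b1 \<phi>] ennreal_tendsto_0_iff)
    have "(\<lambda>k. 2 * (ell2_norm (\<lambda>n. b k n - a n))\<^sup>2 + 2 * (ell2_norm (\<lambda>n. b k n - ?c n))\<^sup>2) \<longlonglongrightarrow> 2 * 0\<^sup>2 + 2 * 0"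
      by (intro tendsto_intros lim_a lim_c)
    moreover have "(ell2_norm (\<lambda>n. ?c n - a n))\<^sup>2 \<le>
        2 * (ell2_norm (\<lambda>n. b k n - a n))\<^sup>2 + 2 * (ell2_norm (\<lambda>n. b k n - ?c n))\<^sup>2" for k
      using ell2_norm_diff_sq_le[OF diff_ell2[OF a] diff_ell2[OF fourier_coeff_ell2[OF \<phi>]], of k k] by simp
    ultimately have "(ell2_norm (\<lambda>n. ?c n - a n))\<^sup>2 \<le> 2 * 0\<^sup>2 + 2 * 0"
      by (intro tendsto_lowerbound[OF _ always_eventually]) auto
    then have "?c = a"
      using ell2_norm_diff_eq_0[OF fourier_coeff_ell2[OF \<phi>] a] by simp
    with \<phi> show "\<phi> \<in> L2 M \<and> ?c = a" by blast
  qed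
qed

text \<open>Riesz--Fischer provides a witness for the choice in \<open>fourier\<close>.\<close>

lemma fourier_L2: "a \<in> ell2 \<Longrightarrow> fourier M a \<in> L2 M"
  and fourier_coeff_fourier: "a \<in> ell2 \<Longrightarrow> fourier_coeff (fourier M a) = a"
proof -
  assume a: "a \<in> ell2"
  obtain \<phi> where "\<phi> \<in> L2 M" "fourier_coeff \<phi> = a"
    by (rule fourier_coeff_expansion[OF a])
  then have "is_fourier M a (fourier M a)"
    unfolding fourier_def using someI_ex[of "is_fourier M a"] is_fourier_iff[OF a] by blast
  then show "fourier M a \<in> L2 M" "fourier_coeff (fourier M a) = a"
    using is_fourier_iff[OF a] by auto
qed

text \<open>The working rule for \<open>fourier\<close>: a candidate is checked on its coefficients,
  and equality holds a.e. because \<open>fourier\<close> selects an arbitrary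
  representative.\<close>

lemma fourier_eqI:
  assumes "\<phi> \<in> L2 M" "fourier_coeff \<phi> = a"
  shows "AE \<xi> in M. fourier M a \<xi> = \<phi> \<xi>"
proof -
  have "a \<in> ell2"
    using assms fourier_coeff_ell2 by blast
  then show ?thesis
    using assms by (intro fourier_coeff_inject) (auto simp: fourier_L2 fourier_coeff_fourier)
qed

lemma fourier_add:
  "a \<in> ell2 \<Longrightarrow> b \<in> ell2 \<Longrightarrow> AE \<xi> in M. fourier M (\<lambda>n. a n + b n) \<xi> = fourier M a \<xi> + fourier M b \<xi>"
  by (intro fourier_eqI) (auto simp: L2_add fourier_L2 fourier_coeff_add fourier_coeff_fourier)

lemma fourier_cmult: "a \<in> ell2 \<Longrightarrow> AE \<xi> in M. fourier M (\<lambda>n. c * a n) \<xi> = c * fourier M a \<xi>"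
  by (intro fourier_eqI) (auto simp: L2_cmult fourier_L2 fourier_coeff_cmult fourier_coeff_fourier)

lemma fourier_shift:
  assumes "a \<in> ell2"
  shows "AE \<xi> in M. fourier M (\<lambda>n. a (n - m)) \<xi> = \<xi> (- m) * fourier M a \<xi>"
proof (rule fourier_eqI)
  show "(\<lambda>\<xi>. \<xi> (- m) * fourier M a \<xi>) \<in> L2 M"
    by (intro haar_character_mult_L2 fourier_L2 assms)
  show "fourier_coeff (\<lambda>\<xi>. \<xi> (- m) * fourier M a \<xi>) = (\<lambda>n. a (n - m))"
  proof
    fix n
    have "fourier_coeff (\<lambda>\<xi>. \<xi> (- m) * fourier M a \<xi>) n = fourier_coeff (fourier M a) (n - m)"
      unfolding fourier_coeff_def
      by (rule Bochner_Integration.integral_cong) (auto simp: haar_space[OF haar] dual_group_simps mult_ac)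
    then show "fourier_coeff (\<lambda>\<xi>. \<xi> (- m) * fourier M a \<xi>) n = a (n - m)"
      using assms by (simp add: fourier_coeff_fourier)
  qed
qed

lemma fourier_unit: "AE \<xi> in M. fourier M (\<lambda>n. if n = m then c else 0) \<xi> = c * \<xi> (- m)"
proof (rule fourier_eqI)
  show "(\<lambda>\<xi>. c * \<xi> (- m)) \<in> L2 M"
    by (intro L2_cmult haar_character_L2[OF haar])
  show "fourier_coeff (\<lambda>\<xi>. c * \<xi> (- m)) = (\<lambda>n. if n = m then c else 0)"
    using haar_characters_orthonormal[OF haar, of m]
    by (auto simp: fun_eq_iff fourier_coeff_cmult fourier_coeff_inner)
qed

lemma fourier_inner:
  assumes a: "a \<in> ell2" and b: "b \<in> ell2"
  shows "(\<integral>\<xi>. fourier M a \<xi> * cnj (fourier M b \<xi>) \<partial>M) = ell2_inner a b"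
proof -
  have L: "(\<integral>\<xi>. (cmod (fourier M a \<xi> + c * fourier M b \<xi>))\<^sup>2 \<partial>M) = (ell2_norm (\<lambda>n. a n + c * b n))\<^sup>2" for c
    using fourier_coeff_parseval[OF L2_add[OF fourier_L2[OF a] L2_cmult[OF fourier_L2[OF b]]], of c]
    by (simp add: fourier_coeff_add[OF fourier_L2[OF a] L2_cmult[OF fourier_L2[OF b]], abs_def]
        fourier_coeff_cmult a b fourier_coeff_fourier)
  have R: "(\<integral>x. (cmod (a x + c * b x))\<^sup>2 \<partial>count_space UNIV) = (ell2_norm (\<lambda>n. a n + c * b n))\<^sup>2" for c
    by (simp only: ell2_norm_sq[OF ell2_add[OF a ell2_cmult[OF b]]])
  have "4 * (\<integral>\<xi>. fourier M a \<xi> * cnj (fourier M b \<xi>) \<partial>M) = 4 * (\<integral>x. a x * cnj (b x) \<partial>count_space UNIV)"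
    using L2_polarization[OF fourier_L2[OF a] fourier_L2[OF b]]
      L2_polarization[OF a[unfolded ell2_iff_L2] b[unfolded ell2_iff_L2]]
    unfolding L R by (rule trans[OF _ sym])
  then show ?thesis
    by (simp add: ell2_inner_eq a b)
qed

end

section \<open>Quadratic forms and determinants of matrices\<close>

lemma vec_norm_sq: "(norm (x :: complex^'h))\<^sup>2 = (\<Sum>h\<in>UNIV. (cmod (x $ h))\<^sup>2)"
  by (simp add: norm_vec_def L2_set_def sum_nonneg)

lemma vec_norm_le_sum: "norm (x :: complex^'h) \<le> (\<Sum>h\<in>UNIV. cmod (x $ h))"
  unfolding norm_vec_def by (rule L2_set_le_sum) simp

lemma inner_complex_Re: "(z::complex) \<bullet> w = Re (z * cnj w)"
  by (simp add: inner_complex_def)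

text \<open>\<open>\<bullet>\<close> on complex vectors is the real part of the Hermitian product.
  The eigenvalue arguments run in this real Euclidean space, which fits \<open>lambda_min\<close>
  and \<open>lambda_max\<close> because they refer to real eigenvalues.\<close>

lemma conj_transpose_adjoint:
  fixes A :: "complex^'m^'n"
  shows "(conj_transpose A *v x) \<bullet> y = x \<bullet> (A *v y)"
proof -
  have "(conj_transpose A *v x) \<bullet> y = (\<Sum>i\<in>UNIV. \<Sum>j\<in>UNIV. Re (cnj (A $ j $ i) * x $ j * cnj (y $ i)))"
    by (simp only: inner_vec_def inner_complex_Re matrix_vector_mult_def conj_transpose_def vec_lambda_beta
      sum_distrib_right Re_sum)
  also have "\<dots> = (\<Sum>j\<in>UNIV. \<Sum>i\<in>UNIV. Re (cnj (A $ j $ i) * x $ j * cnj (y $ i)))"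
    by (rule sum.swap)
  also have "\<dots> = x \<bullet> (A *v y)"
    by (simp only: inner_vec_def inner_complex_Re matrix_vector_mult_def vec_lambda_beta cnj_sum complex_cnj_mult
      sum_distrib_left Re_sum mult_ac)
  finally show ?thesis .
qed

lemma vec_mult_of_real: "complex_of_real t *s (v :: complex^'h) = t *\<^sub>R v"
  unfolding vec_eq_iff vector_smult_component vector_scaleR_component by (simp add: scaleR_conv_of_real)

lemma matrix_vector_linear: "linear ((*v) (A :: complex^'m^'n))"
proof (rule linearI)
  show "A *v (r *\<^sub>R x) = r *\<^sub>R (A *v x)" for r x
    by (simp only: vec_mult_of_real[symmetric] vector_scalar_commute)
qed (rule matrix_vector_right_distrib)

section \<open>Extreme eigenvalues of self-adjoint maps\<close>

context
  fixes L :: "'a::euclidean_space \<Rightarrow> 'a"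
  assumes lin: "linear L" and sa: "\<And>x y. L x \<bullet> y = x \<bullet> L y"
begin

text \<open>Eigenvectors for different eigenvalues are orthogonal, hence independent. Finiteness is
  what gives \<open>Min\<close> and \<open>Max\<close> their meaning.\<close>

lemma self_adjoint_eigenvalues_finite: "finite {t. \<exists>v. v \<noteq> 0 \<and> L v = t *\<^sub>R v}"
proof -
  let ?E = "{t. \<exists>v. v \<noteq> 0 \<and> L v = t *\<^sub>R v}"
  have "\<forall>t\<in>?E. \<exists>v. v \<noteq> 0 \<and> L v = t *\<^sub>R v"
    by blast
  then obtain w where w: "\<And>t. t \<in> ?E \<Longrightarrow> w t \<noteq> 0 \<and> L (w t) = t *\<^sub>R w t"
    using bchoice[of ?E "\<lambda>t v. v \<noteq> 0 \<and> L v = t *\<^sub>R v"] by blast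
  have orth: "w s \<bullet> w t = 0" if "s \<in> ?E" "t \<in> ?E" "s \<noteq> t" for s t
  proof -
    have "s * (w s \<bullet> w t) = t * (w s \<bullet> w t)"
      using sa[of "w s" "w t"] w[OF that(1)] w[OF that(2)] by simp
    then show ?thesis using that(3) by simp
  qed
  have inj: "inj_on w ?E"
  proof (rule inj_onI, rule ccontr)
    fix s t assume "s \<in> ?E" "t \<in> ?E" "w s = w t" "s \<noteq> t"
    then have "w s \<bullet> w s = 0"
      using orth[of s t] by simp
    then show False
      using w \<open>s \<in> ?E\<close> by auto
  qed
  have "pairwise orthogonal (w ` ?E)"
    unfolding pairwise_def orthogonal_def using orth by fastforce
  then have "independent (w ` ?E)"
    by (rule pairwise_orthogonal_independent) (use w in force)
  then have "finite (w ` ?E)"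
    by (rule independent_imp_finite)
  then show ?thesis
    using inj finite_imageD by blast
qed

text \<open>The Rayleigh quotient attains its minimum on the compact unit sphere. A minimizer is an
  eigenvector, by a variation in the direction \<open>w\<close>, the defect in the eigenvalue
  equation.\<close>

lemma self_adjoint_min_eigenvalue:
  obtains t v where "v \<noteq> 0" "L v = t *\<^sub>R v" "\<And>x. t * (norm x)\<^sup>2 \<le> L x \<bullet> x"
proof -
  have bl: "bounded_linear L"
    using lin by (simp add: linear_conv_bounded_linear)
  have "continuous_on (sphere (0::'a) 1) (\<lambda>x. L x \<bullet> x)"
    by (intro continuous_intros bounded_linear.continuous_on[OF bl])
  moreover have "sphere (0::'a) 1 \<noteq> {}"
    by simp
  ultimately obtain v where v: "v \<in> sphere 0 1" and min: "\<And>x. x \<in> sphere 0 1 \<Longrightarrow> L v \<bullet> v \<le> L x \<bullet> x"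
    using continuous_attains_inf[OF compact_sphere] by blast
  define t where "t = L v \<bullet> v"
  have le: "t * (norm x)\<^sup>2 \<le> L x \<bullet> x" for x
  proof (cases "x = 0")
    case True
    then show ?thesis by simp
  next
    case False
    have "t \<le> L (x /\<^sub>R norm x) \<bullet> (x /\<^sub>R norm x)"
      unfolding t_def using False by (intro min) simp
    also have "\<dots> = (L x \<bullet> x) / (norm x)\<^sup>2"
      using linear_cmul[OF lin] by (simp add: power2_eq_square divide_inverse mult_ac)
    finally show ?thesis
      using False by (simp add: pos_le_divide_eq)
  qed
  \<comment> \<open>The form \<open>B x = \<langle>L x - t x, x\<rangle>\<close> is nonnegative and vanishes at \<open>v\<close>, so its derivative at \<open>v\<close> vanishes.\<close>
  define w where "w = L v - t *\<^sub>R v"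
  define b where "b = L w \<bullet> w - t * (norm w)\<^sup>2"
  have "norm v = 1"
    using v by simp
  then have vv: "v \<bullet> v = 1"
    by (simp add: dot_square_norm)
  have expand: "L (v + s *\<^sub>R w) \<bullet> (v + s *\<^sub>R w) - t * (norm (v + s *\<^sub>R w))\<^sup>2 = 2 * s * (w \<bullet> w) + s\<^sup>2 * b" for s
  proof -
    have 1: "L (v + s *\<^sub>R w) = L v + s *\<^sub>R L w"
      by (simp add: linear_add[OF lin] linear_cmul[OF lin])
    have 2: "L v \<bullet> v = t" "w \<bullet> v = v \<bullet> w"
      by (simp_all add: t_def inner_commute)
    have 3: "L v \<bullet> w = w \<bullet> w + t * (v \<bullet> w)"
      by (simp add: w_def inner_diff_left)
    moreover have "L w \<bullet> v = L v \<bullet> w"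
      using sa[of w v] inner_commute[of w "L v"] by simp
    ultimately have 4: "L w \<bullet> v = w \<bullet> w + t * (v \<bullet> w)"
      by simp
    show ?thesis
      unfolding b_def power2_norm_eq_inner 1 inner_add_left inner_add_right inner_scaleR_left inner_scaleR_right 2 3 4 vv
      by (simp add: power2_eq_square algebra_simps)
  qed
  have "w \<bullet> w = 0"
  proof (rule ccontr)
    assume "w \<bullet> w \<noteq> 0"
    then have pos: "0 < w \<bullet> w"
      by simp
    \<comment> \<open>A negative \<open>s\<close> so small that the quadratic term cannot outweigh
      the linear one: \<open>\<bar>s\<bar> * \<bar>b\<bar> \<le> w \<bullet> w\<close>. The summand
      1 avoids division by 0.\<close>
    define s where "s = - (w \<bullet> w) / (\<bar>b\<bar> + 1)"
    have "s < 0"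
      using pos by (simp add: s_def divide_neg_pos)
    have "0 \<le> 2 * s * (w \<bullet> w) + s\<^sup>2 * b"
      using le[of "v + s *\<^sub>R w"] expand[of s] by simp
    also have "\<dots> = s * (2 * (w \<bullet> w) + s * b)"
      by (simp add: power2_eq_square algebra_simps)
    finally have "2 * (w \<bullet> w) + s * b \<le> 0"
      using \<open>s < 0\<close> by (simp add: zero_le_mult_iff)
    moreover have "- (s * b) \<le> w \<bullet> w"
    proof -
      have "- (s * b) \<le> \<bar>s\<bar> * \<bar>b\<bar>"
        by (metis abs_ge_minus_self abs_mult)
      also have "\<dots> = (w \<bullet> w) * (\<bar>b\<bar> / (\<bar>b\<bar> + 1))"
        using pos by (simp add: s_def abs_mult)
      also have "\<dots> \<le> (w \<bullet> w) * 1"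
        using pos by (intro mult_left_mono) auto
      finally show ?thesis by simp
    qed
    ultimately show False
      using pos by linarith
  qed
  then have "L v = t *\<^sub>R v"
    by (simp add: w_def)
  moreover have "v \<noteq> 0"
    using vv by auto
  ultimately show ?thesis
    using le that by blast
qed

text \<open>Replaces the eigenvalue by a family of inequalities, the form in which it can be
  compared with norms and shown to be measurable.\<close>

lemma self_adjoint_Min_eigenvalue_iff:
  "c \<le> Min {t. \<exists>v. v \<noteq> 0 \<and> L v = t *\<^sub>R v} \<longleftrightarrow> (\<forall>x. c * (norm x)\<^sup>2 \<le> L x \<bullet> x)"
proof -
  let ?E = "{t. \<exists>v. v \<noteq> 0 \<and> L v = t *\<^sub>R v}"
  obtain t v where tv: "v \<noteq> 0" "L v = t *\<^sub>R v" "\<And>x. t * (norm x)\<^sup>2 \<le> L x \<bullet> x"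
    using self_adjoint_min_eigenvalue by blast
  have "c \<le> Min ?E \<longleftrightarrow> (\<forall>s\<in>?E. c \<le> s)"
    using tv by (intro Min_ge_iff self_adjoint_eigenvalues_finite) blast
  also have "\<dots> \<longleftrightarrow> (\<forall>x. c * (norm x)\<^sup>2 \<le> L x \<bullet> x)"
  proof
    assume "\<forall>s\<in>?E. c \<le> s"
    then have "c \<le> t" using tv by blast
    then show "\<forall>x. c * (norm x)\<^sup>2 \<le> L x \<bullet> x"
      using tv(3) by (meson mult_right_mono order_trans zero_le_power2)
  next
    assume c: "\<forall>x. c * (norm x)\<^sup>2 \<le> L x \<bullet> x"
    show "\<forall>s\<in>?E. c \<le> s"
    proof
      fix s assume "s \<in> ?E"
      then obtain x where "x \<noteq> 0" "L x = s *\<^sub>R x" by blast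
      then show "c \<le> s"
        using c[rule_format, of x] by (simp add: dot_square_norm)
    qed
  qed
  finally show ?thesis .
qed

end

text \<open>The previous equivalence applied to the negative of \<open>L\<close>, whose eigenvalues
  are those of \<open>L\<close> with opposite sign.\<close>

lemma self_adjoint_Max_eigenvalue_iff:
  fixes L :: "'a::euclidean_space \<Rightarrow> 'a"
  assumes lin: "linear L" and sa: "\<And>x y. L x \<bullet> y = x \<bullet> L y"
  shows "Max {t. \<exists>v. v \<noteq> 0 \<and> L v = t *\<^sub>R v} \<le> c \<longleftrightarrow> (\<forall>x. L x \<bullet> x \<le> c * (norm x)\<^sup>2)"
proof -
  let ?E = "\<lambda>L. {t. \<exists>v. v \<noteq> 0 \<and> L v = t *\<^sub>R v} :: real set"
  have neg: "linear (\<lambda>x. - L x)" "\<And>x y. (- L x) \<bullet> y = x \<bullet> (- L y)"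
    using linear_compose_neg[OF lin] by (simp_all add: sa)
  have E: "?E (\<lambda>x. - L x) = uminus ` ?E L"
  proof (intro set_eqI iffI)
    fix t assume "t \<in> ?E (\<lambda>x. - L x)"
    then obtain v where v: "v \<noteq> 0" "- L v = t *\<^sub>R v" by blast
    have "L v = - (- L v)" by simp
    then have "L v = (- t) *\<^sub>R v"
      unfolding v(2) by simp
    with v(1) have "- t \<in> ?E L" by blast
    then show "t \<in> uminus ` ?E L"
      by (rule rev_image_eqI) simp
  next
    fix t assume "t \<in> uminus ` ?E L"
    then show "t \<in> ?E (\<lambda>x. - L x)" by auto
  qed
  have fin: "finite (?E L)"
    by (rule self_adjoint_eigenvalues_finite[OF lin sa])
  obtain t v where "v \<noteq> 0" "- L v = t *\<^sub>R v"
    using self_adjoint_min_eigenvalue[OF neg] by blast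
  then have ne: "?E L \<noteq> {}"
    using E by blast
  have "Max (?E L) \<le> c \<longleftrightarrow> (\<forall>s\<in>?E L. s \<le> c)"
    using fin ne by (rule Max_le_iff)
  also have "\<dots> \<longleftrightarrow> (\<forall>s\<in>uminus ` ?E L. - c \<le> s)"
    by simp
  also have "\<dots> \<longleftrightarrow> - c \<le> Min (?E (\<lambda>x. - L x))"
    unfolding E using fin ne by simp
  also have "\<dots> \<longleftrightarrow> (\<forall>x. (- c) * (norm x)\<^sup>2 \<le> (- L x) \<bullet> x)"
    by (rule self_adjoint_Min_eigenvalue_iff[OF neg])
  finally show ?thesis by simp
qed

lemma gram_self_adjoint:
  fixes A :: "complex^'h^'h"
  shows "((conj_transpose A ** A) *v x) \<bullet> y = (A *v x) \<bullet> (A *v y)"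
    "((conj_transpose A ** A) *v x) \<bullet> y = x \<bullet> ((conj_transpose A ** A) *v y)"
  by (simp_all add: matrix_vector_mul_assoc[symmetric] conj_transpose_adjoint)
    (simp add: inner_commute[of x] inner_commute[of "A *v x"] conj_transpose_adjoint)

lemma lambda_min_gram_iff:
  fixes A :: "complex^'h^'h"
  shows "c \<le> lambda_min (conj_transpose A ** A) \<longleftrightarrow> (\<forall>x. c * (norm x)\<^sup>2 \<le> (norm (A *v x))\<^sup>2)"
  unfolding lambda_min_def eigenvalue_of_def vec_mult_of_real
  by (subst self_adjoint_Min_eigenvalue_iff[OF matrix_vector_linear gram_self_adjoint(2)])
    (simp add: gram_self_adjoint(1) dot_square_norm)

lemma lambda_max_gram_iff:
  fixes A :: "complex^'h^'h"
  shows "lambda_max (conj_transpose A ** A) \<le> c \<longleftrightarrow> (\<forall>x. (norm (A *v x))\<^sup>2 \<le> c * (norm x)\<^sup>2)"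
  unfolding lambda_max_def eigenvalue_of_def vec_mult_of_real
  by (subst self_adjoint_Max_eigenvalue_iff[OF matrix_vector_linear gram_self_adjoint(2)])
    (simp add: gram_self_adjoint(1) dot_square_norm)

section \<open>Entries, norms and determinants of matrices\<close>

lemma matrix_vector_axis: "((A :: complex^'m^'n) *v axis l 1) $ h = A $ h $ l"
  by (simp add: matrix_vector_mult_def axis_def if_distrib cong: if_cong)

lemma norm_axis_one: "norm (axis l 1 :: complex^'h) = 1"
proof -
  have "(norm (axis l 1 :: complex^'h))\<^sup>2 = 1"
    unfolding vec_norm_sq by (simp add: axis_def if_distrib[of cmod] if_distrib[of "\<lambda>x. x\<^sup>2"] cong: if_cong)
  then show ?thesis
    by (simp add: power2_eq_1_iff)
qed

lemma matrix_entry_bound: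
  fixes A :: "complex^'m^'n"
  assumes "\<And>x. (norm (A *v x))\<^sup>2 \<le> C * (norm x)\<^sup>2"
  shows "cmod (A $ h $ l) \<le> sqrt C"
proof -
  have "cmod ((A *v axis l 1) $ h) \<le> norm (A *v axis l 1)"
    by (rule Finite_Cartesian_Product.norm_nth_le)
  then have "(cmod (A $ h $ l))\<^sup>2 \<le> (norm (A *v axis l 1))\<^sup>2"
    by (simp add: matrix_vector_axis power_mono)
  also have "\<dots> \<le> C"
    using assms[of "axis l 1"] by (simp add: norm_axis_one)
  finally show ?thesis
    by (simp add: real_le_rsqrt)
qed

text \<open>The constant is crude: only the existence of a bound matters here, and the optimal ones
  come from the eigenvalues.\<close>

lemma matrix_norm_bound:
  fixes A :: "complex^'m^'n"
  assumes K: "\<And>h l. cmod (A $ h $ l) \<le> K"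
  shows "(norm (A *v x))\<^sup>2 \<le> (real CARD('n) * real CARD('m) * K)\<^sup>2 * (norm x)\<^sup>2"
proof -
  have "0 \<le> K"
    using K norm_ge_zero order_trans by blast
  have "cmod ((A *v x) $ h) \<le> real CARD('m) * (K * norm x)" for h
  proof -
    have "cmod ((A *v x) $ h) \<le> (\<Sum>l\<in>UNIV. cmod (A $ h $ l * x $ l))"
      unfolding matrix_vector_mult_def vec_lambda_beta by (rule norm_sum)
    also have "\<dots> \<le> (\<Sum>l\<in>(UNIV::'m set). K * norm x)"
      unfolding norm_mult by (intro sum_mono mult_mono K Finite_Cartesian_Product.norm_nth_le) (simp_all add: \<open>0 \<le> K\<close>)
    finally show ?thesis by simp
  qed
  then have "(\<Sum>h\<in>UNIV. cmod ((A *v x) $ h)) \<le> (\<Sum>h\<in>(UNIV::'n set). real CARD('m) * (K * norm x))"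
    by (intro sum_mono)
  then have "norm (A *v x) \<le> (real CARD('n) * real CARD('m) * K) * norm x"
    using vec_norm_le_sum[of "A *v x"] by simp
  then show ?thesis
    unfolding power_mult_distrib[symmetric] by (intro power_mono) auto
qed

text \<open>The number of terms in the Leibniz formula, that is, the factorial of the dimension. It
  enters only constants whose positivity matters.\<close>

definition perm_count :: "'h itself \<Rightarrow> real" where
  "perm_count _ = real (card {p. p permutes (UNIV :: 'h set)})"

lemma perm_count_pos: "0 < perm_count TYPE('h::finite)"
proof -
  have "id \<in> {p. p permutes (UNIV :: 'h set)}"
    by (simp add: permutes_id)
  then show ?thesis
    unfolding perm_count_def of_nat_0_less_iff card_gt_0_iff using finite_permutations[OF finite] by blast
qed

lemma det_bound:
  fixes A :: "complex^'h^'h"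
  assumes K: "\<And>h l. cmod (A $ h $ l) \<le> K"
  shows "cmod (det A) \<le> perm_count TYPE('h) * K ^ CARD('h)"
proof -
  have "cmod (det A) \<le> (\<Sum>p\<in>{p. p permutes (UNIV::'h set)}. cmod (of_int (sign p) * (\<Prod>i\<in>UNIV. A $ i $ p i)))"
    unfolding det_def by (rule norm_sum)
  also have "\<dots> \<le> (\<Sum>p\<in>{p. p permutes (UNIV::'h set)}. K ^ CARD('h))"
  proof (rule sum_mono)
    fix p :: "'h \<Rightarrow> 'h"
    have "cmod (of_int (sign p)) = 1"
      by (simp add: sign_def)
    moreover have "(\<Prod>i\<in>UNIV. cmod (A $ i $ p i)) \<le> (\<Prod>i\<in>(UNIV::'h set). K)"
      by (intro prod_mono) (simp add: K)
    ultimately show "cmod (of_int (sign p) * (\<Prod>i\<in>UNIV. A $ i $ p i)) \<le> K ^ CARD('h)"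
      by (simp add: norm_mult prod_norm)
  qed
  finally show ?thesis
    by (simp add: perm_count_def)
qed

text \<open>A lower bound for \<open>A\<close> bounds the entries of its inverse by
  \<open>sqrt (1 / c)\<close>, and hence the determinant of the inverse from above.\<close>

lemma det_lower_bound:
  fixes A :: "complex^'h^'h"
  assumes "0 < c" and c: "\<And>x. c * (norm x)\<^sup>2 \<le> (norm (A *v x))\<^sup>2"
  shows "1 / (perm_count TYPE('h) * sqrt (1 / c) ^ CARD('h)) \<le> cmod (det A)"
proof -
  have "inj ((*v) A)"
  proof (rule injI)
    fix x y assume "A *v x = A *v y"
    then have "A *v (x - y) = 0"
      by (simp add: matrix_vector_mult_diff_distrib)
    then have "c * (norm (x - y))\<^sup>2 \<le> 0"
      using c[of "x - y"] by simp
    then show "x = y"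
      using \<open>0 < c\<close> by (simp add: mult_le_0_iff)
  qed
  then obtain B where B: "B ** A = mat 1"
    using matrix_left_invertible_injective by blast
  then have AB: "A ** B = mat 1"
    using matrix_left_right_inverse by blast
  have "(norm (B *v x))\<^sup>2 \<le> 1 / c * (norm x)\<^sup>2" for x
  proof -
    have "A *v (B *v x) = x"
      by (simp add: matrix_vector_mul_assoc AB)
    then show ?thesis
      using c[of "B *v x"] \<open>0 < c\<close> by (simp add: field_simps)
  qed
  then have "cmod (det B) \<le> perm_count TYPE('h) * sqrt (1 / c) ^ CARD('h)"
    by (intro det_bound matrix_entry_bound)
  moreover have "cmod (det A) * cmod (det B) = 1"
    using arg_cong[OF AB, of "\<lambda>X. cmod (det X)"] by (simp add: det_mul norm_mult)
  ultimately have "1 \<le> cmod (det A) * (perm_count TYPE('h) * sqrt (1 / c) ^ CARD('h))"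
    by (metis mult_left_mono norm_ge_zero)
  then show ?thesis
    using perm_count_pos[where 'h = 'h] \<open>0 < c\<close> by (simp add: divide_le_eq)
qed

text \<open>The constant is obtained before the matrix and depends only on \<open>K\<close>,
  \<open>d\<close> and the dimension, so that one \<open>c\<close> serves almost all
  \<open>\<xi>\<close>. Cramer's rule bounds the entries of the inverse, and thereby its
  norm.\<close>

lemma matrix_lower_bound:
  assumes "0 < d"
  obtains c where "0 < c" "\<And>(A :: complex^'h^'h) x. (\<And>h l. cmod (A $ h $ l) \<le> K) \<Longrightarrow> d \<le> cmod (det A) \<Longrightarrow> c * (norm x)\<^sup>2 \<le> (norm (A *v x))\<^sup>2"
proof -
  \<comment> \<open>Cramer's rule replaces a column by a unit vector with entries 0 and 1, so the
    common bound on the entries has to be at least 1.\<close>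
  define K' where "K' = perm_count TYPE('h) * max K 1 ^ CARD('h) / d"
  define C where "C = (real CARD('h) * real CARD('h) * K')\<^sup>2"
  have "0 < K'"
    using assms perm_count_pos[where 'h = 'h] by (simp add: K'_def)
  then have "0 < C"
    by (simp add: C_def)
  have "1 / C * (norm x)\<^sup>2 \<le> (norm (A *v x))\<^sup>2"
    if K: "\<And>h l. cmod (A $ h $ l) \<le> K" and d: "d \<le> cmod (det A)" for A :: "complex^'h^'h" and x
  proof -
    have det: "det A \<noteq> 0"
      using d \<open>0 < d\<close> by auto
    then obtain B where B: "A ** B = mat 1" "B ** A = mat 1"
      using invertible_det_nz[of A] unfolding invertible_def by blast
    have "cmod (B $ k $ l) \<le> K'" for k l
    proof -
      have "A *v (B *v axis l 1) = axis l 1"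
        by (simp add: matrix_vector_mul_assoc B)
      then have "B *v axis l 1 = (\<chi> k. det (\<chi> i j. if j = k then axis l 1 $ i else A $ i $ j) / det A)"
        using cramer[OF det] by blast
      then have "B $ k $ l = det (\<chi> i j. if j = k then axis l 1 $ i else A $ i $ j) / det A"
        using matrix_vector_axis[of B l k] by simp
      moreover have "cmod (det (\<chi> i j. if j = k then axis l 1 $ i else A $ i $ j)) \<le> perm_count TYPE('h) * max K 1 ^ CARD('h)"
        by (rule det_bound) (auto simp: axis_def K le_max_iff_disj)
      ultimately show ?thesis
        unfolding K'_def norm_divide using d \<open>0 < d\<close> perm_count_pos[where 'h = 'h]
        by (auto simp: norm_divide intro!: frac_le)
    qed
    then have "(norm (B *v (A *v x)))\<^sup>2 \<le> C * (norm (A *v x))\<^sup>2"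
      unfolding C_def by (rule matrix_norm_bound)
    then have "(norm x)\<^sup>2 \<le> C * (norm (A *v x))\<^sup>2"
      by (simp add: matrix_vector_mul_assoc B)
    then show ?thesis
      using \<open>0 < C\<close> by (simp add: field_simps)
  qed
  then show ?thesis
    using that[of "1 / C"] \<open>0 < C\<close> by simp
qed

lemma dense_forall_vec:
  fixes P :: "'a::euclidean_space \<Rightarrow> bool"
  assumes D: "\<And>X :: 'a set. open X \<Longrightarrow> X \<noteq> {} \<Longrightarrow> \<exists>d\<in>D. d \<in> X"
    and "closed {x. P x}" and "\<And>d. d \<in> D \<Longrightarrow> P d"
  shows "P x"
proof (rule ccontr)
  assume "\<not> P x"
  moreover have "open (- {x. P x})"
    using assms(2) by (simp add: open_closed)
  ultimately obtain d where "d \<in> D" "d \<in> - {x. P x}"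
    using D[of "- {x. P x}"] by blast
  then show False
    using assms(3) by blast
qed

lemma det_conj_transpose: "det (conj_transpose A) = cnj (det (A :: complex^'h^'h))"
proof -
  have "conj_transpose A = transpose (\<chi> i j. cnj (A $ i $ j))"
    by (simp add: conj_transpose_def transpose_def)
  moreover have "det (\<chi> i j. cnj (A $ i $ j)) = cnj (det A)"
    by (simp add: det_def)
  ultimately show ?thesis
    by (simp add: det_transpose)
qed

section \<open>Vector-valued Fourier transform\<close>

lemma slice_has_sum:
  fixes g :: "'n \<times> 'h::finite \<Rightarrow> 'b::topological_comm_monoid_add"
  assumes "\<And>h. ((\<lambda>n. g (n, h)) has_sum s h) UNIV"
  shows "(g has_sum (\<Sum>h\<in>UNIV. s h)) UNIV"
proof -
  have "(g has_sum s h) (range (\<lambda>n. (n, h)))" for h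
    using assms by (subst has_sum_reindex) (auto simp: inj_on_def o_def)
  then have *: "(g has_sum (\<Sum>h\<in>UNIV. s h)) (\<Union>h. range (\<lambda>n. (n, h)))"
    by (rule sum_has_sum[OF finite]) blast
  have "x \<in> (\<Union>h. range (\<lambda>n. (n, h)))" for x :: "'n \<times> 'h"
    by (cases x) blast
  then have "(\<Union>h. range (\<lambda>n::'n. (n, h :: 'h))) = UNIV"
    by blast
  from *[unfolded this] show ?thesis .
qed

lemma ell2_prod_iff:
  fixes a :: "'n \<times> 'h::finite \<Rightarrow> complex"
  shows "a \<in> ell2 \<longleftrightarrow> (\<forall>h. (\<lambda>n. a (n, h)) \<in> ell2)"
proof
  assume a: "a \<in> ell2"
  show "\<forall>h. (\<lambda>n. a (n, h)) \<in> ell2"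
  proof
    fix h
    have "(\<lambda>x. (cmod (a x))\<^sup>2) summable_on range (\<lambda>n. (n, h))"
      using a unfolding ell2_def mem_Collect_eq by (rule summable_on_subset_banach) simp
    then show "(\<lambda>n. a (n, h)) \<in> ell2"
      by (subst (asm) summable_on_reindex) (auto simp: inj_on_def ell2_def o_def)
  qed
next
  assume "\<forall>h. (\<lambda>n. a (n, h)) \<in> ell2"
  then have "((\<lambda>n. (cmod (a (n, h)))\<^sup>2) has_sum (\<Sum>\<^sub>\<infinity>n. (cmod (a (n, h)))\<^sup>2)) UNIV" for h
    by (simp add: ell2_def)
  then show "a \<in> ell2"
    unfolding ell2_def mem_Collect_eq by (rule has_sum_imp_summable[OF slice_has_sum])
qed

lemma ell2_slice: "a \<in> ell2 \<Longrightarrow> (\<lambda>n. a (n, h::'h::finite)) \<in> ell2"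
  by (simp add: ell2_prod_iff)

lemma ell2_norm_prod:
  fixes a :: "'n \<times> 'h::finite \<Rightarrow> complex"
  assumes "a \<in> ell2"
  shows "(ell2_norm a)\<^sup>2 = (\<Sum>h\<in>UNIV. (ell2_norm (\<lambda>n. a (n, h)))\<^sup>2)"
proof -
  have "((\<lambda>n. (cmod (a (n, h)))\<^sup>2) has_sum (\<Sum>\<^sub>\<infinity>n. (cmod (a (n, h)))\<^sup>2)) UNIV" for h
    using ell2_slice[OF assms, of h] by (simp add: ell2_def)
  then have "((\<lambda>x. (cmod (a x))\<^sup>2) has_sum (\<Sum>h\<in>UNIV. \<Sum>\<^sub>\<infinity>n. (cmod (a (n, h)))\<^sup>2)) UNIV"
    by (rule slice_has_sum)
  then show ?thesis
    by (simp add: ell2_norm_def infsum_nonneg sum_nonneg infsumI)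
qed

lemma ell2_slice_norm_le:
  fixes a :: "'n \<times> 'h::finite \<Rightarrow> complex"
  assumes "a \<in> ell2"
  shows "(ell2_norm (\<lambda>n. a (n, h)))\<^sup>2 \<le> (ell2_norm a)\<^sup>2"
  unfolding ell2_norm_prod[OF assms] by (rule member_le_sum) auto

lemma ell2_inner_prod:
  fixes a b :: "'n \<times> 'h::finite \<Rightarrow> complex"
  assumes "a \<in> ell2" "b \<in> ell2"
  shows "ell2_inner a b = (\<Sum>h\<in>UNIV. ell2_inner (\<lambda>n. a (n, h)) (\<lambda>n. b (n, h)))"
proof -
  have "((\<lambda>n. a (n, h) * cnj (b (n, h))) has_sum ell2_inner (\<lambda>n. a (n, h)) (\<lambda>n. b (n, h))) UNIV" for h
  proof -
    have "integrable (count_space UNIV) (\<lambda>n. a (n, h) * cnj (b (n, h)))"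
      using ell2_slice[OF assms(1), of h] ell2_slice[OF assms(2), of h]
      by (intro L2_mult_integrable L2_cnj) (simp_all add: ell2_iff_L2)
    then have "(\<lambda>n. cmod (a (n, h) * cnj (b (n, h)))) summable_on UNIV"
      by (rule iffD2[OF abs_summable_equivalent, unfolded abs_summable_on_def])
    then show ?thesis
      unfolding ell2_inner_def by (rule has_sum_infsum[OF abs_summable_summable])
  qed
  then show ?thesis
    unfolding ell2_inner_def[of a] by (rule infsumI[OF slice_has_sum])
qed

lemma transfer_vector_nth: "transfer_vector M a \<xi> $ h = fourier M (\<lambda>n. a (n, h)) \<xi>"
  by (simp add: transfer_vector_def)

lemma AE_vec_eq_iff: "(AE \<xi> in M. u \<xi> = (v \<xi> :: complex^'h)) \<longleftrightarrow> (\<forall>h. AE \<xi> in M. u \<xi> $ h = v \<xi> $ h)"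
proof -
  have "(AE \<xi> in M. u \<xi> = v \<xi>) \<longleftrightarrow> (AE \<xi> in M. \<forall>h\<in>UNIV. u \<xi> $ h = v \<xi> $ h)"
    by (simp add: vec_eq_iff)
  also have "\<dots> \<longleftrightarrow> (\<forall>h\<in>UNIV. AE \<xi> in M. u \<xi> $ h = v \<xi> $ h)"
    by (rule AE_finite_all) simp
  finally show ?thesis by simp
qed

section \<open>Unitarity of the transfer vector map\<close>

context
  fixes M :: "('n::ab_group_add \<Rightarrow> complex) measure"
  assumes haar: "dual_haar_measure M"
begin

lemma transfer_vector_L2:
  fixes a :: "'n \<times> 'h::finite \<Rightarrow> complex"
  shows "a \<in> ell2 \<Longrightarrow> (\<lambda>\<xi>. transfer_vector M a \<xi> $ h) \<in> L2 M"
  by (simp add: transfer_vector_nth fourier_L2[OF haar] ell2_slice)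

lemma L2_vec_norm_integrable:
  fixes p :: "('n \<Rightarrow> complex) \<Rightarrow> complex^'h"
  assumes "\<And>h. (\<lambda>\<xi>. p \<xi> $ h) \<in> L2 M"
  shows "integrable M (\<lambda>\<xi>. (norm (p \<xi>))\<^sup>2)" "(\<integral>\<xi>. (norm (p \<xi>))\<^sup>2 \<partial>M) = (\<Sum>h\<in>UNIV. \<integral>\<xi>. (cmod (p \<xi> $ h))\<^sup>2 \<partial>M)"
  unfolding vec_norm_sq using L2_integrable[OF assms] by auto

lemma transfer_vector_norm:
  fixes a :: "'n \<times> 'h::finite \<Rightarrow> complex"
  assumes "a \<in> ell2"
  shows "(\<integral>\<xi>. (norm (transfer_vector M a \<xi>))\<^sup>2 \<partial>M) = (ell2_norm a)\<^sup>2"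
  unfolding L2_vec_norm_integrable(2)[OF transfer_vector_L2[OF assms]] transfer_vector_nth ell2_norm_prod[OF assms]
  using ell2_slice[OF assms]
  by (simp add: fourier_coeff_parseval[OF haar] fourier_L2[OF haar] fourier_coeff_fourier[OF haar])

lemma transfer_vector_inner:
  fixes a b :: "'n \<times> 'h::finite \<Rightarrow> complex"
  assumes "a \<in> ell2" "b \<in> ell2"
  shows "(\<Sum>h\<in>UNIV. \<integral>\<xi>. transfer_vector M a \<xi> $ h * cnj (transfer_vector M b \<xi> $ h) \<partial>M) = ell2_inner a b"
  unfolding transfer_vector_nth ell2_inner_prod[OF assms]
  using ell2_slice[OF assms(1)] ell2_slice[OF assms(2)] by (simp add: fourier_inner[OF haar])

lemma transfer_vector_eqI:
  fixes a :: "'n \<times> 'h::finite \<Rightarrow> complex"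
  assumes "\<And>h. (\<lambda>\<xi>. p \<xi> $ h) \<in> L2 M" "\<And>n h. fourier_coeff M (\<lambda>\<xi>. p \<xi> $ h) n = a (n, h)"
  shows "a \<in> ell2" "AE \<xi> in M. transfer_vector M a \<xi> = p \<xi>"
proof -
  have eq: "fourier_coeff M (\<lambda>\<xi>. p \<xi> $ h) = (\<lambda>n. a (n, h))" for h
    using assms(2) by auto
  show "a \<in> ell2"
    unfolding ell2_prod_iff eq[symmetric] using fourier_coeff_ell2[OF haar assms(1)] by blast
  show "AE \<xi> in M. transfer_vector M a \<xi> = p \<xi>"
    unfolding AE_vec_eq_iff transfer_vector_nth using fourier_eqI[OF haar assms(1) eq] by blast
qed

lemma transfer_vector_surj:
  fixes p :: "('n \<Rightarrow> complex) \<Rightarrow> complex^'h"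
  assumes "\<And>h. (\<lambda>\<xi>. p \<xi> $ h) \<in> L2 M"
  obtains a where "a \<in> ell2" "AE \<xi> in M. transfer_vector M a \<xi> = p \<xi>"
  using transfer_vector_eqI[of p "\<lambda>(n, h). fourier_coeff M (\<lambda>\<xi>. p \<xi> $ h) n"] assms by auto

lemma transfer_vector_inject:
  fixes a b :: "'n \<times> 'h::finite \<Rightarrow> complex"
  assumes "a \<in> ell2" "b \<in> ell2" "AE \<xi> in M. transfer_vector M a \<xi> = transfer_vector M b \<xi>"
  shows "a = b"
proof
  fix x :: "'n \<times> 'h"
  obtain n h where x: "x = (n, h)" by (cases x)
  have "AE \<xi> in M. fourier M (\<lambda>n. a (n, h)) \<xi> = fourier M (\<lambda>n. b (n, h)) \<xi>"
    using assms(3) unfolding AE_vec_eq_iff transfer_vector_nth by blast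
  then have "fourier_coeff M (fourier M (\<lambda>n. a (n, h))) n = fourier_coeff M (fourier M (\<lambda>n. b (n, h))) n"
    by (rule fourier_coeff_cong_AE[OF haar]) (simp_all add: L2_measurable fourier_L2[OF haar] ell2_slice assms)
  then show "a x = b x"
    by (simp add: fourier_coeff_fourier[OF haar] ell2_slice assms x)
qed

lemma transfer_vector_add:
  fixes a b :: "'n \<times> 'h::finite \<Rightarrow> complex"
  shows "a \<in> ell2 \<Longrightarrow> b \<in> ell2 \<Longrightarrow> AE \<xi> in M. transfer_vector M (\<lambda>x. a x + b x) \<xi> = transfer_vector M a \<xi> + transfer_vector M b \<xi>"
  unfolding AE_vec_eq_iff vector_add_component transfer_vector_nth
  by (intro allI fourier_add[OF haar] ell2_slice)

lemma transfer_vector_cmult: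
  fixes a :: "'n \<times> 'h::finite \<Rightarrow> complex"
  shows "a \<in> ell2 \<Longrightarrow> AE \<xi> in M. transfer_vector M (\<lambda>x. c * a x) \<xi> = c *s transfer_vector M a \<xi>"
  unfolding AE_vec_eq_iff vector_smult_component transfer_vector_nth
  by (intro allI fourier_cmult[OF haar] ell2_slice)

lemma transfer_vector_sum:
  fixes x :: "'i \<Rightarrow> 'n \<times> 'h::finite \<Rightarrow> complex"
  assumes "finite I" "\<And>i. x i \<in> ell2"
  shows "AE \<xi> in M. transfer_vector M (\<lambda>y. \<Sum>i\<in>I. c i * x i y) \<xi> = (\<Sum>i\<in>I. c i *s transfer_vector M (x i) \<xi>)"
  using assms(1)
proof (induction I rule: finite_induct)
  case empty
  show ?case
    using transfer_vector_cmult[OF ell2_zero, of 0] by simp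
next
  case (insert j I)
  have "AE \<xi> in M. transfer_vector M (\<lambda>y. c j * x j y + (\<Sum>i\<in>I. c i * x i y)) \<xi> =
      transfer_vector M (\<lambda>y. c j * x j y) \<xi> + transfer_vector M (\<lambda>y. \<Sum>i\<in>I. c i * x i y) \<xi>"
    by (intro transfer_vector_add ell2_cmult ell2_sum assms(2))
  then show ?case
    using insert.IH transfer_vector_cmult[OF assms(2), of "c j" j]
    by eventually_elim (use insert.hyps in simp)
qed

lemma transfer_vector_shift:
  fixes a b :: "'n \<times> 'h::finite \<Rightarrow> complex"
  assumes "a \<in> ell2" "\<And>n h. b (n, h) = a (n - m, h)"
  shows "AE \<xi> in M. transfer_vector M b \<xi> = \<xi> (- m) *s transfer_vector M a \<xi>"
  unfolding AE_vec_eq_iff vector_smult_component transfer_vector_nth assms(2)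
  by (intro allI fourier_shift[OF haar] ell2_slice assms(1))

lemma transfer_vector_unit:
  "AE \<xi> in M. transfer_vector M (ell2_unit (m, l :: 'h::finite)) \<xi> = \<xi> (- m) *s axis l 1"
  unfolding AE_vec_eq_iff transfer_vector_nth
proof
  fix h :: 'h
  have "(\<lambda>n. ell2_unit (m, l) (n, h)) = (\<lambda>n. if n = m then (if h = l then 1 else 0) else 0)"
    by (auto simp: ell2_unit_def)
  then show "AE \<xi> in M. fourier M (\<lambda>n. ell2_unit (m, l) (n, h)) \<xi> = (\<xi> (- m) *s axis l 1) $ h"
    using fourier_unit[OF haar, of m "if h = l then 1 else 0"] by (simp add: axis_def mult.commute)
qed

text \<open>Convergence a.e. allows multiplication by a matrix function with possibly unbounded
  entries to be carried to the limit.\<close>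

lemma transfer_vector_AE_tendsto:
  fixes a :: "nat \<Rightarrow> 'n \<times> 'h::finite \<Rightarrow> complex"
  assumes a: "\<And>k. a k \<in> ell2" "b \<in> ell2" and le: "\<And>k. (ell2_norm (\<lambda>x. a k x - b x))\<^sup>2 \<le> C * (1/4) ^ k"
  shows "AE \<xi> in M. (\<lambda>k. transfer_vector M (a k) \<xi>) \<longlonglongrightarrow> transfer_vector M b \<xi>"
proof -
  have "AE \<xi> in M. (\<lambda>k. transfer_vector M (a k) \<xi> $ h) \<longlonglongrightarrow> transfer_vector M b \<xi> $ h" for h
  proof (rule L2_AE_tendsto)
    fix k
    note L2 = fourier_L2[OF haar ell2_slice[OF a(1)], of k h] fourier_L2[OF haar ell2_slice[OF a(2)], of h]
    have "fourier_coeff M (\<lambda>\<xi>. transfer_vector M (a k) \<xi> $ h - transfer_vector M b \<xi> $ h) = (\<lambda>n. a k (n, h) - b (n, h))"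
      unfolding transfer_vector_nth
      by (simp add: fourier_coeff_diff[OF haar L2, abs_def] fourier_coeff_fourier[OF haar] ell2_slice a)
    then have "(\<integral>\<xi>. (norm (transfer_vector M (a k) \<xi> $ h - transfer_vector M b \<xi> $ h))\<^sup>2 \<partial>M) =
        (ell2_norm (\<lambda>n. a k (n, h) - b (n, h)))\<^sup>2"
      by (simp add: fourier_coeff_parseval[OF haar] L2_diff transfer_vector_L2 a)
    also have "\<dots> \<le> C * (1/4) ^ k"
      using ell2_slice_norm_le[OF ell2_diff[OF a(1) a(2)], of k h] le[of k] by simp
    finally show "(\<integral>\<xi>. (norm (transfer_vector M (a k) \<xi> $ h - transfer_vector M b \<xi> $ h))\<^sup>2 \<partial>M) \<le> C * (1/4) ^ k" .
  qed (intro transfer_vector_L2 a)+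
  then have "AE \<xi> in M. \<forall>h\<in>UNIV. (\<lambda>k. transfer_vector M (a k) \<xi> $ h) \<longlonglongrightarrow> transfer_vector M b \<xi> $ h"
    by (subst AE_finite_all) auto
  then show ?thesis
    by eventually_elim (auto intro: vec_tendstoI)
qed

section \<open>Multiplication by a matrix-valued function\<close>

text \<open>
  The two Riesz bounds \<open>A\<close> and \<open>B\<close> are the cases \<open>(\<alpha>, \<beta>) = (- A, 1)\<close> and \<open>(\<alpha>, \<beta>) = (B, - 1)\<close>.
  A pointwise violation for a fixed vector \<open>v\<close> on a set \<open>E\<close> is detected by the function
  \<open>\<one>\<^sub>E v\<close>; countably many vectors suffice by density.
\<close>

lemma multiplier_form_iff:
  fixes F :: "('n \<Rightarrow> complex) \<Rightarrow> complex^('h::finite)^'h" and S :: "('n \<times> 'h \<Rightarrow> complex) \<Rightarrow> 'n \<times> 'h \<Rightarrow> complex"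
  assumes F: "\<And>h l. (\<lambda>\<xi>. F \<xi> $ h $ l) \<in> borel_measurable M"
    and S: "\<And>a. a \<in> ell2 \<Longrightarrow> S a \<in> ell2"
      "\<And>a. a \<in> ell2 \<Longrightarrow> AE \<xi> in M. transfer_vector M (S a) \<xi> = F \<xi> *v transfer_vector M a \<xi>"
  shows "(\<forall>a\<in>ell2. 0 \<le> \<alpha> * (ell2_norm a)\<^sup>2 + \<beta> * (ell2_norm (S a))\<^sup>2) \<longleftrightarrow>
    (AE \<xi> in M. \<forall>v. 0 \<le> \<alpha> * (norm v)\<^sup>2 + \<beta> * (norm (F \<xi> *v v))\<^sup>2)"
proof -
  have int: "integrable M (\<lambda>\<xi>. (norm (transfer_vector M a \<xi>))\<^sup>2)" if "a \<in> ell2" for a :: "'n \<times> 'h \<Rightarrow> complex"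
    using that by (intro L2_vec_norm_integrable transfer_vector_L2)
  have meas: "(\<lambda>\<xi>. (norm (transfer_vector M a \<xi>))\<^sup>2) \<in> borel_measurable M" if "a \<in> ell2" for a :: "'n \<times> 'h \<Rightarrow> complex"
    using int[OF that] by simp
  have form: "\<alpha> * (ell2_norm a)\<^sup>2 + \<beta> * (ell2_norm (S a))\<^sup>2 =
      (\<integral>\<xi>. \<alpha> * (norm (transfer_vector M a \<xi>))\<^sup>2 + \<beta> * (norm (transfer_vector M (S a) \<xi>))\<^sup>2 \<partial>M)" if "a \<in> ell2" for a
    using int[OF that] int[OF S(1)[OF that]]
    by (simp add: transfer_vector_norm[symmetric] that S(1))
  show ?thesis
  proof
    assume AE: "AE \<xi> in M. \<forall>v. 0 \<le> \<alpha> * (norm v)\<^sup>2 + \<beta> * (norm (F \<xi> *v v))\<^sup>2"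
    show "\<forall>a\<in>ell2. 0 \<le> \<alpha> * (ell2_norm a)\<^sup>2 + \<beta> * (ell2_norm (S a))\<^sup>2"
    proof
      fix a :: "'n \<times> 'h \<Rightarrow> complex" assume a: "a \<in> ell2"
      show "0 \<le> \<alpha> * (ell2_norm a)\<^sup>2 + \<beta> * (ell2_norm (S a))\<^sup>2"
        unfolding form[OF a]
        by (rule integral_nonneg_AE) (use AE S(2)[OF a] in eventually_elim, simp)
    qed
  next
    assume nonneg: "\<forall>a\<in>ell2. 0 \<le> \<alpha> * (ell2_norm a)\<^sup>2 + \<beta> * (ell2_norm (S a))\<^sup>2"
    let ?q = "\<lambda>v \<xi>. \<alpha> * (norm v)\<^sup>2 + \<beta> * (norm (F \<xi> *v v))\<^sup>2"
    have q_meas[measurable]: "?q v \<in> borel_measurable M" for v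
      unfolding vec_norm_sq matrix_vector_mult_def vec_lambda_beta using F by measurable
    have pointwise: "AE \<xi> in M. 0 \<le> ?q v \<xi>" for v
    proof -
      define E where "E = {\<xi> \<in> space M. ?q v \<xi> < 0}"
      have [measurable]: "E \<in> sets M"
        unfolding E_def by measurable
      have "(\<lambda>\<xi>. (complex_of_real (indicator E \<xi>) *s v) $ h) \<in> L2 M" for h
      proof -
        have "(\<lambda>_. v $ h) \<in> L2 M"
          using haar_prob[OF haar] by (auto intro!: L2_I finite_measure.integrable_const prob_space.finite_measure)
        moreover have "AE \<xi> in M. cmod (complex_of_real (indicator E \<xi>)) \<le> 1"
          by (simp add: indicator_def)
        ultimately show ?thesis
          unfolding vector_smult_component by (intro L2_bounded_mult) measurable
      qed
      then obtain a where a: "a \<in> ell2" "AE \<xi> in M. transfer_vector M a \<xi> = complex_of_real (indicator E \<xi>) *s v"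
        using transfer_vector_surj[of "\<lambda>\<xi>. complex_of_real (indicator E \<xi>) *s v"] by blast
      \<comment> \<open>The size of the violation, supported on \<open>E\<close> and nonnegative
        there. It is integrable because a.e. it is the negative of the form evaluated on the
        transforms of \<open>a\<close> and \<open>S a\<close>; this matters since \<open>F\<close>
        is only known to be measurable.\<close>
      define u where "u \<xi> = indicator E \<xi> * - ?q v \<xi>" for \<xi>
      have [measurable]: "u \<in> borel_measurable M"
        unfolding u_def by measurable
      have eq: "AE \<xi> in M. \<alpha> * (norm (transfer_vector M a \<xi>))\<^sup>2 + \<beta> * (norm (transfer_vector M (S a) \<xi>))\<^sup>2 = - u \<xi>"
        using a(2) S(2)[OF a(1)]
      proof eventually_elim
        case (elim \<xi>)
        show ?case
          unfolding elim u_def by (cases "\<xi> \<in> E") simp_all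
      qed
      have iu: "integrable M u"
      proof -
        have "integrable M (\<lambda>\<xi>. \<alpha> * (norm (transfer_vector M a \<xi>))\<^sup>2 + \<beta> * (norm (transfer_vector M (S a) \<xi>))\<^sup>2)"
          using int a(1) S(1) by simp
        then have "integrable M (\<lambda>\<xi>. - u \<xi>)"
          by (rule integrable_cong_AE_imp) (use eq in \<open>auto elim: eventually_mono\<close>)
        then show ?thesis
          using Bochner_Integration.integrable_minus[of M "\<lambda>\<xi>. - u \<xi>"] by simp
      qed
      have "0 \<le> (\<integral>\<xi>. - u \<xi> \<partial>M)"
      proof -
        have "(\<integral>\<xi>. - u \<xi> \<partial>M) = \<alpha> * (ell2_norm a)\<^sup>2 + \<beta> * (ell2_norm (S a))\<^sup>2"
          unfolding form[OF a(1)]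
          by (rule integral_cong_AE) (use eq meas a(1) S(1) in \<open>auto elim!: eventually_mono\<close>)
        then show ?thesis
          using nonneg a(1) by simp
      qed
      then have "(\<integral>\<xi>. u \<xi> \<partial>M) \<le> 0"
        by simp
      moreover have u_nonneg: "0 \<le> u \<xi>" for \<xi>
        by (auto simp: u_def E_def indicator_def)
      ultimately have "(\<integral>\<xi>. u \<xi> \<partial>M) = 0"
        by (intro antisym Bochner_Integration.integral_nonneg) auto
      then have "AE \<xi> in M. u \<xi> = 0"
        using u_nonneg iu by (subst (asm) integral_nonneg_eq_0_iff_AE) auto
      then show ?thesis
        using AE_space by eventually_elim (auto simp: u_def E_def indicator_def split: if_splits)
    qed
    obtain D :: "(complex^'h) set" where D: "countable D" "\<And>X. open X \<Longrightarrow> X \<noteq> {} \<Longrightarrow> \<exists>d\<in>D. d \<in> X"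
      using countable_dense_setE by blast
    have "AE \<xi> in M. \<forall>d\<in>D. 0 \<le> ?q d \<xi>"
      using pointwise D(1) by (simp add: AE_ball_countable)
    then show "AE \<xi> in M. \<forall>v. 0 \<le> ?q v \<xi>"
    proof eventually_elim
      case (elim \<xi>)
      have "closed {v. 0 \<le> ?q v \<xi>}"
        by (intro closed_Collect_le continuous_intros linear_continuous_on matrix_vector_linear[unfolded linear_conv_bounded_linear])
      then show ?case
        using dense_forall_vec[OF D(2)] elim by blast
    qed
  qed
qed

end

section \<open>The left regular representation\<close>

context
  fixes \<sigma> :: "'h::group_add \<Rightarrow> 'n::ab_group_add \<Rightarrow> 'n"
  assumes action: "aut_action \<sigma>"
begin

lemma action_simps: "\<sigma> h (m + n) = \<sigma> h m + \<sigma> h n" "\<sigma> (h + l) n = \<sigma> h (\<sigma> l n)" "\<sigma> h 0 = 0" "\<sigma> 0 n = n"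
    "\<sigma> h (- n) = - \<sigma> h n" "\<sigma> h (m - n) = \<sigma> h m - \<sigma> h n"
proof -
  show add: "\<sigma> h (m + n) = \<sigma> h m + \<sigma> h n" and "\<sigma> (h + l) n = \<sigma> h (\<sigma> l n)" for m n
    using action by (auto simp: aut_action_def)
  show zero: "\<sigma> h 0 = 0" "\<sigma> 0 n = n"
    by (simp_all add: aut_action_zero[OF action])
  show neg: "\<sigma> h (- n) = - \<sigma> h n" for n
    using add[of n "- n"] zero by (simp add: eq_neg_iff_add_eq_0 add.commute)
  show "\<sigma> h (m - n) = \<sigma> h m - \<sigma> h n"
    using add[of m "- n"] neg by simp
qed

lemma left_reg_translate: "left_reg \<sigma> (m, l) f (n, h) = left_reg \<sigma> (0, l) f (n - m, h)"
  by (simp add: left_reg_def action_simps)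

lemma left_reg_one: "left_reg \<sigma> (0, 0) f = f"
  by (auto simp: left_reg_def fun_eq_iff action_simps)

lemma sd_mult_bij: "bij (sd_mult \<sigma> \<gamma>)"
proof (rule o_bij)
  show "sd_mult \<sigma> (sd_inv \<sigma> \<gamma>) \<circ> sd_mult \<sigma> \<gamma> = id" "sd_mult \<sigma> \<gamma> \<circ> sd_mult \<sigma> (sd_inv \<sigma> \<gamma>) = id"
    by (auto simp: fun_eq_iff sd_mult_assoc[OF action, symmetric] sd_mult_inv[OF action] sd_mult_one[OF action])
qed

lemma left_reg_ell2: "f \<in> ell2 \<Longrightarrow> left_reg \<sigma> \<gamma> f \<in> ell2"
  unfolding ell2_def left_reg_def mem_Collect_eq
  by (subst summable_on_reindex_bij_betw[OF sd_mult_bij, where f = "\<lambda>x. (cmod (f x))\<^sup>2"])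

lemma left_reg_inner: "ell2_inner (left_reg \<sigma> \<gamma> f) (left_reg \<sigma> \<gamma> g) = ell2_inner f g"
  unfolding ell2_inner_def left_reg_def
  by (rule infsum_reindex_bij_betw[OF sd_mult_bij, where f = "\<lambda>x. f x * cnj (g x)"])

lemma sd_mult_inv_cancel: "sd_mult \<sigma> (sd_inv \<sigma> \<gamma>) (sd_mult \<sigma> \<gamma> \<delta>) = \<delta>"
  by (simp only: sd_mult_assoc[OF action, symmetric] sd_mult_inv[OF action] sd_mult_one[OF action])

lemma left_reg_mult: "left_reg \<sigma> (sd_mult \<sigma> \<gamma> \<delta>) f = left_reg \<sigma> \<gamma> (left_reg \<sigma> \<delta> f)"
proof
  fix \<eta>
  have "sd_inv \<sigma> (sd_mult \<sigma> \<gamma> \<delta>) = sd_mult \<sigma> (sd_inv \<sigma> \<delta>) (sd_inv \<sigma> \<gamma>)"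
  proof -
    have "sd_mult \<sigma> (sd_mult \<sigma> \<gamma> \<delta>) (sd_mult \<sigma> (sd_inv \<sigma> \<delta>) (sd_inv \<sigma> \<gamma>)) =
        sd_mult \<sigma> (sd_mult \<sigma> \<gamma> (sd_mult \<sigma> \<delta> (sd_inv \<sigma> \<delta>))) (sd_inv \<sigma> \<gamma>)"
      by (simp only: sd_mult_assoc[OF action])
    also have "\<dots> = (0, 0)"
      by (simp only: sd_mult_inv[OF action] sd_mult_one[OF action])
    finally have "sd_mult \<sigma> (sd_inv \<sigma> (sd_mult \<sigma> \<gamma> \<delta>)) (sd_mult \<sigma> (sd_mult \<sigma> \<gamma> \<delta>) (sd_mult \<sigma> (sd_inv \<sigma> \<delta>) (sd_inv \<sigma> \<gamma>))) =
        sd_mult \<sigma> (sd_inv \<sigma> (sd_mult \<sigma> \<gamma> \<delta>)) (0, 0)"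
      by (rule arg_cong)
    then show ?thesis
      by (simp only: sd_mult_inv_cancel sd_mult_one[OF action])
  qed
  then show "left_reg \<sigma> (sd_mult \<sigma> \<gamma> \<delta>) f \<eta> = left_reg \<sigma> \<gamma> (left_reg \<sigma> \<delta> f) \<eta>"
    by (simp only: left_reg_def sd_mult_assoc[OF action])
qed

text \<open>Invariance of the inner product moves \<open>\<delta>\<close> to the other side, so
  biorthogonality has to be verified only against \<open>g\<close> itself.\<close>

lemma left_reg_inner_left: "ell2_inner (left_reg \<sigma> \<gamma> f) (left_reg \<sigma> \<delta> g) = ell2_inner (left_reg \<sigma> (sd_mult \<sigma> (sd_inv \<sigma> \<delta>) \<gamma>) f) g"
proof -
  have "left_reg \<sigma> \<gamma> f = left_reg \<sigma> \<delta> (left_reg \<sigma> (sd_mult \<sigma> (sd_inv \<sigma> \<delta>) \<gamma>) f)"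
    unfolding left_reg_mult[symmetric]
    by (simp add: sd_mult_assoc[OF action, symmetric] sd_mult_inv[OF action] sd_mult_one[OF action])
  then show ?thesis
    by (simp add: left_reg_inner)
qed

lemma sd_mult_inv_eq_one: "sd_mult \<sigma> (sd_inv \<sigma> \<delta>) \<gamma> = (0, 0) \<longleftrightarrow> \<gamma> = \<delta>"
proof
  assume "sd_mult \<sigma> (sd_inv \<sigma> \<delta>) \<gamma> = (0, 0)"
  then have "sd_mult \<sigma> \<delta> (sd_mult \<sigma> (sd_inv \<sigma> \<delta>) \<gamma>) = \<delta>"
    by (simp add: sd_mult_one[OF action])
  then show "\<gamma> = \<delta>"
    by (simp add: sd_mult_assoc[OF action, symmetric] sd_mult_inv[OF action] sd_mult_one[OF action])
qed (simp add: sd_mult_inv[OF action])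

end

section \<open>Invertible multipliers\<close>

text \<open>The constants may be any real numbers, as in \<open>riesz_bounds\<close>; positivity of
  \<open>c\<close> is added where invertibility is at stake.\<close>

definition matrix_bounds :: "real \<Rightarrow> real \<Rightarrow> complex^'m^'n \<Rightarrow> bool" where
  "matrix_bounds c C A \<longleftrightarrow> (\<forall>v. c * (norm v)\<^sup>2 \<le> (norm (A *v v))\<^sup>2 \<and> (norm (A *v v))\<^sup>2 \<le> C * (norm v)\<^sup>2)"

lemma matrix_bounds_mono: "matrix_bounds c C A \<Longrightarrow> c' \<le> c \<Longrightarrow> C \<le> C' \<Longrightarrow> matrix_bounds c' C' A"
  unfolding matrix_bounds_def by (meson mult_right_mono order_trans zero_le_power2)

lemma matrix_bounds_invertible:
  fixes A :: "complex^'h^'h"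
  assumes "matrix_bounds c C A" "0 < c"
  shows "det A \<noteq> 0" "invertible A"
proof -
  have "0 < 1 / (perm_count TYPE('h) * sqrt (1 / c) ^ CARD('h))"
    using perm_count_pos[where 'h = 'h] \<open>0 < c\<close> by simp
  also have "\<dots> \<le> cmod (det A)"
    using assms by (intro det_lower_bound) (auto simp: matrix_bounds_def)
  finally show "det A \<noteq> 0" by simp
  then show "invertible A"
    by (simp add: invertible_det_nz)
qed

lemma matrix_bounds_inverse:
  fixes A B :: "complex^'h^'h"
  assumes A: "matrix_bounds c C A" "0 < c" "0 < C" and AB: "A ** B = mat 1"
  shows "matrix_bounds (1 / C) (1 / c) B"
  unfolding matrix_bounds_def
proof (intro allI conjI)
  fix v
  have "A *v (B *v v) = v"
    by (simp add: matrix_vector_mul_assoc AB)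
  then show "1 / C * (norm v)\<^sup>2 \<le> (norm (B *v v))\<^sup>2" "(norm (B *v v))\<^sup>2 \<le> 1 / c * (norm v)\<^sup>2"
    using A(1)[unfolded matrix_bounds_def, rule_format, of "B *v v"] A(2,3) by (simp_all add: field_simps)
qed

lemma det_measurable:
  fixes A :: "'x \<Rightarrow> complex^'h^'h"
  assumes [measurable]: "\<And>h l. (\<lambda>x. A x $ h $ l) \<in> borel_measurable M"
  shows "(\<lambda>x. det (A x)) \<in> borel_measurable M"
  unfolding det_def by measurable

text \<open>In each direction the new constants depend only on the given ones and the dimension, so
  the pointwise matrix estimates become uniform a.e.\<close>

lemma AE_matrix_bounds_iff:
  fixes F :: "'x \<Rightarrow> complex^'h^'h"
  shows "(\<exists>c>0. \<exists>C. AE x in M. matrix_bounds c C (F x)) \<longleftrightarrow>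
    (\<exists>d>0. \<exists>K. AE x in M. d \<le> cmod (det (F x)) \<and> (\<forall>h l. cmod (F x $ h $ l) \<le> K))"
proof
  assume "\<exists>c>0. \<exists>C. AE x in M. matrix_bounds c C (F x)"
  then obtain c C where c: "0 < c" and AE: "AE x in M. matrix_bounds c C (F x)"
    by blast
  let ?d = "1 / (perm_count TYPE('h) * sqrt (1 / c) ^ CARD('h))"
  have "0 < ?d"
    using perm_count_pos[where 'h = 'h] c by simp
  moreover have "AE x in M. ?d \<le> cmod (det (F x)) \<and> (\<forall>h l. cmod (F x $ h $ l) \<le> sqrt C)"
    using AE
  proof eventually_elim
    case (elim x)
    then show ?case
      using c unfolding matrix_bounds_def by (auto intro!: det_lower_bound matrix_entry_bound)
  qed
  ultimately show "\<exists>d>0. \<exists>K. AE x in M. d \<le> cmod (det (F x)) \<and> (\<forall>h l. cmod (F x $ h $ l) \<le> K)"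
    by blast
next
  assume "\<exists>d>0. \<exists>K. AE x in M. d \<le> cmod (det (F x)) \<and> (\<forall>h l. cmod (F x $ h $ l) \<le> K)"
  then obtain d K where d: "0 < d" and AE: "AE x in M. d \<le> cmod (det (F x)) \<and> (\<forall>h l. cmod (F x $ h $ l) \<le> K)"
    by blast
  obtain c where c: "0 < c" "\<And>(A :: complex^'h^'h) x. (\<And>h l. cmod (A $ h $ l) \<le> K) \<Longrightarrow> d \<le> cmod (det A) \<Longrightarrow> c * (norm x)\<^sup>2 \<le> (norm (A *v x))\<^sup>2"
    using matrix_lower_bound[OF d, where 'h = 'h and K = K] by blast
  have "AE x in M. matrix_bounds c ((real CARD('h) * real CARD('h) * K)\<^sup>2) (F x)"
    using AE
  proof eventually_elim
    case (elim x)
    then show ?case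
      unfolding matrix_bounds_def by (auto intro!: c(2) matrix_norm_bound)
  qed
  with c(1) show "\<exists>c>0. \<exists>C. AE x in M. matrix_bounds c C (F x)"
    by blast
qed

text \<open>The bounds are expressed by determinant and entries, for which invariance under
  conjugate transposition is evident.\<close>

lemma AE_matrix_bounds_conj_transpose:
  fixes F :: "'x \<Rightarrow> complex^'h^'h"
  assumes "\<exists>c>0. \<exists>C. AE x in M. matrix_bounds c C (F x)"
  shows "\<exists>c>0. \<exists>C. AE x in M. matrix_bounds c C (conj_transpose (F x))"
proof -
  obtain d K where "0 < d" "AE x in M. d \<le> cmod (det (F x)) \<and> (\<forall>h l. cmod (F x $ h $ l) \<le> K)"
    using assms unfolding AE_matrix_bounds_iff by blast
  then show ?thesis
    unfolding AE_matrix_bounds_iff det_conj_transpose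
    by (intro exI[of _ d] exI[of _ K] conjI) (auto simp: conj_transpose_def)
qed

context
  fixes M :: "('n::ab_group_add \<Rightarrow> complex) measure"
  assumes haar: "dual_haar_measure M"
begin

lemma AE_matrix_bounds_multiplier_iff:
  fixes F :: "('n \<Rightarrow> complex) \<Rightarrow> complex^('h::finite)^'h" and S :: "('n \<times> 'h \<Rightarrow> complex) \<Rightarrow> 'n \<times> 'h \<Rightarrow> complex"
  assumes F: "\<And>h l. (\<lambda>\<xi>. F \<xi> $ h $ l) \<in> borel_measurable M"
    and S: "\<And>a. a \<in> ell2 \<Longrightarrow> S a \<in> ell2"
      "\<And>a. a \<in> ell2 \<Longrightarrow> AE \<xi> in M. transfer_vector M (S a) \<xi> = F \<xi> *v transfer_vector M a \<xi>"
  shows "(AE \<xi> in M. matrix_bounds A B (F \<xi>)) \<longleftrightarrow>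
    (\<forall>a\<in>ell2. A * (ell2_norm a)\<^sup>2 \<le> (ell2_norm (S a))\<^sup>2 \<and> (ell2_norm (S a))\<^sup>2 \<le> B * (ell2_norm a)\<^sup>2)"
  using multiplier_form_iff[OF haar F S, of "- A" 1] multiplier_form_iff[OF haar F S, of B "- 1"]
  unfolding matrix_bounds_def by (simp add: all_conj_distrib ball_conj_distrib)

text \<open>The upper bound keeps the product of \<open>F\<close> with a transfer vector
  square-integrable, so multiplication by \<open>F\<close> can be transported to
  \<open>ell2\<close>; the lower bound does the same for the pointwise solutions of
  \<open>F \<xi> *v p \<xi> = transfer_vector M b \<xi>\<close> and gives surjectivity.\<close>

lemma multiplier_invertible:
  fixes F :: "('n \<Rightarrow> complex) \<Rightarrow> complex^('h::finite)^'h"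
  assumes F[measurable]: "\<And>h l. (\<lambda>\<xi>. F \<xi> $ h $ l) \<in> borel_measurable M"
    and "0 < c" and AE: "AE \<xi> in M. matrix_bounds c C (F \<xi>)"
  obtains S where "ell2_bounded_invertible S"
    "\<And>a :: 'n \<times> 'h \<Rightarrow> complex. a \<in> ell2 \<Longrightarrow> AE \<xi> in M. transfer_vector M (S a) \<xi> = F \<xi> *v transfer_vector M a \<xi>"
proof -
  \<comment> \<open>A common criterion for products and preimages: measurable components and a
    pointwise bound by a known transfer vector, with constant \<open>C\<close> for products and
    \<open>1 / c\<close> for preimages.\<close>
  have vec_L2: "(\<lambda>\<xi>. p \<xi> $ h) \<in> L2 M"
    if "\<And>h. (\<lambda>\<xi>. p \<xi> $ h) \<in> borel_measurable M" "b \<in> ell2" "AE \<xi> in M. (norm (p \<xi>))\<^sup>2 \<le> K * (norm (transfer_vector M b \<xi>))\<^sup>2"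
    for p :: "('n \<Rightarrow> complex) \<Rightarrow> complex^'h" and b :: "'n \<times> 'h \<Rightarrow> complex" and K h
  proof (rule L2_dominated[OF that(1)])
    show "integrable M (\<lambda>\<xi>. K * (norm (transfer_vector M b \<xi>))\<^sup>2)"
      using L2_vec_norm_integrable(1)[OF haar transfer_vector_L2[OF haar that(2)]] by simp
    show "AE \<xi> in M. (norm (p \<xi> $ h))\<^sup>2 \<le> K * (norm (transfer_vector M b \<xi>))\<^sup>2"
      using that(3)
    proof eventually_elim
      case (elim \<xi>)
      have "(norm (p \<xi> $ h))\<^sup>2 \<le> (norm (p \<xi>))\<^sup>2"
        by (intro power_mono Finite_Cartesian_Product.norm_nth_le) simp
      then show ?case
        using elim by (rule order_trans)
    qed
  qed
  have tv_meas[measurable]: "(\<lambda>\<xi>. transfer_vector M a \<xi> $ h) \<in> borel_measurable M" if "a \<in> ell2" for a :: "'n \<times> 'h \<Rightarrow> complex" and h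
    using transfer_vector_L2[OF haar that] by (rule L2_measurable)
  have "\<exists>b. b \<in> ell2 \<and> (AE \<xi> in M. transfer_vector M b \<xi> = F \<xi> *v transfer_vector M a \<xi>)" if a: "a \<in> ell2" for a :: "'n \<times> 'h \<Rightarrow> complex"
  proof -
    have "(\<lambda>\<xi>. (F \<xi> *v transfer_vector M a \<xi>) $ h) \<in> L2 M" for h
    proof (rule vec_L2[OF _ a])
      show "(\<lambda>\<xi>. (F \<xi> *v transfer_vector M a \<xi>) $ h) \<in> borel_measurable M" for h
        unfolding matrix_vector_mult_def vec_lambda_beta using a by measurable
      show "AE \<xi> in M. (norm (F \<xi> *v transfer_vector M a \<xi>))\<^sup>2 \<le> C * (norm (transfer_vector M a \<xi>))\<^sup>2"
        using AE by eventually_elim (simp add: matrix_bounds_def)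
    qed
    then show ?thesis
      using transfer_vector_surj[OF haar, of "\<lambda>\<xi>. F \<xi> *v transfer_vector M a \<xi>"] by blast
  qed
  then obtain S where S: "\<And>a :: 'n \<times> 'h \<Rightarrow> complex. a \<in> ell2 \<Longrightarrow> S a \<in> ell2"
      "\<And>a :: 'n \<times> 'h \<Rightarrow> complex. a \<in> ell2 \<Longrightarrow> AE \<xi> in M. transfer_vector M (S a) \<xi> = F \<xi> *v transfer_vector M a \<xi>"
    by metis
  have bounds: "c * (ell2_norm a)\<^sup>2 \<le> (ell2_norm (S a))\<^sup>2" "(ell2_norm (S a))\<^sup>2 \<le> C * (ell2_norm a)\<^sup>2" if "a \<in> ell2" for a
    using AE_matrix_bounds_multiplier_iff[OF F S] AE that by blast+
  have add: "S (\<lambda>x. a x + b x) = (\<lambda>x. S a x + S b x)" if ab: "a \<in> ell2" "b \<in> ell2" for a b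
  proof (rule transfer_vector_inject[OF haar])
    show "AE \<xi> in M. transfer_vector M (S (\<lambda>x. a x + b x)) \<xi> = transfer_vector M (\<lambda>x. S a x + S b x) \<xi>"
      using S(2)[OF ab(1)] S(2)[OF ab(2)] S(2)[OF ell2_add[OF ab]] transfer_vector_add[OF haar ab]
        transfer_vector_add[OF haar S(1)[OF ab(1)] S(1)[OF ab(2)]]
      by eventually_elim (simp add: matrix_vector_right_distrib)
  qed (simp_all add: S ab ell2_add)
  have cmult: "S (\<lambda>x. k * a x) = (\<lambda>x. k * S a x)" if a: "a \<in> ell2" for a k
  proof (rule transfer_vector_inject[OF haar])
    show "AE \<xi> in M. transfer_vector M (S (\<lambda>x. k * a x)) \<xi> = transfer_vector M (\<lambda>x. k * S a x) \<xi>"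
      using S(2)[OF a] S(2)[OF ell2_cmult[OF a, of k]] transfer_vector_cmult[OF haar a, of k]
        transfer_vector_cmult[OF haar S(1)[OF a], of k]
      by eventually_elim (simp add: vector_scalar_commute)
  qed (simp_all add: S a ell2_cmult)
  have "ell2_bounded_invertible S"
    unfolding ell2_bounded_invertible_def
  proof (intro conjI ballI allI add cmult)
    show "bij_betw S ell2 ell2"
      unfolding bij_betw_def
    proof
      show "inj_on S ell2"
      proof (rule inj_onI)
        fix a b assume ab: "a \<in> ell2" "b \<in> ell2" "S a = S b"
        have "AE \<xi> in M. transfer_vector M a \<xi> = transfer_vector M b \<xi>"
          using S(2)[OF ab(1)] S(2)[OF ab(2)] AE
        proof eventually_elim
          case (elim \<xi>)
          then have "F \<xi> *v (transfer_vector M a \<xi> - transfer_vector M b \<xi>) = 0"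
            using ab(3) by (simp add: matrix_vector_mult_diff_distrib)
          then have "c * (norm (transfer_vector M a \<xi> - transfer_vector M b \<xi>))\<^sup>2 \<le> 0"
            using elim(3) unfolding matrix_bounds_def by (metis norm_zero zero_power2)
          then show ?case
            using \<open>0 < c\<close> by (simp add: mult_le_0_iff)
        qed
        then show "a = b"
          by (rule transfer_vector_inject[OF haar ab(1,2)])
      qed
      have "b \<in> S ` ell2" if b: "b \<in> ell2" for b
      proof -
        \<comment> \<open>Cramer's rule gives a measurable choice of \<open>F\<^sup>-\<^sup>1 b\<close>.\<close>
        define p where "p \<xi> = (\<chi> k. det (\<chi> i j. if j = k then transfer_vector M b \<xi> $ i else F \<xi> $ i $ j) / det (F \<xi>))" for \<xi>
        have Fp: "AE \<xi> in M. F \<xi> *v p \<xi> = transfer_vector M b \<xi>"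
          using AE by eventually_elim (simp add: p_def cramer[OF matrix_bounds_invertible(1)[OF _ \<open>0 < c\<close>]])
        have "(\<lambda>\<xi>. p \<xi> $ h) \<in> L2 M" for h
        proof (rule vec_L2[OF _ b])
          fix h
          have "(\<lambda>\<xi>. det (\<chi> i j. if j = h then transfer_vector M b \<xi> $ i else F \<xi> $ i $ j)) \<in> borel_measurable M"
          proof (rule det_measurable)
            fix i l
            show "(\<lambda>\<xi>. (\<chi> i j. if j = h then transfer_vector M b \<xi> $ i else F \<xi> $ i $ j) $ i $ l) \<in> borel_measurable M"
              by (cases "l = h") (simp_all add: F tv_meas[OF b])
          qed
          then show "(\<lambda>\<xi>. p \<xi> $ h) \<in> borel_measurable M"
            unfolding p_def vec_lambda_beta by (rule borel_measurable_divide[OF _ det_measurable[OF F]])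
          show "AE \<xi> in M. (norm (p \<xi>))\<^sup>2 \<le> 1 / c * (norm (transfer_vector M b \<xi>))\<^sup>2"
            using Fp AE
          proof eventually_elim
            case (elim \<xi>)
            then show ?case
              using \<open>0 < c\<close> unfolding matrix_bounds_def by (metis mult.commute mult_1 pos_le_divide_eq times_divide_eq_left)
          qed
        qed
        then obtain a where a: "a \<in> ell2" "AE \<xi> in M. transfer_vector M a \<xi> = p \<xi>"
          using transfer_vector_surj[OF haar, of p] by blast
        have "AE \<xi> in M. transfer_vector M (S a) \<xi> = transfer_vector M b \<xi>"
          using S(2)[OF a(1)] a(2) Fp by eventually_elim simp
        then have "S a = b"
          by (rule transfer_vector_inject[OF haar S(1)[OF a(1)] b])
        then show ?thesis
          using a(1) by blast
      qed
      then show "S ` ell2 = ell2"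
        using S(1) by blast
    qed
    have "ell2_norm (S a) \<le> sqrt C * ell2_norm a" if "a \<in> ell2" for a
      using real_sqrt_le_mono[OF bounds(2)[OF that]] by (simp add: real_sqrt_mult ell2_norm_nonneg)
    then show "\<exists>C. \<forall>a\<in>ell2. ell2_norm (S a) \<le> C * ell2_norm a"
      by blast
    have "ell2_norm a \<le> 1 / sqrt c * ell2_norm (S a)" if "a \<in> ell2" for a
      using real_sqrt_le_mono[OF bounds(1)[OF that]] \<open>0 < c\<close> by (simp add: real_sqrt_mult ell2_norm_nonneg field_simps)
    then show "\<exists>C. \<forall>a\<in>ell2. ell2_norm a \<le> C * ell2_norm (S a)"
      by blast
  qed
  with S that show ?thesis by blast
qed

end

section \<open>Essential bounds\<close>

lemma esssup_le_iff:
  fixes g :: "'x \<Rightarrow> ereal"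
  assumes "g \<in> borel_measurable M"
  shows "esssup M g \<le> c \<longleftrightarrow> (AE x in M. g x \<le> c)"
proof
  assume "esssup M g \<le> c"
  then show "AE x in M. g x \<le> c"
    using esssup_AE[of g M] by (auto elim: eventually_mono)
qed (rule esssup_I[OF assms])

lemma le_essinf_iff:
  fixes g :: "'x \<Rightarrow> ereal"
  assumes "g \<in> borel_measurable M"
  shows "c \<le> essinf M g \<longleftrightarrow> (AE x in M. c \<le> g x)"
proof -
  have "c \<le> essinf M g \<longleftrightarrow> esssup M (\<lambda>x. - g x) \<le> - c"
    unfolding essinf_def using ereal_minus_le_minus[of "- c" "esssup M (\<lambda>x. - g x)"] by simp
  also have "\<dots> \<longleftrightarrow> (AE x in M. - g x \<le> - c)"
    using assms by (intro esssup_le_iff) simp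
  finally show ?thesis by simp
qed

text \<open>A real \<open>d\<close> is chosen strictly below the essential infimum, which for a
  general measure may be infinite.\<close>

lemma essinf_pos_iff:
  fixes g :: "'x \<Rightarrow> real"
  assumes [measurable]: "g \<in> borel_measurable M"
  shows "0 < essinf M (\<lambda>x. ereal (g x)) \<longleftrightarrow> (\<exists>d>0. AE x in M. d \<le> g x)"
proof
  assume "0 < essinf M (\<lambda>x. ereal (g x))"
  then obtain d where d: "0 < ereal d" "ereal d < essinf M (\<lambda>x. ereal (g x))"
    using ereal_dense2 by blast
  then have "AE x in M. ereal d \<le> ereal (g x)"
    by (subst le_essinf_iff[symmetric]) auto
  with d(1) show "\<exists>d>0. AE x in M. d \<le> g x"
    by auto
next
  assume "\<exists>d>0. AE x in M. d \<le> g x"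
  then obtain d where d: "0 < d" "AE x in M. ereal d \<le> ereal (g x)"
    by auto
  have "0 < ereal d"
    using d(1) by simp
  also have "ereal d \<le> essinf M (\<lambda>x. ereal (g x))"
    using d(2) by (subst le_essinf_iff) auto
  finally show "0 < essinf M (\<lambda>x. ereal (g x))" .
qed

lemma ess_bounded_iff:
  assumes [measurable]: "\<phi> \<in> borel_measurable M"
  shows "ess_bounded M \<phi> \<longleftrightarrow> (\<exists>K. AE x in M. cmod (\<phi> x) \<le> K)"
proof
  assume "ess_bounded M \<phi>"
  then obtain K where "esssup M (\<lambda>x. ereal (cmod (\<phi> x))) < ereal K"
    unfolding ess_bounded_def using ereal_dense2 by blast
  then have "esssup M (\<lambda>x. ereal (cmod (\<phi> x))) \<le> ereal K"
    by simp
  then show "\<exists>K. AE x in M. cmod (\<phi> x) \<le> K"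
    by (subst (asm) esssup_le_iff) auto
next
  assume "\<exists>K. AE x in M. cmod (\<phi> x) \<le> K"
  then obtain K where "AE x in M. ereal (cmod (\<phi> x)) \<le> ereal K"
    by auto
  then have "esssup M (\<lambda>x. ereal (cmod (\<phi> x))) \<le> ereal K"
    by (subst esssup_le_iff) auto
  then show "ess_bounded M \<phi>"
    unfolding ess_bounded_def by (auto intro: le_less_trans)
qed

lemma AE_det_entries_iff:
  fixes F :: "'x \<Rightarrow> complex^('h::finite)^'h"
  assumes F: "\<And>h l. (\<lambda>x. F x $ h $ l) \<in> borel_measurable M"
  shows "(\<exists>d>0. \<exists>K. AE x in M. d \<le> cmod (det (F x)) \<and> (\<forall>h l. cmod (F x $ h $ l) \<le> K)) \<longleftrightarrow>
    (\<forall>h l. ess_bounded M (\<lambda>x. F x $ h $ l)) \<and> 0 < essinf M (\<lambda>x. ereal (cmod (det (F x))))"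
proof -
  have det: "(\<lambda>x. cmod (det (F x))) \<in> borel_measurable M"
    using det_measurable[OF F] by simp
  show ?thesis
    unfolding essinf_pos_iff[OF det] ess_bounded_iff[OF F]
  proof
    assume "\<exists>d>0. \<exists>K. AE x in M. d \<le> cmod (det (F x)) \<and> (\<forall>h l. cmod (F x $ h $ l) \<le> K)"
    then obtain d K where "0 < d" "AE x in M. d \<le> cmod (det (F x)) \<and> (\<forall>h l. cmod (F x $ h $ l) \<le> K)"
      by blast
    then have "AE x in M. cmod (F x $ h $ l) \<le> K" "AE x in M. d \<le> cmod (det (F x))" for h l
      by (auto elim: eventually_mono)
    with \<open>0 < d\<close> show "(\<forall>h l. \<exists>K. AE x in M. cmod (F x $ h $ l) \<le> K) \<and> (\<exists>d>0. AE x in M. d \<le> cmod (det (F x)))"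
      by blast
  next
    assume "(\<forall>h l. \<exists>K. AE x in M. cmod (F x $ h $ l) \<le> K) \<and> (\<exists>d>0. AE x in M. d \<le> cmod (det (F x)))"
    then obtain K d where K: "\<And>h l. AE x in M. cmod (F x $ h $ l) \<le> K h l" and d: "0 < d" "AE x in M. d \<le> cmod (det (F x))"
      by metis
    \<comment> \<open>One bound for the finitely many entries; absolute values make the sum dominate
      each \<open>K h l\<close>.\<close>
    define B where "B = (\<Sum>h\<in>UNIV. \<Sum>l\<in>UNIV. \<bar>K h l\<bar>)"
    have B: "K h l \<le> B" for h l
    proof -
      have "K h l \<le> \<bar>K h l\<bar>" by simp
      also have "\<dots> \<le> (\<Sum>l\<in>UNIV. \<bar>K h l\<bar>)"
        by (rule member_le_sum) auto
      also have "\<dots> \<le> B"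
        unfolding B_def by (rule member_le_sum[where f = "\<lambda>h. \<Sum>l\<in>UNIV. \<bar>K h l\<bar>"]) (auto intro: sum_nonneg)
      finally show ?thesis .
    qed
    have "AE x in M. cmod (F x $ h $ l) \<le> B" for h l
      using K[of h l] B[of h l] by (auto elim!: eventually_mono)
    then have "AE x in M. \<forall>h\<in>UNIV. \<forall>l\<in>UNIV. cmod (F x $ h $ l) \<le> B"
      by (simp only: AE_finite_all[OF finite]) blast
    then have "AE x in M. d \<le> cmod (det (F x)) \<and> (\<forall>h l. cmod (F x $ h $ l) \<le> B)"
      using d(2) by eventually_elim simp
    with d(1) show "\<exists>d>0. \<exists>K. AE x in M. d \<le> cmod (det (F x)) \<and> (\<forall>h l. cmod (F x $ h $ l) \<le> K)"
      by blast
  qed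
qed

lemma matrix_bounds_gram_iff:
  fixes A :: "complex^'h^'h"
  shows "matrix_bounds c C A \<longleftrightarrow> c \<le> lambda_min (conj_transpose A ** A) \<and> lambda_max (conj_transpose A ** A) \<le> C"
  unfolding matrix_bounds_def lambda_min_gram_iff lambda_max_gram_iff by blast

text \<open>By continuity in the vector, the inequalities that characterize the extreme eigenvalues
  need only be tested on a countable dense set, so the level sets are countable intersections of
  measurable sets.\<close>

lemma lambda_measurable:
  fixes F :: "'x \<Rightarrow> complex^('h::finite)^'h"
  assumes [measurable]: "\<And>h l. (\<lambda>x. F x $ h $ l) \<in> borel_measurable M"
  shows "(\<lambda>x. lambda_min (conj_transpose (F x) ** F x)) \<in> borel_measurable M"
    "(\<lambda>x. lambda_max (conj_transpose (F x) ** F x)) \<in> borel_measurable M"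
proof -
  obtain D :: "(complex^'h) set" where D: "countable D" "\<And>X. open X \<Longrightarrow> X \<noteq> {} \<Longrightarrow> \<exists>d\<in>D. d \<in> X"
    using countable_dense_setE by blast
  have [measurable]: "(\<lambda>x. (norm (F x *v d))\<^sup>2) \<in> borel_measurable M" for d
    unfolding vec_norm_sq matrix_vector_mult_def vec_lambda_beta by measurable
  have cont: "continuous_on UNIV (\<lambda>v. F x *v v)" for x
    by (intro linear_continuous_on matrix_vector_linear[unfolded linear_conv_bounded_linear])
  have min: "c \<le> lambda_min (conj_transpose (F x) ** F x) \<longleftrightarrow> (\<forall>d\<in>D. c * (norm d)\<^sup>2 \<le> (norm (F x *v d))\<^sup>2)" for c x
    unfolding lambda_min_gram_iff
  proof (intro iffI allI)
    fix v assume *: "\<forall>d\<in>D. c * (norm d)\<^sup>2 \<le> (norm (F x *v d))\<^sup>2"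
    have "closed {v. c * (norm v)\<^sup>2 \<le> (norm (F x *v v))\<^sup>2}"
      by (intro closed_Collect_le continuous_intros cont)
    from dense_forall_vec[OF D(2) this] * show "c * (norm v)\<^sup>2 \<le> (norm (F x *v v))\<^sup>2"
      by blast
  qed blast
  have max: "lambda_max (conj_transpose (F x) ** F x) \<le> c \<longleftrightarrow> (\<forall>d\<in>D. (norm (F x *v d))\<^sup>2 \<le> c * (norm d)\<^sup>2)" for c x
    unfolding lambda_max_gram_iff
  proof (intro iffI allI)
    fix v assume *: "\<forall>d\<in>D. (norm (F x *v d))\<^sup>2 \<le> c * (norm d)\<^sup>2"
    have "closed {v. (norm (F x *v v))\<^sup>2 \<le> c * (norm v)\<^sup>2}"
      by (intro closed_Collect_le continuous_intros cont)
    from dense_forall_vec[OF D(2) this] * show "(norm (F x *v v))\<^sup>2 \<le> c * (norm v)\<^sup>2"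
      by blast
  qed blast
  show "(\<lambda>x. lambda_min (conj_transpose (F x) ** F x)) \<in> borel_measurable M"
    unfolding borel_measurable_iff_ge min by (intro allI sets.sets_Collect_countable_All' D(1)) measurable
  show "(\<lambda>x. lambda_max (conj_transpose (F x) ** F x)) \<in> borel_measurable M"
    unfolding borel_measurable_iff_le max by (intro allI sets.sets_Collect_countable_All' D(1)) measurable
qed

section \<open>Systems of translates\<close>

text \<open>\<open>axis 0 1\<close> is the column (1, 0, ..., 0): the group \<open>H\<close> is
  written additively, so its identity is the index 0.\<close>

abbreviation dual_generator where
  "dual_generator M \<sigma> f g \<equiv> AE \<xi> in M. conj_transpose (transfer_matrix M \<sigma> f \<xi>) *v transfer_vector M g \<xi> = axis 0 1"

lemma transfer_matrix_nth:
  "transfer_matrix M \<sigma> f \<xi> $ h $ l = transfer_vector M (left_reg \<sigma> (0, l) f) \<xi> $ h"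
  by (simp add: transfer_matrix_def transfer_vector_def left_reg_def)

lemma transfer_matrix_column:
  "transfer_matrix M \<sigma> f \<xi> *v axis l 1 = transfer_vector M (left_reg \<sigma> (0, l) f) \<xi>"
  by (simp add: vec_eq_iff matrix_vector_axis transfer_matrix_nth)

context
  fixes M :: "('n::ab_group_add \<Rightarrow> complex) measure" and \<sigma> :: "'h::{finite,group_add} \<Rightarrow> 'n \<Rightarrow> 'n"
  assumes haar: "dual_haar_measure M" and action: "aut_action \<sigma>"
begin

lemma transfer_matrix_L2: "f \<in> ell2 \<Longrightarrow> (\<lambda>\<xi>. transfer_matrix M \<sigma> f \<xi> $ h $ l) \<in> L2 M"
  unfolding transfer_matrix_nth by (intro transfer_vector_L2[OF haar] left_reg_ell2[OF action])

lemma transfer_matrix_measurable: "f \<in> ell2 \<Longrightarrow> (\<lambda>\<xi>. transfer_matrix M \<sigma> f \<xi> $ h $ l) \<in> borel_measurable M"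
  using transfer_matrix_L2 L2_measurable by blast

lemma transfer_vector_left_reg:
  assumes "f \<in> ell2"
  shows "AE \<xi> in M. transfer_vector M (left_reg \<sigma> (m, l) f) \<xi> = \<xi> (- m) *s (transfer_matrix M \<sigma> f \<xi> *v axis l 1)"
  unfolding transfer_matrix_column
  by (rule transfer_vector_shift[OF haar left_reg_ell2[OF action assms] left_reg_translate[OF action]])

text \<open>The transform of the unit vector at \<open>(m, l)\<close> is \<open>\<xi> (- m)\<close>
  times the \<open>l\<close>-th basis vector, so synthesis and multiplication by \<open>F\<close>
  agree on unit vectors.\<close>

lemma transfer_vector_left_reg_unit:
  assumes "f \<in> ell2"
  shows "AE \<xi> in M. transfer_vector M (left_reg \<sigma> \<gamma> f) \<xi> = transfer_matrix M \<sigma> f \<xi> *v transfer_vector M (ell2_unit \<gamma>) \<xi>"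
proof (cases \<gamma>)
  case (Pair m l)
  show ?thesis
    using transfer_vector_left_reg[OF assms, of m l] transfer_vector_unit[OF haar, of m l]
    unfolding Pair by eventually_elim (simp add: vector_scalar_commute)
qed

text \<open>Extends the identity from unit vectors to all of \<open>ell2\<close>. At this stage the
  entries of \<open>F\<close> are only square-integrable, so multiplication by \<open>F\<close> is
  not known to be continuous in norm. Instead, both \<open>b k\<close> and \<open>S (b k)\<close>
  converge fast enough for their transforms to converge a.e., and at a fixed \<open>\<xi>\<close>
  the matrix acts continuously.\<close>

lemma synthesis_multiplier:
  assumes f: "f \<in> ell2" and S: "ell2_bounded_invertible S" and unit: "\<And>\<gamma>. left_reg \<sigma> \<gamma> f = S (ell2_unit \<gamma>)"
    and a: "a \<in> ell2"
  shows "AE \<xi> in M. transfer_vector M (S a) \<xi> = transfer_matrix M \<sigma> f \<xi> *v transfer_vector M a \<xi>"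
proof -
  obtain G where G: "\<And>k. finite (G k)" "\<And>k m. k \<le> m \<Longrightarrow> G k \<subseteq> G m"
    "\<And>k B. finite B \<Longrightarrow> B \<inter> G k = {} \<Longrightarrow> (\<Sum>i\<in>B. (cmod (a i))\<^sup>2) \<le> (1/4) ^ k"
    using ell2_fast_exhaustion[OF a] by metis
  define b where "b k x = (\<Sum>\<gamma>\<in>G k. a \<gamma> * ell2_unit \<gamma> x)" for k x
  have b: "b k \<in> ell2" for k
    unfolding b_def by (intro ell2_sum ell2_cmult ell2_unit)
  have b_le: "(ell2_norm (\<lambda>x. b k x - a x))\<^sup>2 \<le> 1 * (1/4) ^ k" for k
  proof -
    have "b k x = (if x \<in> G k then a x else 0)" for x
      unfolding b_def using G(1)[of k] by (simp add: ell2_unit_def if_distrib cong: if_cong)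
    then show ?thesis
      using ell2_cutoff_norm_le[OF a G(1) G(3)] by simp
  qed
  obtain C where C: "\<And>u. u \<in> ell2 \<Longrightarrow> (ell2_norm (S u))\<^sup>2 \<le> C * (ell2_norm u)\<^sup>2" "0 \<le> C"
    using ell2_bi_bounded[OF S] by blast
  have Sb_le: "(ell2_norm (\<lambda>x. S (b k) x - S a x))\<^sup>2 \<le> C * (1/4) ^ k" for k
    using order_trans[OF C(1)[OF ell2_diff[OF b a]] mult_left_mono[OF b_le C(2)], of k]
    by (simp add: ell2_bi_diff[OF S b a])
  have "AE \<xi> in M. transfer_vector M (S (b k)) \<xi> = transfer_matrix M \<sigma> f \<xi> *v transfer_vector M (b k) \<xi>" for k
  proof -
    have "AE \<xi> in M. \<forall>\<gamma>\<in>G k. transfer_vector M (left_reg \<sigma> \<gamma> f) \<xi> = transfer_matrix M \<sigma> f \<xi> *v transfer_vector M (ell2_unit \<gamma>) \<xi>"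
      using transfer_vector_left_reg_unit[OF f] by (simp only: AE_finite_all[OF G(1)]) blast
    moreover have "AE \<xi> in M. transfer_vector M (b k) \<xi> = (\<Sum>\<gamma>\<in>G k. a \<gamma> *s transfer_vector M (ell2_unit \<gamma>) \<xi>)"
      unfolding b_def by (rule transfer_vector_sum[OF haar G(1) ell2_unit])
    moreover have "S (b k) = (\<lambda>x. \<Sum>\<gamma>\<in>G k. a \<gamma> * left_reg \<sigma> \<gamma> f x)"
      unfolding b_def unit by (rule ell2_bi_sum[OF S G(1) ell2_unit])
    then have "AE \<xi> in M. transfer_vector M (S (b k)) \<xi> = (\<Sum>\<gamma>\<in>G k. a \<gamma> *s transfer_vector M (left_reg \<sigma> \<gamma> f) \<xi>)"
      using transfer_vector_sum[OF haar G(1) left_reg_ell2[OF action f]] by simp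
    ultimately show ?thesis
      by eventually_elim (simp add: linear_sum[OF matrix_vector_linear] vector_scalar_commute)
  qed
  then have "AE \<xi> in M. \<forall>k. transfer_vector M (S (b k)) \<xi> = transfer_matrix M \<sigma> f \<xi> *v transfer_vector M (b k) \<xi>"
    by (simp add: AE_all_countable)
  then show ?thesis
    using transfer_vector_AE_tendsto[OF haar b a b_le]
      transfer_vector_AE_tendsto[OF haar ell2_bi_mem[OF S b] ell2_bi_mem[OF S a] Sb_le]
  proof eventually_elim
    case (elim \<xi>)
    have "(\<lambda>k. transfer_matrix M \<sigma> f \<xi> *v transfer_vector M (b k) \<xi>) \<longlonglongrightarrow> transfer_matrix M \<sigma> f \<xi> *v transfer_vector M a \<xi>"
      using elim(2) by (rule bounded_linear.tendsto[OF matrix_vector_linear[unfolded linear_conv_bounded_linear]])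
    with elim(1,3) show ?case
      using LIMSEQ_unique by fastforce
  qed
qed

text \<open>In one direction the bounds of the synthesis operator pass to \<open>F\<close>. In the
  other, multiplication by \<open>F\<close> yields an invertible operator, and it sends unit vectors
  to translates because a function is determined by its transfer vector.\<close>

lemma riesz_basis_left_reg_iff:
  assumes f: "f \<in> ell2"
  shows "riesz_basis (\<lambda>\<gamma>. left_reg \<sigma> \<gamma> f) \<longleftrightarrow> (\<exists>c>0. \<exists>C. AE \<xi> in M. matrix_bounds c C (transfer_matrix M \<sigma> f \<xi>))"
proof
  assume "riesz_basis (\<lambda>\<gamma>. left_reg \<sigma> \<gamma> f)"
  then obtain S where S: "ell2_bounded_invertible S" "\<And>\<gamma>. left_reg \<sigma> \<gamma> f = S (ell2_unit \<gamma>)"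
    unfolding riesz_basis_iff by blast
  obtain C where "\<And>a. a \<in> ell2 \<Longrightarrow> (ell2_norm (S a))\<^sup>2 \<le> C * (ell2_norm a)\<^sup>2"
    using ell2_bi_bounded[OF S(1)] by blast
  moreover obtain c where "0 < c" "\<And>a. a \<in> ell2 \<Longrightarrow> c * (ell2_norm a)\<^sup>2 \<le> (ell2_norm (S a))\<^sup>2"
    using ell2_bi_bounded_below[OF S(1)] by blast
  ultimately show "\<exists>c>0. \<exists>C. AE \<xi> in M. matrix_bounds c C (transfer_matrix M \<sigma> f \<xi>)"
    using AE_matrix_bounds_multiplier_iff[OF haar transfer_matrix_measurable[OF f] ell2_bi_mem[OF S(1)] synthesis_multiplier[OF f S], of c C]
    by blast
next
  assume "\<exists>c>0. \<exists>C. AE \<xi> in M. matrix_bounds c C (transfer_matrix M \<sigma> f \<xi>)"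
  then obtain c C where c: "0 < c" "AE \<xi> in M. matrix_bounds c C (transfer_matrix M \<sigma> f \<xi>)"
    by blast
  obtain S where S: "ell2_bounded_invertible S"
    "\<And>a. a \<in> ell2 \<Longrightarrow> AE \<xi> in M. transfer_vector M (S a) \<xi> = transfer_matrix M \<sigma> f \<xi> *v transfer_vector M a \<xi>"
    by (rule multiplier_invertible[OF haar transfer_matrix_measurable[OF f] c]) blast
  have "left_reg \<sigma> \<gamma> f = S (ell2_unit \<gamma>)" for \<gamma>
  proof (rule transfer_vector_inject[OF haar])
    show "AE \<xi> in M. transfer_vector M (left_reg \<sigma> \<gamma> f) \<xi> = transfer_vector M (S (ell2_unit \<gamma>)) \<xi>"
      using transfer_vector_left_reg_unit[OF f, of \<gamma>] S(2)[OF ell2_unit[of \<gamma>]] by eventually_elim simp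
  qed (simp_all add: left_reg_ell2[OF action f] ell2_bi_mem[OF S(1)] ell2_unit)
  then show "riesz_basis (\<lambda>\<gamma>. left_reg \<sigma> \<gamma> f)"
    unfolding riesz_basis_iff using S(1) by blast
qed

text \<open>Admissible lower and upper bounds are exactly the reals at most the essential infimum
  and at least the essential supremum, so optimality is immediate once both are known to be
  finite.\<close>

lemma optimal_riesz_bounds_left_reg:
  assumes f: "f \<in> ell2" and riesz: "riesz_basis (\<lambda>\<gamma>. left_reg \<sigma> \<gamma> f)"
  defines "m \<equiv> \<lambda>\<xi>. lambda_min (conj_transpose (transfer_matrix M \<sigma> f \<xi>) ** transfer_matrix M \<sigma> f \<xi>)"
    and "m' \<equiv> \<lambda>\<xi>. lambda_max (conj_transpose (transfer_matrix M \<sigma> f \<xi>) ** transfer_matrix M \<sigma> f \<xi>)"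
  shows "\<exists>A B. optimal_riesz_bounds (\<lambda>\<gamma>. left_reg \<sigma> \<gamma> f) A B \<and>
    ereal A = essinf M (\<lambda>\<xi>. ereal (m \<xi>)) \<and> ereal B = esssup M (\<lambda>\<xi>. ereal (m' \<xi>))"
proof -
  interpret prob_space M
    by (rule haar_prob[OF haar])
  obtain S where S: "ell2_bounded_invertible S" "\<And>\<gamma>. left_reg \<sigma> \<gamma> f = S (ell2_unit \<gamma>)"
    using riesz unfolding riesz_basis_iff by blast
  have meas: "(\<lambda>\<xi>. ereal (m \<xi>)) \<in> borel_measurable M" "(\<lambda>\<xi>. ereal (m' \<xi>)) \<in> borel_measurable M"
    using lambda_measurable[OF transfer_matrix_measurable[OF f]] unfolding m_def m'_def by simp_all
  have bounds: "riesz_bounds (\<lambda>\<gamma>. left_reg \<sigma> \<gamma> f) A B \<longleftrightarrow>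
      ereal A \<le> essinf M (\<lambda>\<xi>. ereal (m \<xi>)) \<and> esssup M (\<lambda>\<xi>. ereal (m' \<xi>)) \<le> ereal B" for A B
  proof -
    have "riesz_bounds (\<lambda>\<gamma>. left_reg \<sigma> \<gamma> f) A B \<longleftrightarrow> (AE \<xi> in M. matrix_bounds A B (transfer_matrix M \<sigma> f \<xi>))"
      using AE_matrix_bounds_multiplier_iff[OF haar transfer_matrix_measurable[OF f] ell2_bi_mem[OF S(1)] synthesis_multiplier[OF f S], of A B]
        riesz_bounds_iff[OF S(1), of A B]
      unfolding S(2) by (rule trans[OF _ sym, rotated])
    then show ?thesis
      unfolding le_essinf_iff[OF meas(1)] esssup_le_iff[OF meas(2)]
      unfolding matrix_bounds_gram_iff m_def m'_def by simp
  qed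
  obtain c C where "AE \<xi> in M. matrix_bounds c C (transfer_matrix M \<sigma> f \<xi>)"
    using riesz unfolding riesz_basis_left_reg_iff[OF f] by blast
  \<comment> \<open>The middle inequality links the two essential bounds: it bounds the infimum from
    above by \<open>C\<close> and the supremum from below by \<open>c\<close>, so that both are
    real.\<close>
  then have cC: "AE \<xi> in M. c \<le> m \<xi> \<and> m' \<xi> \<le> C \<and> m \<xi> \<le> m' \<xi>"
  proof eventually_elim
    case (elim \<xi>)
    have "m \<xi> * (norm v)\<^sup>2 \<le> m' \<xi> * (norm v)\<^sup>2" for v :: "complex^'h::{finite,group_add}"
      using lambda_min_gram_iff[of "m \<xi>" "transfer_matrix M \<sigma> f \<xi>"] lambda_max_gram_iff[of "transfer_matrix M \<sigma> f \<xi>" "m' \<xi>"]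
      unfolding m_def m'_def by (meson order_refl order_trans)
    from this[of "axis 0 1"] elim show ?case
      unfolding matrix_bounds_gram_iff m_def m'_def by (simp add: norm_axis_one)
  qed
  have fin: "ereal c \<le> essinf M (\<lambda>\<xi>. ereal (m \<xi>))" "esssup M (\<lambda>\<xi>. ereal (m' \<xi>)) \<le> ereal C"
    unfolding le_essinf_iff[OF meas(1)] esssup_le_iff[OF meas(2)] using cC by (auto elim: eventually_mono)
  have "AE \<xi> in M. essinf M (\<lambda>\<xi>. ereal (m \<xi>)) \<le> ereal (m \<xi>)" "AE \<xi> in M. ereal (m' \<xi>) \<le> esssup M (\<lambda>\<xi>. ereal (m' \<xi>))"
    using le_essinf_iff[OF meas(1)] esssup_le_iff[OF meas(2)] by blast+
  then have "AE \<xi> in M. essinf M (\<lambda>\<xi>. ereal (m \<xi>)) \<le> ereal C \<and> ereal c \<le> esssup M (\<lambda>\<xi>. ereal (m' \<xi>))"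
    using cC
  proof eventually_elim
    case (elim \<xi>)
    then have "ereal (m \<xi>) \<le> ereal C" "ereal c \<le> ereal (m' \<xi>)"
      by auto
    with elim show ?case
      by (blast intro: order_trans)
  qed
  \<comment> \<open>A statement independent of \<open>\<xi>\<close> that holds a.e. is true because
    the measure has mass 1.\<close>
  then have "essinf M (\<lambda>\<xi>. ereal (m \<xi>)) \<le> ereal C" "ereal c \<le> esssup M (\<lambda>\<xi>. ereal (m' \<xi>))"
    by (simp_all add: AE_const)
  with fin obtain A B where AB: "ereal A = essinf M (\<lambda>\<xi>. ereal (m \<xi>))" "ereal B = esssup M (\<lambda>\<xi>. ereal (m' \<xi>))"
    by (metis ereal_cases ereal_infty_less_eq(1,2) MInfty_neq_ereal(1) PInfty_neq_ereal(1))
  then show ?thesis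
    unfolding optimal_riesz_bounds_def bounds by (intro exI[of _ A] exI[of _ B]) (auto simp flip: AB)
qed

section \<open>The dual basis\<close>

lemma mult_matrix_inv: "invertible A \<Longrightarrow> A ** matrix_inv A = mat 1"
  unfolding invertible_def matrix_inv_def by (rule someI2_ex) auto

lemma conj_transpose_mult_nth:
  "(conj_transpose A *v v) $ l = (\<Sum>h\<in>UNIV. cnj (A $ h $ l) * v $ h)"
  "(conj_transpose A ** B) $ l $ k = (\<Sum>h\<in>UNIV. cnj (A $ h $ l) * B $ h $ k)"
  by (simp_all add: matrix_vector_mult_def matrix_matrix_mult_def conj_transpose_def)

text \<open>Up to the factor \<open>\<xi> (- m)\<close>, the integrand is the conjugate of the
  \<open>l\<close>-th entry in the equation for \<open>g\<close>, which is 1 for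
  \<open>l = 0\<close> and 0 otherwise; what remains is the integral of a character.\<close>

lemma left_reg_inner_dual:
  assumes f: "f \<in> ell2" and g: "g \<in> ell2"
    and dual: "dual_generator M \<sigma> f g"
  shows "ell2_inner (left_reg \<sigma> \<gamma> f) g = (if \<gamma> = (0, 0) then 1 else 0)"
proof -
  obtain m l where \<gamma>: "\<gamma> = (m, l)" by (cases \<gamma>)
  let ?F = "transfer_matrix M \<sigma> f" and ?g = "transfer_vector M g"
  have "ell2_inner (left_reg \<sigma> \<gamma> f) g = (\<Sum>h\<in>UNIV. \<integral>\<xi>. transfer_vector M (left_reg \<sigma> \<gamma> f) \<xi> $ h * cnj (?g \<xi> $ h) \<partial>M)"
    by (rule transfer_vector_inner[OF haar left_reg_ell2[OF action f] g, symmetric])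
  also have "\<dots> = (\<integral>\<xi>. (\<Sum>h\<in>UNIV. transfer_vector M (left_reg \<sigma> \<gamma> f) \<xi> $ h * cnj (?g \<xi> $ h)) \<partial>M)"
    by (rule Bochner_Integration.integral_sum[symmetric])
      (intro L2_mult_integrable L2_cnj transfer_vector_L2[OF haar] left_reg_ell2[OF action f] g)
  also have "\<dots> = (\<integral>\<xi>. \<xi> (- m) * (if l = 0 then 1 else 0) \<partial>M)"
  proof (rule integral_cong_AE)
    have [measurable]: "(\<lambda>\<xi>. transfer_vector M (left_reg \<sigma> \<gamma> f) \<xi> $ h * cnj (?g \<xi> $ h)) \<in> borel_measurable M" for h
      by (rule borel_measurable_integrable)
        (intro L2_mult_integrable L2_cnj transfer_vector_L2[OF haar] left_reg_ell2[OF action f] g)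
    show "(\<lambda>\<xi>. \<Sum>h\<in>UNIV. transfer_vector M (left_reg \<sigma> \<gamma> f) \<xi> $ h * cnj (?g \<xi> $ h)) \<in> borel_measurable M"
      by measurable
    show "(\<lambda>\<xi>. \<xi> (- m) * (if l = 0 then 1 else 0)) \<in> borel_measurable M"
      using haar_measurable_character[OF haar] by measurable
    show "AE \<xi> in M. (\<Sum>h\<in>UNIV. transfer_vector M (left_reg \<sigma> \<gamma> f) \<xi> $ h * cnj (?g \<xi> $ h)) = \<xi> (- m) * (if l = 0 then 1 else 0)"
      using transfer_vector_left_reg[OF f, of m l] dual
    proof eventually_elim
      case (elim \<xi>)
      have "(\<Sum>h\<in>UNIV. transfer_vector M (left_reg \<sigma> \<gamma> f) \<xi> $ h * cnj (?g \<xi> $ h)) =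
          \<xi> (- m) * cnj ((conj_transpose (?F \<xi>) *v ?g \<xi>) $ l)"
        unfolding \<gamma> elim(1) conj_transpose_mult_nth vector_smult_component matrix_vector_axis
        by (simp add: sum_distrib_left mult_ac)
      then show ?case
        unfolding elim(2) by (simp add: axis_def)
    qed
  qed
  also have "\<dots> = (if \<gamma> = (0, 0) then 1 else 0)"
    using haar_integral_character[OF haar, of "- m"] by (auto simp: \<gamma>)
  finally show ?thesis .
qed

lemma left_reg_biorthogonal:
  assumes f: "f \<in> ell2" and g: "g \<in> ell2"
    and dual: "dual_generator M \<sigma> f g"
  shows "ell2_inner (left_reg \<sigma> \<gamma> f) (left_reg \<sigma> \<delta> g) = (if \<gamma> = \<delta> then 1 else 0)"
  unfolding left_reg_inner_left[OF action] left_reg_inner_dual[OF f g dual] sd_mult_inv_eq_one[OF action] ..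

text \<open>The assumption prescribes only the first column of the product; the others follow from
  biorthogonality with the translates by \<open>(0, k)\<close>. The entries of the product are
  integrable, which is enough for the completeness of the characters.\<close>

lemma transfer_matrix_dual:
  assumes f: "f \<in> ell2" and g: "g \<in> ell2"
    and dual: "dual_generator M \<sigma> f g"
  shows "AE \<xi> in M. conj_transpose (transfer_matrix M \<sigma> f \<xi>) ** transfer_matrix M \<sigma> g \<xi> = mat 1"
proof -
  interpret prob_space M
    by (rule haar_prob[OF haar])
  let ?F = "transfer_matrix M \<sigma> f" and ?G = "transfer_matrix M \<sigma> g"
  have int: "integrable M (\<lambda>\<xi>. cnj (?F \<xi> $ h $ l) * ?G \<xi> $ h $ k)" for h l k
    by (intro L2_mult_integrable L2_cnj transfer_matrix_L2 f g)
  have "AE \<xi> in M. (conj_transpose (?F \<xi>) ** ?G \<xi>) $ l $ k - (if l = k then 1 else 0) = 0" for l k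
  proof (rule haar_characters_complete[OF haar])
    have int_FG: "integrable M (\<lambda>\<xi>. (conj_transpose (?F \<xi>) ** ?G \<xi>) $ l $ k)"
      unfolding conj_transpose_mult_nth by (intro Bochner_Integration.integrable_sum int)
    then show "integrable M (\<lambda>\<xi>. (conj_transpose (?F \<xi>) ** ?G \<xi>) $ l $ k - (if l = k then 1 else 0))"
      by simp
    \<comment> \<open>The Fourier coefficients of \<open>F\<^sup>* G\<close> are inner products of translates of \<open>f\<close> and \<open>g\<close>.\<close>
    fix m :: 'n
    have bd: "\<And>\<xi>. \<xi> \<in> dual_group \<Longrightarrow> cmod (\<xi> m) \<le> 1"
      by (simp add: dual_group_simps)
    have int_F: "integrable M (\<lambda>\<xi>. cnj (?F \<xi> $ h $ l) * ?G \<xi> $ h $ k * \<xi> m)" for h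
      by (intro haar_bounded_mult_integrable[OF haar int haar_measurable_character[OF haar] bd])
    have "(\<integral>\<xi>. (conj_transpose (?F \<xi>) ** ?G \<xi>) $ l $ k * \<xi> m \<partial>M) = (\<Sum>h\<in>UNIV. \<integral>\<xi>. cnj (?F \<xi> $ h $ l) * ?G \<xi> $ h $ k * \<xi> m \<partial>M)"
      unfolding conj_transpose_mult_nth sum_distrib_right by (rule Bochner_Integration.integral_sum) (rule int_F)
    also have "\<dots> = (\<Sum>h\<in>UNIV. \<integral>\<xi>. transfer_vector M (left_reg \<sigma> (0, k) g) \<xi> $ h * cnj (transfer_vector M (left_reg \<sigma> (m, l) f) \<xi> $ h) \<partial>M)"
    proof (rule sum.cong[OF refl])
      fix h
      have [measurable]: "(\<lambda>\<xi>. transfer_vector M (left_reg \<sigma> (0, k) g) \<xi> $ h * cnj (transfer_vector M (left_reg \<sigma> (m, l) f) \<xi> $ h)) \<in> borel_measurable M"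
        by (rule borel_measurable_integrable)
          (intro L2_mult_integrable L2_cnj transfer_vector_L2[OF haar] left_reg_ell2[OF action] f g)
      show "(\<integral>\<xi>. cnj (?F \<xi> $ h $ l) * ?G \<xi> $ h $ k * \<xi> m \<partial>M) =
          (\<integral>\<xi>. transfer_vector M (left_reg \<sigma> (0, k) g) \<xi> $ h * cnj (transfer_vector M (left_reg \<sigma> (m, l) f) \<xi> $ h) \<partial>M)"
      proof (rule integral_cong_AE)
        show "AE \<xi> in M. cnj (?F \<xi> $ h $ l) * ?G \<xi> $ h $ k * \<xi> m =
            transfer_vector M (left_reg \<sigma> (0, k) g) \<xi> $ h * cnj (transfer_vector M (left_reg \<sigma> (m, l) f) \<xi> $ h)"
          using transfer_vector_left_reg[OF f, of m l] haar_AE_dual_group[OF haar]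
        proof eventually_elim
          case (elim \<xi>)
          then show ?case
            by (simp add: matrix_vector_axis dual_group_simps transfer_matrix_nth[of M \<sigma> g])
        qed
      qed (use borel_measurable_integrable[OF int_F] in measurable)
    qed
    also have "\<dots> = ell2_inner (left_reg \<sigma> (0, k) g) (left_reg \<sigma> (m, l) f)"
      by (rule transfer_vector_inner[OF haar left_reg_ell2[OF action g] left_reg_ell2[OF action f]])
    also have "\<dots> = (if l = k \<and> m = 0 then 1 else 0)"
      by (subst ell2_inner_cnj) (simp add: left_reg_biorthogonal[OF f g dual])
    finally have "(\<integral>\<xi>. (conj_transpose (?F \<xi>) ** ?G \<xi>) $ l $ k * \<xi> m \<partial>M) = (if l = k \<and> m = 0 then 1 else 0)" .
    moreover have "integrable M (\<lambda>\<xi>. (conj_transpose (?F \<xi>) ** ?G \<xi>) $ l $ k * \<xi> m)"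
      by (intro haar_bounded_mult_integrable[OF haar int_FG haar_measurable_character[OF haar] bd])
    moreover have "integrable M (\<lambda>\<xi>. (if l = k then 1 else 0) * \<xi> m)"
      by (intro integrable_mult_right haar_L2_integrable[OF haar] haar_character_L2[OF haar])
    ultimately show "(\<integral>\<xi>. ((conj_transpose (?F \<xi>) ** ?G \<xi>) $ l $ k - (if l = k then 1 else 0)) * \<xi> m \<partial>M) = 0"
      using haar_integral_character[OF haar, of m] by (simp add: left_diff_distrib)
  qed
  then have "AE \<xi> in M. \<forall>l\<in>UNIV. \<forall>k\<in>UNIV. (conj_transpose (?F \<xi>) ** ?G \<xi>) $ l $ k - (if l = k then 1 else 0) = 0"
    by (simp only: AE_finite_all[OF finite]) blast
  then show ?thesis
    by eventually_elim (simp add: vec_eq_iff mat_def)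
qed

text \<open>A one-sided inverse of a square matrix is two-sided; conversely, the first column of the
  transfer matrix of \<open>g\<close> is the transfer vector of \<open>g\<close>. Invertibility is
  stated explicitly because \<open>matrix_inv\<close> is arbitrary on singular matrices.\<close>

lemma dual_iff_inverse_transfer_matrix:
  assumes f: "f \<in> ell2" and g: "g \<in> ell2"
  shows "dual_generator M \<sigma> f g \<longleftrightarrow>
    (AE \<xi> in M. invertible (conj_transpose (transfer_matrix M \<sigma> f \<xi>)) \<and>
      transfer_matrix M \<sigma> g \<xi> = matrix_inv (conj_transpose (transfer_matrix M \<sigma> f \<xi>)))"
proof
  assume "dual_generator M \<sigma> f g"
  from transfer_matrix_dual[OF f g this]
  show "AE \<xi> in M. invertible (conj_transpose (transfer_matrix M \<sigma> f \<xi>)) \<and>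
      transfer_matrix M \<sigma> g \<xi> = matrix_inv (conj_transpose (transfer_matrix M \<sigma> f \<xi>))"
  proof eventually_elim
    case (elim \<xi>)
    let ?A = "conj_transpose (transfer_matrix M \<sigma> f \<xi>)" and ?B = "transfer_matrix M \<sigma> g \<xi>"
    have BA: "?B ** ?A = mat 1"
      using elim matrix_left_right_inverse by blast
    with elim have inv: "invertible ?A"
      unfolding invertible_def by blast
    have "?B = ?B ** (?A ** matrix_inv ?A)"
      using mult_matrix_inv[OF inv] by simp
    also have "\<dots> = matrix_inv ?A"
      by (simp add: matrix_mul_assoc BA)
    finally show ?case
      using inv by blast
  qed
next
  assume "AE \<xi> in M. invertible (conj_transpose (transfer_matrix M \<sigma> f \<xi>)) \<and>
      transfer_matrix M \<sigma> g \<xi> = matrix_inv (conj_transpose (transfer_matrix M \<sigma> f \<xi>))"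
  then show "dual_generator M \<sigma> f g"
  proof eventually_elim
    case (elim \<xi>)
    have "transfer_vector M g \<xi> = transfer_matrix M \<sigma> g \<xi> *v axis 0 1"
      by (simp add: transfer_matrix_column left_reg_one[OF action])
    then show ?case
      using elim by (simp add: matrix_vector_mul_assoc mult_matrix_inv)
  qed
qed

text \<open>Multiplication by the conjugate transpose corresponds to an invertible operator
  \<open>S\<close>, and \<open>axis 0 1\<close> is the transform of the unit vector at the group
  identity; the equation becomes \<open>S g = ell2_unit (0, 0)\<close>.\<close>

lemma dual_generator_exists_unique:
  assumes f: "f \<in> ell2" and riesz: "riesz_basis (\<lambda>\<gamma>. left_reg \<sigma> \<gamma> f)"
  shows "\<exists>!g. g \<in> ell2 \<and> dual_generator M \<sigma> f g"
proof -
  let ?A = "\<lambda>\<xi>. conj_transpose (transfer_matrix M \<sigma> f \<xi>)"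
  obtain c C where c: "0 < c" "AE \<xi> in M. matrix_bounds c C (?A \<xi>)"
    using AE_matrix_bounds_conj_transpose riesz unfolding riesz_basis_left_reg_iff[OF f] by blast
  have A: "(\<lambda>\<xi>. ?A \<xi> $ h $ l) \<in> borel_measurable M" for h l
    unfolding conj_transpose_def vec_lambda_beta by (intro L2_measurable L2_cnj transfer_matrix_L2 f)
  obtain S where S: "ell2_bounded_invertible S"
    "\<And>a. a \<in> ell2 \<Longrightarrow> AE \<xi> in M. transfer_vector M (S a) \<xi> = ?A \<xi> *v transfer_vector M a \<xi>"
    by (rule multiplier_invertible[OF haar A c]) blast
  have unit: "AE \<xi> in M. transfer_vector M (ell2_unit (0, 0 :: 'h)) \<xi> = axis 0 1"
    using transfer_vector_unit[OF haar, of 0 0] haar_AE_dual_group[OF haar]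
    by eventually_elim (simp add: dual_group_simps)
  have iff: "(AE \<xi> in M. ?A \<xi> *v transfer_vector M g \<xi> = axis 0 1) \<longleftrightarrow> S g = ell2_unit (0, 0)" if g: "g \<in> ell2" for g
  proof
    assume "AE \<xi> in M. ?A \<xi> *v transfer_vector M g \<xi> = axis 0 1"
    then have "AE \<xi> in M. transfer_vector M (S g) \<xi> = transfer_vector M (ell2_unit (0, 0)) \<xi>"
      using S(2)[OF g] unit by eventually_elim simp
    then show "S g = ell2_unit (0, 0)"
      by (rule transfer_vector_inject[OF haar ell2_bi_mem[OF S(1) g] ell2_unit])
  next
    assume Sg: "S g = ell2_unit (0, 0)"
    show "AE \<xi> in M. ?A \<xi> *v transfer_vector M g \<xi> = axis 0 1"
      using S(2)[OF g] unit unfolding Sg by eventually_elim simp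
  qed
  have inj: "inj_on S ell2"
    using S(1) by (simp add: ell2_bounded_invertible_def bij_betw_def)
  obtain g where g: "g \<in> ell2" "S g = ell2_unit (0, 0)"
    using ell2_bi_surj[OF S(1) ell2_unit] by blast
  show ?thesis
  proof (rule ex1I[of _ g])
    show "g \<in> ell2 \<and> (AE \<xi> in M. ?A \<xi> *v transfer_vector M g \<xi> = axis 0 1)"
      using g iff[OF g(1)] by blast
    fix g' assume g': "g' \<in> ell2 \<and> (AE \<xi> in M. ?A \<xi> *v transfer_vector M g' \<xi> = axis 0 1)"
    then have "S g' = S g"
      using iff[of g'] g(2) by simp
    then show "g' = g"
      using inj g(1) g' by (auto dest: inj_onD)
  qed
qed

text \<open>The transfer matrix of \<open>g\<close> is the inverse of a matrix with uniform bounds,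
  hence has such bounds itself, and the translates of \<open>g\<close> form a Riesz basis. A
  biorthogonal competitor differs from them by vectors orthogonal to all translates of
  \<open>f\<close>, which are total.\<close>

lemma dual_riesz_basis_left_reg:
  assumes f: "f \<in> ell2" and riesz: "riesz_basis (\<lambda>\<gamma>. left_reg \<sigma> \<gamma> f)" and g: "g \<in> ell2"
    and dual: "dual_generator M \<sigma> f g"
  shows "is_dual_riesz_basis (\<lambda>\<gamma>. left_reg \<sigma> \<gamma> f) (\<lambda>\<gamma>. left_reg \<sigma> \<gamma> g)"
  unfolding is_dual_riesz_basis_def
proof (intro conjI allI impI)
  obtain c C where c: "0 < c" and bd: "AE \<xi> in M. matrix_bounds c C (conj_transpose (transfer_matrix M \<sigma> f \<xi>))"
    using AE_matrix_bounds_conj_transpose riesz unfolding riesz_basis_left_reg_iff[OF f] by blast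
  have "AE \<xi> in M. matrix_bounds (1 / max C 1) (1 / c) (transfer_matrix M \<sigma> g \<xi>)"
    using bd transfer_matrix_dual[OF f g dual]
  proof eventually_elim
    case (elim \<xi>)
    \<comment> \<open>\<open>max C 1\<close> makes the upper constant positive, as the inversion of
      the bounds requires.\<close>
    have "matrix_bounds c (max C 1) (conj_transpose (transfer_matrix M \<sigma> f \<xi>))"
      using elim(1) by (rule matrix_bounds_mono) auto
    then show ?case
      by (rule matrix_bounds_inverse) (use c elim(2) in auto)
  qed
  moreover have "0 < 1 / max C 1"
    by simp
  ultimately show "riesz_basis (\<lambda>\<gamma>. left_reg \<sigma> \<gamma> g)"
    unfolding riesz_basis_left_reg_iff[OF g] by blast
  show bi: "biorthogonal (\<lambda>\<gamma>. left_reg \<sigma> \<gamma> f) (\<lambda>\<gamma>. left_reg \<sigma> \<gamma> g)"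
    using left_reg_biorthogonal[OF f g dual] by (simp add: biorthogonal_def)
  fix y assume y: "riesz_basis y \<and> biorthogonal (\<lambda>\<gamma>. left_reg \<sigma> \<gamma> f) y"
  obtain S where S: "ell2_bounded_invertible S" "\<And>\<gamma>. left_reg \<sigma> \<gamma> f = S (ell2_unit \<gamma>)"
    using riesz unfolding riesz_basis_iff by blast
  obtain S' where S': "ell2_bounded_invertible S'" "\<And>\<gamma>. y \<gamma> = S' (ell2_unit \<gamma>)"
    using y unfolding riesz_basis_iff by blast
  show "y = (\<lambda>\<gamma>. left_reg \<sigma> \<gamma> g)"
  proof
    fix \<delta>
    have mem: "y \<delta> \<in> ell2" "left_reg \<sigma> \<delta> g \<in> ell2"
      unfolding S'(2) by (simp_all add: ell2_bi_mem[OF S'(1)] ell2_unit left_reg_ell2[OF action g])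
    have "(\<lambda>x. y \<delta> x - left_reg \<sigma> \<delta> g x) = (\<lambda>_. 0)"
    proof (rule ell2_bi_total[OF S(1) ell2_diff[OF mem]])
      fix \<gamma>
      have "ell2_inner (left_reg \<sigma> \<gamma> f) (\<lambda>x. y \<delta> x - left_reg \<sigma> \<delta> g x) = 0"
        using y bi unfolding ell2_inner_diff_right[OF left_reg_ell2[OF action f] mem] biorthogonal_def by (simp only: diff_self)
      then show "ell2_inner (S (ell2_unit \<gamma>)) (\<lambda>x. y \<delta> x - left_reg \<sigma> \<delta> g x) = 0"
        by (simp only: S(2))
    qed
    then show "y \<delta> = left_reg \<sigma> \<delta> g"
      by (simp add: fun_eq_iff)
  qed
qed

end

text \<open>The optimal bounds are asserted as real numbers equal to the extended real essential
  bounds, so finiteness of the latter is part of the claim.\<close>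

theorem theorem6:
  fixes M :: "('n::ab_group_add \<Rightarrow> complex) measure"
    and \<sigma> :: "'h::{finite,group_add} \<Rightarrow> 'n \<Rightarrow> 'n"
    and f :: "'n \<times> 'h \<Rightarrow> complex"
  defines "F \<equiv> transfer_matrix M \<sigma> f"
  assumes haar: "dual_haar_measure M"
    and action: "aut_action \<sigma>"
    and f: "f \<in> ell2"
  shows
    "(riesz_basis (\<lambda>\<gamma>. left_reg \<sigma> \<gamma> f) \<longleftrightarrow>
        (\<forall>h l. ess_bounded M (\<lambda>\<xi>. F \<xi> $ h $ l)) \<and>
        essinf M (\<lambda>\<xi>. ereal (cmod (det (F \<xi>)))) > 0) \<and>
     (riesz_basis (\<lambda>\<gamma>. left_reg \<sigma> \<gamma> f) \<longrightarrow>
        (\<exists>A B. optimal_riesz_bounds (\<lambda>\<gamma>. left_reg \<sigma> \<gamma> f) A B \<and>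
           ereal A = essinf M (\<lambda>\<xi>. ereal (lambda_min (conj_transpose (F \<xi>) ** F \<xi>))) \<and>
           ereal B = esssup M (\<lambda>\<xi>. ereal (lambda_max (conj_transpose (F \<xi>) ** F \<xi>)))) \<and>
        (\<exists>!g. g \<in> ell2 \<and>
           (AE \<xi> in M. conj_transpose (F \<xi>) *v transfer_vector M g \<xi> = axis 0 1)) \<and>
        (\<forall>g\<in>ell2. (AE \<xi> in M. conj_transpose (F \<xi>) *v transfer_vector M g \<xi> = axis 0 1) \<longrightarrow>
           is_dual_riesz_basis (\<lambda>\<gamma>. left_reg \<sigma> \<gamma> f) (\<lambda>\<gamma>. left_reg \<sigma> \<gamma> g)) \<and>
        (\<forall>g\<in>ell2. (AE \<xi> in M. conj_transpose (F \<xi>) *v transfer_vector M g \<xi> = axis 0 1) \<longleftrightarrow>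
           (AE \<xi> in M. invertible (conj_transpose (F \<xi>)) \<and>
              transfer_matrix M \<sigma> g \<xi> = matrix_inv (conj_transpose (F \<xi>)))))"
  unfolding F_def
proof (intro conjI impI ballI)
  show "riesz_basis (\<lambda>\<gamma>. left_reg \<sigma> \<gamma> f) \<longleftrightarrow>
        (\<forall>h l. ess_bounded M (\<lambda>\<xi>. transfer_matrix M \<sigma> f \<xi> $ h $ l)) \<and>
        essinf M (\<lambda>\<xi>. ereal (cmod (det (transfer_matrix M \<sigma> f \<xi>)))) > 0"
    unfolding riesz_basis_left_reg_iff[OF haar action f] AE_matrix_bounds_iff
    by (rule AE_det_entries_iff[OF transfer_matrix_measurable[OF haar action f]])
qed (rule optimal_riesz_bounds_left_reg[OF haar action f] dual_generator_exists_unique[OF haar action f]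
    dual_riesz_basis_left_reg[OF haar action f] dual_iff_inverse_transfer_matrix[OF haar action f]; assumption)+

end
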